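(* Let $1\le q<\infty$, let $q'$ be the Hölder conjugate of $q$, and let $K$ be a kernel on $\mathbb{R}^n\setminus\{0\}$ such that $K\in H_{q'}$ and, for some constant $A$, $|K(x)|\le \frac{A}{|x|^n}$ for all $x\ne 0$. Let $T$ be a singular integral operator associated with $K$, and suppose that $T$ is bounded on $L^s(\mathbb{R}^n)$ for some $s\in(q,\infty]$ with bound $B$ (that is, $\|Tf\|_{L^s(\mathbb{R}^n)}\le B\|f\|_{L^s(\mathbb{R}^n)}$ for all $f\in L^s(\mathbb{R}^n)$). Let $s'$ be the Hölder conjugate of $s$. Then $T$ is bounded on $L^p(\mathbb{R}^n)$ for every $p$ in the interval $\big(\min(s',q),\max(q',s)\big)$.
   Context: For $1\le r\le\infty$, a (measurable) kernel $K$ defined on $\mathbb{R}^n\setminus\{0\}$ is in the class $H_r$ if $$[K]_{H_r}:=\sup_{R>0}\bigg[\frac{1}{v_nR^n}\int_{|y|\le R}\bigg(\int_{|x|\ge 2R}|K(x-y)-K(x)|\,dx\bigg)^r dy\bigg]^{\frac1r}<\infty,$$ where $v_n$ is the volume of the unit ball $B(0,1)$ in $\mathbb{R}^n$; for $r=\infty$ the $L^r$ average over $|y|\le R$ is replaced by the essential supremum over $|y|\le R$. A singular integral operator associated with $K$ is a linear operator $T$ satisfying $Tf(x)=\int_{\mathbb{R}^n}K(x-y)f(y)\,dy$ for smooth compactly supported functions $f$, and more generally for integrable compactly supported $f$ on which $T$ is defined, and (almost every) $x\notin\operatorname{supp} f$. ($T$ is not uniquely determined by $K$.) For general $f\in L^p(\mathbb{R}^n)$,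 $Tf$ is understood via the extension of $T$ by density from the smooth compactly supported functions; thus boundedness on $L^p(\mathbb{R}^n)$ means that there is a finite constant $C$ with $\|Tf\|_{L^p(\mathbb{R}^n)}\le C\|f\|_{L^p(\mathbb{R}^n)}$ for all smooth compactly supported $f$, and hence for all $f\in L^p(\mathbb{R}^n)$ after extension. *)

theory Defs
  imports "HOL-Analysis.Analysis" "HOL-Probability.Essential_Supremum"
begin

text \<open>Exponents range over \<^typ>\<open>ennreal\<close>, so that \<open>1 / \<infinity> = 0\<close>; in particular \<open>1\<close> and \<open>\<infinity>\<close> are
  conjugate to each other, and both members of a conjugate pair lie in \<open>[1, \<infinity>]\<close>.\<close>

definition holder_conjugate :: "ennreal \<Rightarrow> ennreal \<Rightarrow> bool" where
  "holder_conjugate p p' \<longleftrightarrow> 1 / p + 1 / p' = 1"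

text \<open>Real powers of extended nonnegative numbers, only used with exponent \<open>a > 0\<close>.\<close>

definition ennreal_powr :: "ennreal \<Rightarrow> real \<Rightarrow> ennreal" where
  "ennreal_powr x a = (if x = \<infinity> then \<infinity> else ennreal (enn2real x powr a))"

definition Lp_norm :: "ennreal \<Rightarrow> ('a::euclidean_space \<Rightarrow> complex) \<Rightarrow> ennreal" where
  "Lp_norm p f =
    (if p = \<infinity> then esssup lebesgue (\<lambda>x. ennreal (norm (f x)))
     else ennreal_powr (\<integral>\<^sup>+x. ennreal (norm (f x) powr enn2real p) \<partial>lebesgue) (1 / enn2real p))"

primrec C_k :: "nat \<Rightarrow> ('a::euclidean_space \<Rightarrow> complex) \<Rightarrow> bool" where
  "C_k 0 f \<longleftrightarrow> continuous_on UNIV f"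
| "C_k (Suc k) f \<longleftrightarrow>
    (\<forall>x. f differentiable (at x)) \<and> (\<forall>v. C_k k (\<lambda>x. frechet_derivative f (at x) v))"

definition supp :: "('a::euclidean_space \<Rightarrow> complex) \<Rightarrow> 'a set" where
  "supp f = closure {x. f x \<noteq> 0}"

definition test_functions :: "('a::euclidean_space \<Rightarrow> complex) set" where
  "test_functions = {f. (\<forall>k. C_k k f) \<and> compact (supp f)}"

text \<open>A kernel on \<open>\<real>\<^sup>n - {0}\<close> is a total function whose value at \<open>0\<close> is never used.\<close>

definition hormander_inner :: "(real^'n \<Rightarrow> complex) \<Rightarrow> real \<Rightarrow> real^'n \<Rightarrow> ennreal" where
  "hormander_inner K R y =
    (\<integral>\<^sup>+x\<in>{x. norm x \<ge> 2 * R}. ennreal (norm (K (x - y) - K x)) \<partial>lebesgue)"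

definition hormander_const :: "ennreal \<Rightarrow> (real^'n \<Rightarrow> complex) \<Rightarrow> ennreal" where
  "hormander_const r K = (SUP R\<in>{0<..}.
    if r = \<infinity> then esssup (lebesgue_on (cball 0 R)) (hormander_inner K R)
    else ennreal_powr
      (ennreal (1 / (measure lebesgue (ball 0 1 :: (real^'n) set) * R ^ CARD('n))) *
        (\<integral>\<^sup>+y\<in>cball 0 R. ennreal_powr (hormander_inner K R y) (enn2real r) \<partial>lebesgue))
      (1 / enn2real r))"

definition hormander_class :: "ennreal \<Rightarrow> (real^'n \<Rightarrow> complex) set" where
  "hormander_class r =
    {K. K \<in> borel_measurable (lebesgue_on (- {0})) \<and> hormander_const r K < \<infinity>}"

text \<open>\<open>D\<close> is the domain of \<open>T\<close>. Functions are not identified when they agree almost everywhere, so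
  linearity of \<open>T\<close> is required almost everywhere. The integral converges absolutely for
  \<open>x \<notin> supp f\<close> whenever \<open>K\<close> is bounded away from the origin.\<close>

definition singular_integral_operator ::
  "(real^'n \<Rightarrow> complex) \<Rightarrow> (real^'n \<Rightarrow> complex) set \<Rightarrow>
    ((real^'n \<Rightarrow> complex) \<Rightarrow> (real^'n \<Rightarrow> complex)) \<Rightarrow> bool" where
  "singular_integral_operator K D T \<longleftrightarrow>
    test_functions \<subseteq> D \<and>
    (\<forall>f\<in>D. f \<in> borel_measurable lebesgue \<and> T f \<in> borel_measurable lebesgue) \<and>
    (\<forall>f\<in>D. \<forall>g\<in>D. \<forall>c. (\<lambda>x. c * f x + g x) \<in> D \<and>
      (AE x in lebesgue. T (\<lambda>x. c * f x + g x) x = c * T f x + T g x)) \<and>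
    (\<forall>f\<in>D. integrable lebesgue f \<longrightarrow> compact (supp f) \<longrightarrow>
      (AE x in lebesgue. x \<notin> supp f \<longrightarrow> T f x = (\<integral>y. K (x - y) * f y \<partial>lebesgue)))"

text \<open>Boundedness on \<open>L\<^sup>p\<close> is an a priori estimate on test functions; on \<open>L\<^sup>p\<close> itself the operator
  is the extension by density. For \<open>p = \<infinity>\<close> this is weaker than an estimate on all of
  \<open>L\<^sup>\<infinity>\<close>, as test functions are not dense there.\<close>

definition Lp_bounded_with ::
  "ennreal \<Rightarrow> real \<Rightarrow> (('a::euclidean_space \<Rightarrow> complex) \<Rightarrow> ('a \<Rightarrow> complex)) \<Rightarrow> bool" where
  "Lp_bounded_with p C T \<longleftrightarrow>
    0 \<le> C \<and> (\<forall>f\<in>test_functions. Lp_norm p (T f) \<le> ennreal C * Lp_norm p f)"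

definition Lp_bounded ::
  "ennreal \<Rightarrow> (('a::euclidean_space \<Rightarrow> complex) \<Rightarrow> ('a \<Rightarrow> complex)) \<Rightarrow> bool" where
  "Lp_bounded p T \<longleftrightarrow> (\<exists>C. Lp_bounded_with p C T)"

end

theory Submission
  imports Defs
begin

text \<open>
  Everything is done on test functions, so no extension of \<open>T\<close> is needed.

  Upwards from \<open>q\<close>: at height \<open>t\<close> split \<open>f = g + \<Sum>b\<^sub>j\<close> by stopping the dyadic averages of \<open>\<bar>f\<bar>\<^sup>q\<close>.
  Young's inequality gives \<open>\<bar>b\<bar> h \<le> t ((\<bar>b\<bar> / t)\<^sup>q + h\<^sup>q\<^sup>')\<close>, where \<open>h\<close> is the inner integral in the definition of
  \<open>H\<^sub>q\<^sub>'\<close>; hence \<open>T\<close> of the bad part is controlled off the dilated cubes, and the good part is controlled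
  by the bound on \<open>L\<^sup>s\<close>. Integrating the resulting level set estimate against \<open>t\<^sup>p\<^sup>-\<^sup>1\<close>, for \<open>q < p < s\<close>, yields
  boundedness on \<open>L\<^sup>p\<close> directly. If \<open>T\<close> is already bounded on \<open>L\<^sup>q\<close>, then the bad part is trivially
  controlled and the same argument is the Marcinkiewicz interpolation between \<open>L\<^sup>q\<close> and \<open>L\<^sup>s\<close>.

  Duality: with \<open>(R f) x = f (- x)\<close>, the operator \<open>R T\<^sup>t R\<close> has the same kernel \<open>K\<close> as \<open>T\<close>, so that
  \<open>T - R T\<^sup>t R\<close> is local and hence given by a bounded multiplier. Therefore \<open>T\<close> is bounded on \<open>L\<^sup>p\<close>
  if and only if it is bounded on the dual space, for \<open>1 < p < \<infinity>\<close>.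

  The set of good exponents thus contains \<open>(q, s)\<close> and \<open>(s', q')\<close> and is convex.
\<close>

section \<open>Smooth functions and a partition of unity on a grid\<close>

text \<open>The obstacle is that \<open>T\<close> is controlled on test functions only, so functions
  cannot be cut off sharply along cubes: both parts of a decomposition have to stay smooth.
  Indicators of cubes are therefore replaced by products of smooth hats on a grid of mesh \<delta>
  whose translates add up to one, and f is replaced by its suprema on grid cells. The mesh must
  resolve f and so depends on it, but the constants do not, and one mesh serves all heights t; this
  permits the integration in t. Integrals of |f|^r are used instead of norms because they can be
  summed over cells; Young's inequality takes the place of Hoelder's, and product bounds are
  recovered by scaling. In the duality step no multiplier is constructed. The difference of the two
  bilinear forms vanishes on pairs of cells that do not meet. On a pair that meets, each piece is
  dominated by its supremum on one cell, so bounds with exponents p and p' carry the same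
  information and can be exchanged. The size bound on K makes the double integrals over separated
  supports absolutely convergent, as the change of order of integration requires.\<close>

definition smooth :: "('a::euclidean_space \<Rightarrow> complex) \<Rightarrow> bool" where
  "smooth f \<longleftrightarrow> (\<forall>k. C_k k f)"

text \<open>Uniqueness of the derivative lets an explicit candidate \<open>D\<close> stand in for
  \<open>frechet_derivative\<close>, so that the closure proofs can differentiate by
  formula.\<close>

lemma C_k_SucI:
  assumes "\<And>x. (f has_derivative D x) (at x)" "\<And>v. C_k k (\<lambda>x. D x v)"
  shows "C_k (Suc k) f"
proof -
  have "frechet_derivative f (at x) = D x" for x
    using frechet_derivative_at[OF assms(1)[of x]] by simp
  then show ?thesis using assms by (auto simp: differentiable_def)
qed

lemma C_k_SucD:
  assumes "C_k (Suc k) f"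
  obtains D where "\<And>x. (f has_derivative D x) (at x)" "\<And>v. C_k k (\<lambda>x. D x v)"
  using assms that[of "\<lambda>x. frechet_derivative f (at x)"] by (auto simp: frechet_derivative_works)

text \<open>The product rule keeps undifferentiated factors, so the inductions for products and
  inverses must also lower the order of the factors themselves.\<close>

lemma C_k_Suc_imp: "C_k (Suc k) f \<Longrightarrow> C_k k f"
proof (induction k arbitrary: f)
  case 0
  then show ?case
    by (auto simp: continuous_on_eq_continuous_at intro: differentiable_imp_continuous_within)
next
  case (Suc k)
  then show ?case by (metis C_k.simps(2))
qed

lemma C_k_const: "C_k k (\<lambda>x. c)"
proof (induction k arbitrary: c)
  case (Suc k)
  show ?case by (rule C_k_SucI[where D="\<lambda>x v. 0"]) (auto intro: Suc)
qed simp

lemma C_k_add: "C_k k f \<Longrightarrow> C_k k g \<Longrightarrow> C_k k (\<lambda>x. f x + g x)"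
proof (induction k arbitrary: f g)
  case 0 then show ?case by (auto intro: continuous_intros)
next
  case (Suc k)
  obtain F G where "\<And>x. (f has_derivative F x) (at x)" "\<And>v. C_k k (\<lambda>x. F x v)"
     "\<And>x. (g has_derivative G x) (at x)" "\<And>v. C_k k (\<lambda>x. G x v)"
    using Suc.prems by (metis C_k_SucD)
  then show ?case
    by (intro C_k_SucI[where D="\<lambda>x v. F x v + G x v"] has_derivative_add Suc.IH)
qed

lemma C_k_mult: "C_k k f \<Longrightarrow> C_k k g \<Longrightarrow> C_k k (\<lambda>x. f x * g x)"
proof (induction k arbitrary: f g)
  case 0 then show ?case by (auto intro: continuous_intros)
next
  case (Suc k)
  obtain F G where *: "\<And>x. (f has_derivative F x) (at x)" "\<And>v. C_k k (\<lambda>x. F x v)"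
     "\<And>x. (g has_derivative G x) (at x)" "\<And>v. C_k k (\<lambda>x. G x v)"
    using Suc.prems by (metis C_k_SucD)
  show ?case
    by (rule C_k_SucI[where D="\<lambda>x v. f x * G x v + F x v * g x"])
      (intro has_derivative_mult * C_k_add Suc.IH C_k_Suc_imp[OF Suc.prems(1)] C_k_Suc_imp[OF Suc.prems(2)])+
qed

lemma C_k_inverse: "C_k k f \<Longrightarrow> (\<And>x. f x \<noteq> 0) \<Longrightarrow> C_k k (\<lambda>x. inverse (f x))"
proof (induction k arbitrary: f)
  case 0 then show ?case by (auto intro: continuous_intros)
next
  case (Suc k)
  obtain F where *: "\<And>x. (f has_derivative F x) (at x)" "\<And>v. C_k k (\<lambda>x. F x v)"
    using Suc.prems by (metis C_k_SucD)
  show ?case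
  proof (rule C_k_SucI)
    show "((\<lambda>x. inverse (f x)) has_derivative (\<lambda>v. (- 1) * (inverse (f x) * F x v * inverse (f x)))) (at x)" for x
      using Deriv.has_derivative_inverse[OF Suc.prems(2)[of x] *(1)[of x]] by simp
    show "C_k k (\<lambda>x. (- 1) * (inverse (f x) * F x v * inverse (f x)))" for v
      by (intro C_k_mult C_k_const * Suc.IH[OF C_k_Suc_imp[OF Suc.prems(1)] Suc.prems(2)])
  qed
qed

lemma C_k_affine:
  assumes "bounded_linear L"
  shows "C_k k f \<Longrightarrow> C_k k (\<lambda>x. f (L x + b))"
proof (induction k arbitrary: f)
  case 0
  have "continuous_on UNIV (\<lambda>x. L x + b)"
    using assms by (intro continuous_intros linear_continuous_on)
  with 0 show ?case by (auto intro: continuous_on_compose2)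
next
  case (Suc k)
  obtain F where *: "\<And>x. (f has_derivative F x) (at x)" "\<And>v. C_k k (\<lambda>x. F x v)"
    using Suc.prems by (metis C_k_SucD)
  show ?case
  proof (rule C_k_SucI)
    fix x
    have "((\<lambda>x. L x + b) has_derivative L) (at x)"
      using has_derivative_add[OF bounded_linear.has_derivative[OF assms has_derivative_ident] has_derivative_const]
      by simp
    from has_derivative_compose[OF this *(1)]
    show "((\<lambda>x. f (L x + b)) has_derivative (\<lambda>v. F (L x + b) (L v))) (at x)" .
    show "C_k k (\<lambda>x. F (L x + b) (L v))" for v by (rule Suc.IH) (rule *)
  qed
qed

lemma smooth_const: "smooth (\<lambda>x. c)" by (simp add: smooth_def C_k_const)

lemma smooth_add: "smooth f \<Longrightarrow> smooth g \<Longrightarrow> smooth (\<lambda>x. f x + g x)" by (simp add: smooth_def C_k_add)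

lemma smooth_mult: "smooth f \<Longrightarrow> smooth g \<Longrightarrow> smooth (\<lambda>x. f x * g x)" by (simp add: smooth_def C_k_mult)

lemma smooth_inverse: "smooth f \<Longrightarrow> (\<And>x. f x \<noteq> 0) \<Longrightarrow> smooth (\<lambda>x. inverse (f x))"
  by (simp add: smooth_def C_k_inverse)

lemma smooth_affine: "bounded_linear L \<Longrightarrow> smooth f \<Longrightarrow> smooth (\<lambda>x. f (L x + b))"
  by (simp add: smooth_def C_k_affine)

lemma smooth_prod: "(\<And>i. i \<in> A \<Longrightarrow> smooth (f i)) \<Longrightarrow> smooth (\<lambda>x. \<Prod>i\<in>A. f i x)"
  by (induction A rule: infinite_finite_induct) (auto intro: smooth_const smooth_mult)

lemma smooth_diff: "smooth f \<Longrightarrow> smooth g \<Longrightarrow> smooth (\<lambda>x. f x - g x)"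
  using smooth_add[of f "\<lambda>x. (-1) * g x"] smooth_mult[of "\<lambda>x. -1" g] by (simp add: smooth_const)

lemma smooth_imp_continuous: "smooth f \<Longrightarrow> continuous_on A f"
  unfolding smooth_def using C_k.simps(1) continuous_on_subset by blast

section \<open>A smooth step and a smooth hat from exp(-1/t)\<close>

definition flat_exp :: "real poly \<Rightarrow> real \<Rightarrow> real" where
  "flat_exp P t = (if t > 0 then poly P (1/t) * exp (-(1/t)) else 0)"

lemma tendsto_poly_div_exp: "((\<lambda>x::real. poly P x / exp x) \<longlongrightarrow> 0) at_top"
proof -
  have "((\<lambda>x::real. \<Sum>i\<le>degree P. coeff P i * (x ^ i / exp x)) \<longlongrightarrow> (\<Sum>i\<le>degree P. coeff P i * 0)) at_top"
    by (intro tendsto_sum tendsto_mult tendsto_const tendsto_power_div_exp_0)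
  then show ?thesis by (simp add: poly_altdef sum_divide_distrib)
qed

text \<open>The factor P(1/t) is carried along because the family is then closed under
  differentiation: with X = 1/t, the derivative of P(X) exp(-X) is X^2 (P(X) - P'(X)) exp(-X).
  Smoothness of every order follows by iterating.\<close>

lemma flat_exp_deriv:
  "(flat_exp P has_field_derivative flat_exp ([:0,0,1:] * (P - pderiv P)) t) (at t)"
proof (cases t "0::real" rule: linorder_cases)
  case less
  have "\<forall>\<^sub>F x in nhds t. flat_exp P x = 0"
    using eventually_nhds_in_open[of "{..<0}" t] less
    by (auto simp: flat_exp_def elim!: eventually_mono)
  then show ?thesis using less
    by (subst DERIV_cong_ev[OF refl _ refl, where g="\<lambda>_. 0"]) (auto simp: flat_exp_def)
next
  case greater
  have ev: "\<forall>\<^sub>F x in nhds t. flat_exp P x = poly P (1/x) * exp (-(1/x))"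
    using eventually_nhds_in_open[of "{0<..}" t] greater
    by (auto simp: flat_exp_def elim!: eventually_mono)
  have "((\<lambda>x. poly P (1/x) * exp (-(1/x))) has_field_derivative
      (poly (pderiv P) (1/t) * (- 1 / t^2)) * exp (-(1/t)) + exp (-(1/t)) * (1/t^2) * poly P (1/t)) (at t)"
    using greater
    by (auto intro!: derivative_eq_intros simp: power2_eq_square field_simps)
  then show ?thesis using greater ev
    apply (subst DERIV_cong_ev[OF refl ev refl])
    apply (erule back_subst[where P="\<lambda>d. (_ has_field_derivative d) _"])
    by (auto simp: flat_exp_def power2_eq_square field_simps)
next
  case equal
  \<comment> \<open>The right difference quotient at 0 is X P(X) exp(-X) with X = 1/h, whence the
    polynomial \<open>[:0,1:] * P\<close>.\<close>
  have R: "((\<lambda>h. flat_exp P h / h) \<longlongrightarrow> 0) (at_right 0)"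
  proof -
    have 1: "((\<lambda>h::real. poly ([:0,1:] * P) (inverse h) / exp (inverse h)) \<longlongrightarrow> 0) (at_right 0)"
      using filterlim_compose[OF tendsto_poly_div_exp filterlim_inverse_at_top_right] .
    show ?thesis
      by (rule Lim_transform_eventually[OF 1])
        (auto simp: eventually_at_filter flat_exp_def exp_minus field_simps)
  qed
  have L: "((\<lambda>h. flat_exp P h / h) \<longlongrightarrow> 0) (at_left 0)"
    by (rule Lim_transform_eventually[OF tendsto_const[of 0]])
      (auto simp: eventually_at_filter flat_exp_def)
  from R L have "((\<lambda>h. flat_exp P h / h) \<longlongrightarrow> 0) (at 0)"
    using filterlim_split_at by blast
  then show ?thesis using equal by (simp add: DERIV_def flat_exp_def)
qed

lemma smooth_flat_exp: "smooth (\<lambda>t. complex_of_real (flat_exp P t))"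
proof -
  have "C_k k (\<lambda>t. complex_of_real (flat_exp P t))" for k
  proof (induction k arbitrary: P)
    case 0
    show ?case using flat_exp_deriv
      by (auto intro!: continuous_intros simp: continuous_on_eq_continuous_at intro: DERIV_isCont)
  next
    case (Suc k)
    show ?case
    proof (rule C_k_SucI)
      fix t
      let ?d = "\<lambda>t. flat_exp ([:0,0,1:] * (P - pderiv P)) t"
      have "(flat_exp P has_derivative (\<lambda>v. ?d t * v)) (at t)"
        using flat_exp_deriv by (simp add: has_field_derivative_def)
      from bounded_linear.has_derivative[OF bounded_linear_of_real this]
      show "((\<lambda>t. complex_of_real (flat_exp P t)) has_derivative
        (\<lambda>v. complex_of_real v * complex_of_real (?d t))) (at t)"
        by (simp add: mult.commute)
      show "C_k k (\<lambda>t. complex_of_real v * complex_of_real (?d t))" for v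
        by (intro C_k_mult C_k_const Suc.IH)
    qed
  qed
  then show ?thesis by (simp add: smooth_def)
qed

definition smooth_step :: "real \<Rightarrow> real" where
  "smooth_step t = flat_exp 1 t / (flat_exp 1 t + flat_exp 1 (1 - t))"

lemma flat_exp_1: "flat_exp 1 t \<ge> 0" "t > 0 \<Longrightarrow> flat_exp 1 t > 0" "t \<le> 0 \<Longrightarrow> flat_exp 1 t = 0"
  by (auto simp: flat_exp_def)

lemma smooth_step_denom: "flat_exp 1 t + flat_exp 1 (1 - t) > 0"
  using flat_exp_1(1)[of t] flat_exp_1(1)[of "1 - t"] flat_exp_1(2)[of t] flat_exp_1(2)[of "1 - t"]
  by (cases "t > 0") linarith+

lemma smooth_step_bounds: "0 \<le> smooth_step t" "smooth_step t \<le> 1"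
  using smooth_step_denom[of t] flat_exp_1(1)[of "1-t"] flat_exp_1(1)[of t]
  by (auto simp: smooth_step_def divide_le_eq_1)

lemma smooth_step_le_0: "t \<le> 0 \<Longrightarrow> smooth_step t = 0"
  by (simp add: smooth_step_def flat_exp_1)

lemma smooth_step_ge_1: "t \<ge> 1 \<Longrightarrow> smooth_step t = 1"
  using flat_exp_1(2)[of t] flat_exp_1(3)[of "1 - t"] by (simp add: smooth_step_def)

lemma smooth_smooth_step: "smooth (\<lambda>t. complex_of_real (smooth_step t))"
proof -
  have "smooth (\<lambda>t::real. complex_of_real (flat_exp 1 ((- t) + 1)))"
    by (rule smooth_affine[OF bounded_linear_minus[OF bounded_linear_ident] smooth_flat_exp])
  then have 1: "smooth (\<lambda>t::real. complex_of_real (flat_exp 1 (1 - t)))" by simp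
  have "smooth (\<lambda>t. complex_of_real (flat_exp 1 t) * inverse (complex_of_real (flat_exp 1 t) + complex_of_real (flat_exp 1 (1 - t))))"
    using smooth_step_denom
    by (intro smooth_mult smooth_inverse smooth_add smooth_flat_exp 1)
      (metis of_real_add of_real_eq_0_iff less_irrefl)
  then show ?thesis by (simp add: smooth_step_def divide_inverse)
qed

text \<open>A difference of consecutive translates of the step, so that sums of integer translates
  telescope to one; it vanishes outside [-1, 1].\<close>

definition hat :: "real \<Rightarrow> real" where
  "hat t = smooth_step (t + 1) - smooth_step t"

lemma hat_bounds: "0 \<le> hat t" "hat t \<le> 1"
  using smooth_step_bounds[of t] smooth_step_bounds[of "t+1"] smooth_step_le_0[of t] smooth_step_ge_1[of "t+1"]
  by (cases "t \<le> 0"; auto simp: hat_def)+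

lemma hat_eq_0: "\<bar>t\<bar> \<ge> 1 \<Longrightarrow> hat t = 0"
  using smooth_step_le_0[of t] smooth_step_ge_1[of "t+1"] smooth_step_le_0[of "t+1"] smooth_step_ge_1[of "t"]
  by (cases "t \<le> 0"; auto simp: hat_def)

lemma hat_0: "hat 0 = 1"
  by (simp add: hat_def smooth_step_le_0 smooth_step_ge_1)

lemma smooth_hat: "smooth (\<lambda>t. complex_of_real (hat t))"
  using smooth_diff[OF smooth_affine[OF bounded_linear_ident smooth_smooth_step, of 1] smooth_smooth_step]
  by (simp add: hat_def)

lemma sum_hat_telescope:
  "(\<Sum>k\<in>{- int N..int N}. hat (t - of_int k)) = smooth_step (t + real N + 1) - smooth_step (t - real N)"
proof (induction N)
  case 0 then show ?case by (simp add: hat_def)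
next
  case (Suc N)
  have "{- int (Suc N)..int (Suc N)} = insert (- int (Suc N)) (insert (int (Suc N)) {- int N..int N})"
    by auto
  then have "(\<Sum>k\<in>{- int (Suc N)..int (Suc N)}. hat (t - of_int k))
     = hat (t - (- 1 - real N)) + (hat (t - (1 + real N)) + (\<Sum>k\<in>{- int N..int N}. hat (t - of_int k)))"
    by simp
  also have "\<dots> = smooth_step (t + real (Suc N) + 1) - smooth_step (t - real (Suc N))"
    unfolding Suc by (simp add: hat_def algebra_simps)
  finally show ?case .
qed

lemma sum_hat: "\<bar>t\<bar> \<le> real N \<Longrightarrow> (\<Sum>k\<in>{- int N..int N}. hat (t - of_int k)) = 1"
  unfolding sum_hat_telescope by (simp add: smooth_step_le_0 smooth_step_ge_1)

lemma sum_hat_le: "(\<Sum>k\<in>{- int N..int N}. hat (t - of_int k)) \<le> 1"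
  unfolding sum_hat_telescope using smooth_step_bounds[of "t + real N + 1"] smooth_step_bounds[of "t - real N"] by simp

section \<open>A smooth partition of unity on the grid\<close>

definition grid_bump :: "real \<Rightarrow> ('n \<Rightarrow> int) \<Rightarrow> real^'n \<Rightarrow> real" where
  "grid_bump \<delta> c x = (\<Prod>i\<in>UNIV. hat (x $ i / \<delta> - of_int (c i)))"

text \<open>The set carrying the bump at node \<open>c\<close>. Its centre is
  \<open>\<delta> c\<close> and its side is \<open>2 \<delta>\<close>, so neighbouring cubes
  overlap.\<close>

definition grid_cube :: "real \<Rightarrow> ('n \<Rightarrow> int) \<Rightarrow> (real^'n) set" where
  "grid_cube \<delta> c = {x. \<forall>i. \<bar>x $ i - \<delta> * of_int (c i)\<bar> \<le> \<delta>}"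

definition grid_box :: "nat \<Rightarrow> ('n::finite \<Rightarrow> int) set" where
  "grid_box N = {c. \<forall>i. c i \<in> {- int N..int N}}"

lemma grid_box_PiE: "grid_box N = PiE UNIV (\<lambda>i. {- int N..int N})"
  by (auto simp: grid_box_def PiE_def Pi_def extensional_def)

lemma finite_grid_box: "finite (grid_box N)"
  unfolding grid_box_PiE by (intro finite_PiE) auto

lemma card_grid_box: "card (grid_box N :: ('n::finite \<Rightarrow> int) set) = (2 * N + 1) ^ CARD('n)"
  unfolding grid_box_PiE by (subst card_PiE) (auto simp: nat_add_distrib nat_mult_distrib)

lemma finite_subset_grid_box: "finite S \<Longrightarrow> \<exists>N. S \<subseteq> grid_box N"
proof (induction rule: finite_induct)
  case (insert c S)
  then obtain N where N: "S \<subseteq> grid_box N" by auto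
  define M where "M = Max (range (\<lambda>i. nat \<bar>c i\<bar>))"
  have "nat \<bar>c i\<bar> \<le> M" for i unfolding M_def by simp
  then have "c \<in> grid_box M" by (auto simp: grid_box_def) (smt (verit) nat_le_iff)+
  then have "insert c S \<subseteq> grid_box (max M N)" using N
    by (auto simp: grid_box_def subset_iff; smt (verit) of_nat_mono max.cobounded1 max.cobounded2)
  then show ?case by blast
qed simp

lemma grid_bump_bounds: "0 \<le> grid_bump \<delta> c x" "grid_bump \<delta> c x \<le> 1"
  unfolding grid_bump_def by (auto intro!: prod_nonneg prod_le_1 hat_bounds)

lemma grid_bump_eq_0: "0 < \<delta> \<Longrightarrow> x \<notin> grid_cube \<delta> c \<Longrightarrow> grid_bump \<delta> c x = 0"
proof -
  assume d: "0 < \<delta>" and "x \<notin> grid_cube \<delta> c"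
  then obtain i where "\<bar>x $ i - \<delta> * of_int (c i)\<bar> > \<delta>" by (auto simp: grid_cube_def not_le)
  then have "\<bar>x $ i / \<delta> - of_int (c i)\<bar> \<ge> 1" using d
    by (auto simp: abs_if field_simps split: if_splits)
  then have "hat (x $ i / \<delta> - of_int (c i)) = 0" by (rule hat_eq_0)
  then show ?thesis unfolding grid_bump_def by (intro prod_zero) auto
qed

lemma smooth_grid_bump: "smooth (\<lambda>x::real^'n. complex_of_real (grid_bump \<delta> c x))"
proof -
  have "smooth (\<lambda>x::real^'n. complex_of_real (hat (x $ i / \<delta> + - of_int (c i))))" for i
    by (rule smooth_affine[OF _ smooth_hat])
      (intro bounded_linear_divide bounded_linear_compose[OF bounded_linear_divide] bounded_linear_vec_nth)
  then show ?thesis unfolding grid_bump_def of_real_prod by (intro smooth_prod) simp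
qed

lemma sum_grid_bump_box:
  "(\<Sum>c\<in>grid_box N. grid_bump \<delta> c x) = (\<Prod>i\<in>UNIV. \<Sum>k\<in>{- int N..int N}. hat (x $ i / \<delta> - of_int k))"
  unfolding grid_bump_def grid_box_PiE by (subst prod_sum_PiE) auto

lemma sum_grid_bump_eq_1:
  assumes "0 < \<delta>" "\<And>i. \<bar>x $ i\<bar> \<le> real N * \<delta>"
  shows "(\<Sum>c\<in>grid_box N. grid_bump \<delta> c x) = 1"
proof -
  have "\<bar>x $ i / \<delta>\<bar> \<le> real N" for i using assms by (simp add: divide_le_eq)
  then show ?thesis unfolding sum_grid_bump_box by (simp add: sum_hat)
qed

text \<open>A finite index set lies in a box, where the sum factors into telescoping one-dimensional
  sums. Bumps can thus serve as weights of total at most one.\<close>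

lemma sum_grid_bump_le_1:
  assumes "finite S" shows "(\<Sum>c\<in>S. grid_bump \<delta> c x) \<le> 1"
proof -
  obtain N where N: "S \<subseteq> grid_box N" using finite_subset_grid_box[OF assms] by auto
  have "(\<Sum>c\<in>S. grid_bump \<delta> c x) \<le> (\<Sum>c\<in>grid_box N. grid_bump \<delta> c x)"
    using N by (intro sum_mono2 finite_grid_box) (auto simp: grid_bump_bounds)
  also have "\<dots> \<le> 1" unfolding sum_grid_bump_box
    by (intro prod_le_1) (auto simp: sum_hat_le intro!: sum_nonneg hat_bounds)
  finally show ?thesis .
qed

section \<open>Test functions and sampling on a grid\<close>

lemma test_functions_iff: "f \<in> test_functions \<longleftrightarrow> smooth f \<and> compact (supp f)"
  by (simp add: test_functions_def smooth_def)

lemma supp_superset: "f x \<noteq> 0 \<Longrightarrow> x \<in> supp f"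
  unfolding supp_def by (rule subsetD[OF closure_subset]) simp

lemma test_functionI:
  assumes "smooth f" "\<And>x. x \<notin> S \<Longrightarrow> f x = 0" "bounded S"
  shows "f \<in> test_functions"
proof -
  have "{x. f x \<noteq> 0} \<subseteq> S" using assms(2) by auto
  then have "bounded {x. f x \<noteq> 0}" using assms(3) bounded_subset by blast
  then show ?thesis using assms(1) by (simp add: test_functions_iff supp_def compact_closure)
qed

lemma test_bounded_supp: "f \<in> test_functions \<Longrightarrow> bounded {x. f x \<noteq> 0}"
  by (simp add: test_functions_iff supp_def compact_closure)

lemma test_smooth: "f \<in> test_functions \<Longrightarrow> smooth f"
  by (simp add: test_functions_iff)

lemma test_vanish:
  assumes "f \<in> test_functions"
  obtains \<rho> where "\<rho> > 0" "\<And>x. norm x > \<rho> \<Longrightarrow> f x = 0"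
proof -
  obtain \<rho> where "\<rho> > 0" "\<forall>x\<in>{x. f x \<noteq> 0}. norm x \<le> \<rho>"
    using test_bounded_supp[OF assms] unfolding bounded_pos by auto
  then show ?thesis using that by fastforce
qed

lemma test_mult: "smooth h \<Longrightarrow> f \<in> test_functions \<Longrightarrow> (\<lambda>x. h x * f x) \<in> test_functions"
  by (rule test_functionI[where S="{x. f x \<noteq> 0}"]) (auto intro: smooth_mult test_smooth test_bounded_supp)

lemma test_cmult: "f \<in> test_functions \<Longrightarrow> (\<lambda>x. c * f x) \<in> test_functions"
  by (intro test_mult smooth_const)

lemma test_add: "f \<in> test_functions \<Longrightarrow> g \<in> test_functions \<Longrightarrow> (\<lambda>x. f x + g x) \<in> test_functions"
  by (rule test_functionI[where S="{x. f x \<noteq> 0} \<union> {x. g x \<noteq> 0}"])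
    (auto intro: smooth_add test_smooth test_bounded_supp)

lemma test_zero: "(\<lambda>x. 0) \<in> test_functions"
  by (rule test_functionI[where S="{}"]) (auto intro: smooth_const)

lemma test_diff: "f \<in> test_functions \<Longrightarrow> g \<in> test_functions \<Longrightarrow> (\<lambda>x. f x - g x) \<in> test_functions"
  using test_add[of f "\<lambda>x. (-1) * g x"] test_cmult[of g "-1"] by simp

lemma test_sum: "(\<And>i. i \<in> A \<Longrightarrow> f i \<in> test_functions) \<Longrightarrow> (\<lambda>x. \<Sum>i\<in>A. f i x) \<in> test_functions"
  by (induction A rule: infinite_finite_induct) (auto intro: test_add test_zero)

lemma test_reflect: "f \<in> test_functions \<Longrightarrow> (\<lambda>x. f (- x)) \<in> test_functions"
proof -
  assume f: "f \<in> test_functions"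
  have "smooth (\<lambda>x. f (- x + 0))"
    by (rule smooth_affine[OF bounded_linear_minus[OF bounded_linear_ident] test_smooth[OF f]])
  moreover have "bounded (uminus ` {x. f x \<noteq> 0})"
    by (rule bounded_linear_image[OF test_bounded_supp[OF f] bounded_linear_minus[OF bounded_linear_ident]])
  ultimately show ?thesis
    by (intro test_functionI[where S="uminus ` {x. f x \<noteq> 0}"]) (simp_all add: image_iff, metis minus_minus)
qed

lemma bounded_grid_cube: "bounded (grid_cube \<delta> c)"
proof -
  have "norm x \<le> (\<Sum>i\<in>UNIV. \<bar>\<delta> * of_int (c i)\<bar> + \<bar>\<delta>\<bar>)" if "x \<in> grid_cube \<delta> c" for x
  proof -
    have "norm x \<le> (\<Sum>i\<in>UNIV. \<bar>x $ i\<bar>)" by (rule norm_le_l1_cart)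
    also have "\<dots> \<le> (\<Sum>i\<in>UNIV. \<bar>\<delta> * of_int (c i)\<bar> + \<bar>\<delta>\<bar>)"
    proof (rule sum_mono)
      fix i show "\<bar>x $ i\<bar> \<le> \<bar>\<delta> * of_int (c i)\<bar> + \<bar>\<delta>\<bar>"
        using that unfolding grid_cube_def by (auto dest!: spec[of _ i])
    qed
    finally show ?thesis .
  qed
  then show ?thesis unfolding bounded_iff by blast
qed

lemma closed_grid_cube: "closed (grid_cube \<delta> c)"
  unfolding grid_cube_def by (intro closed_Collect_all closed_Collect_le continuous_intros)

lemma test_grid_bump: "0 < \<delta> \<Longrightarrow> (\<lambda>x::real^'n. complex_of_real (grid_bump \<delta> c x)) \<in> test_functions"
  by (rule test_functionI[where S="grid_cube \<delta> c"])
    (auto intro: smooth_grid_bump bounded_grid_cube simp: grid_bump_eq_0)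

lemma test_continuous: "f \<in> test_functions \<Longrightarrow> continuous_on A f"
  by (rule smooth_imp_continuous[OF test_smooth])

lemma test_borel: "f \<in> test_functions \<Longrightarrow> f \<in> borel_measurable borel"
  by (intro borel_measurable_continuous_onI test_continuous)

lemma test_lebesgue: "f \<in> test_functions \<Longrightarrow> f \<in> borel_measurable lebesgue"
  by (simp add: measurable_completion test_borel)

lemma test_bound:
  assumes "f \<in> test_functions" obtains M where "M > 0" "\<And>x. norm (f x) \<le> M"
proof -
  obtain \<rho> where \<rho>: "\<rho> > 0" "\<And>x. norm x > \<rho> \<Longrightarrow> f x = 0" using test_vanish[OF assms] by blast
  have "bounded (f ` cball 0 \<rho>)"
    by (intro compact_imp_bounded compact_continuous_image test_continuous[OF assms]) auto
  then obtain M where M: "M > 0" "\<forall>x\<in>cball 0 \<rho>. norm (f x) \<le> M"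
    unfolding bounded_pos by auto
  have "norm (f x) \<le> M" for x
    using M \<rho>(2)[of x] by (cases "norm x \<le> \<rho>") auto
  then show ?thesis using that M by blast
qed

lemma test_uniformly_continuous:
  assumes "f \<in> test_functions" "\<omega> > 0"
  obtains d where "d > 0" "\<And>x y. dist x y < d \<Longrightarrow> norm (f x - f y) < \<omega>"
proof -
  obtain \<rho> where \<rho>: "\<rho> > 0" "\<And>x. norm x > \<rho> \<Longrightarrow> f x = 0" using test_vanish[OF assms(1)] by blast
  \<comment> \<open>The margin 1 handles pairs near the boundary: of two points at distance less
    than 1, if one has norm above \<rho> + 1 then both have norm above \<rho>, where f
    vanishes.\<close>
  have "uniformly_continuous_on (cball 0 (\<rho> + 1)) f"
    by (intro compact_uniformly_continuous test_continuous[OF assms(1)]) auto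
  then obtain d where d: "d > 0" "\<forall>x\<in>cball 0 (\<rho>+1). \<forall>y\<in>cball 0 (\<rho>+1). dist x y < d \<longrightarrow> dist (f x) (f y) < \<omega>"
    unfolding uniformly_continuous_on_def using assms(2) by (metis dist_commute)
  have "norm (f x - f y) < \<omega>" if xy: "dist x y < min d 1" for x y
  proof (cases "norm x \<le> \<rho> + 1 \<and> norm y \<le> \<rho> + 1")
    case True then show ?thesis using d(2) xy by (auto simp: dist_norm)
  next
    case False
    have "\<bar>norm x - norm y\<bar> \<le> dist x y" using norm_triangle_ineq3 by (simp add: dist_norm)
    then have "norm x > \<rho>" "norm y > \<rho>" using False xy by auto
    then show ?thesis using \<rho>(2) assms(2) by simp
  qed
  then show ?thesis using that[of "min d 1"] d(1) by auto
qed

lemma grid_bump_borel: "grid_bump \<delta> c \<in> borel_measurable borel"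
proof -
  have "continuous_on UNIV (\<lambda>x. Re (complex_of_real (grid_bump \<delta> c x)))"
    by (intro continuous_intros smooth_imp_continuous smooth_grid_bump)
  then show ?thesis by (intro borel_measurable_continuous_onI) simp
qed

lemma lebesgue_measurable_borel: "f \<in> borel_measurable borel \<Longrightarrow> f \<in> borel_measurable lebesgue"
  by (simp add: measurable_completion)

section \<open>Mass of a bump and power integrals\<close>

lemma nn_integral_affine:
  fixes f :: "'a::euclidean_space \<Rightarrow> ennreal"
  assumes [measurable]: "f \<in> borel_measurable borel" and c: "c \<noteq> 0"
  shows "(\<integral>\<^sup>+x. f x \<partial>lborel) = ennreal (\<bar>c\<bar> ^ DIM('a)) * (\<integral>\<^sup>+x. f (t + c *\<^sub>R x) \<partial>lborel)"
  by (subst lborel_affine[OF c, of t])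
     (simp add: nn_integral_density nn_integral_distr nn_integral_cmult)

text \<open>The factor of proportionality between a count of cells, weighted by the volume
  \<delta>^n, and a Lebesgue integral. It is positive, so either can be estimated by the
  other.\<close>

definition bump_mass :: "'n::finite itself \<Rightarrow> real" where
  "bump_mass _ = enn2real (\<integral>\<^sup>+x. ennreal (grid_bump 1 (\<lambda>i::'n. 0) x) \<partial>lborel)"

lemma nn_integral_grid_bump_1:
  "(\<integral>\<^sup>+x. ennreal (grid_bump 1 (\<lambda>i::'n::finite. 0) x) \<partial>lborel) = ennreal (bump_mass TYPE('n))" (is "?I = _")
  and bump_mass_pos: "bump_mass TYPE('n) > 0"
proof -
  let ?\<phi> = "grid_bump 1 (\<lambda>i::'n. 0)"
  have "?I \<le> (\<integral>\<^sup>+x. indicator (grid_cube 1 (\<lambda>i::'n. 0)) x \<partial>lborel)"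
    by (intro nn_integral_mono) (auto simp: indicator_def grid_bump_eq_0 intro!: grid_bump_bounds)
  also have "\<dots> = emeasure lborel (grid_cube 1 (\<lambda>i::'n. 0))"
    by (intro nn_integral_indicator) (simp add: closed_grid_cube borel_closed)
  also have "\<dots> < \<infinity>" using bounded_grid_cube by (rule emeasure_bounded_finite)
  finally have fin: "?I < \<infinity>" .
  then show 1: "?I = ennreal (bump_mass TYPE('n))" by (simp add: bump_mass_def)
  \<comment> \<open>A vanishing integral would make the open set where the bump is nonzero
    negligible, yet that set contains 0.\<close>
  have "?I \<noteq> 0"
  proof
    assume "?I = 0"
    have "(\<lambda>x. ennreal (?\<phi> x)) \<in> borel_measurable lborel"
      using grid_bump_borel by (intro measurable_compose[OF _ measurable_ennreal]) simp
    from nn_integral_0_iff_AE[OF this] \<open>?I = 0\<close> have "AE x in lborel. ennreal (?\<phi> x) = 0" by simp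
    then have "AE x in lborel. ?\<phi> x = 0"
      by (rule AE_mp) (intro AE_I2 impI order_antisym, simp_all add: grid_bump_bounds ennreal_eq_0_iff)
    moreover have "continuous_on UNIV (\<lambda>x. Re (complex_of_real (?\<phi> x)))"
      by (intro continuous_intros smooth_imp_continuous smooth_grid_bump)
    then have op: "open {x. ?\<phi> x \<noteq> 0}" by (intro open_Collect_neq) auto
    ultimately have "{x. ?\<phi> x \<noteq> 0} \<in> null_sets lborel"
      using borel_open[OF op] by (subst AE_iff_null_sets) auto
    then have "negligible {x. ?\<phi> x \<noteq> 0}"
      by (simp add: negligible_iff_null_sets null_sets_completionI)
    moreover have "0 \<in> {x. ?\<phi> x \<noteq> 0}" by (simp add: grid_bump_def hat_0)
    ultimately show False using op open_not_negligible by blast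
  qed
  then have "ennreal (bump_mass TYPE('n)) > 0" using 1 by (simp add: zero_less_iff_neq_zero)
  then show "bump_mass TYPE('n) > 0" by simp
qed

lemma nn_integral_grid_bump:
  assumes "0 < \<delta>"
  shows "(\<integral>\<^sup>+x. ennreal (grid_bump \<delta> (c::'n::finite \<Rightarrow> int) x) \<partial>lebesgue) = ennreal (bump_mass TYPE('n) * \<delta> ^ CARD('n))"
proof -
  have "(\<integral>\<^sup>+x. ennreal (grid_bump \<delta> c x) \<partial>lborel)
     = ennreal (\<delta> ^ CARD('n)) * (\<integral>\<^sup>+x. ennreal (grid_bump \<delta> c ((\<chi> i. \<delta> * of_int (c i)) + \<delta> *\<^sub>R x)) \<partial>lborel)"
    using assms grid_bump_borel[of \<delta> c] by (subst nn_integral_affine[where c=\<delta>]) auto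
  also have "(\<lambda>x. grid_bump \<delta> c ((\<chi> i. \<delta> * of_int (c i)) + \<delta> *\<^sub>R x)) = grid_bump 1 (\<lambda>i. 0)"
    using assms by (auto simp: grid_bump_def fun_eq_iff add_divide_distrib)
  finally show ?thesis
    using assms less_imp_le[OF bump_mass_pos[where 'n='n]]
    by (simp add: nn_integral_completion nn_integral_grid_bump_1 mult.commute ennreal_mult')
qed

text \<open>The root in the norm is left out so that bounds for pieces can be summed; it returns
  only in the conversions from and to \<open>Lp_norm\<close>.\<close>

definition power_integral :: "real \<Rightarrow> ('a::euclidean_space \<Rightarrow> complex) \<Rightarrow> ennreal" where
  "power_integral r f = (\<integral>\<^sup>+x. ennreal (norm (f x) powr r) \<partial>lebesgue)"

lemma power_integral_test_finite:
  assumes "f \<in> test_functions" "r > 0" shows "power_integral r f < \<infinity>"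
proof -
  obtain M where M: "M > 0" "\<And>x. norm (f x) \<le> M" using test_bound[OF assms(1)] by blast
  have "power_integral r f \<le> (\<integral>\<^sup>+x. ennreal (M powr r) * indicator (supp f) x \<partial>lborel)"
    unfolding power_integral_def nn_integral_completion using assms(2) M supp_superset[of f]
    by (intro nn_integral_mono) (auto simp: indicator_def intro!: ennreal_leI powr_mono2)
  also have "\<dots> = ennreal (M powr r) * emeasure lborel (supp f)"
    by (intro nn_integral_cmult_indicator) (simp add: supp_def)
  also have "\<dots> < \<infinity>"
    using assms(1) emeasure_bounded_finite[of "supp f"]
    by (auto simp: test_functions_iff compact_imp_bounded ennreal_mult_less_top)
  finally show ?thesis .
qed

text \<open>Normalising weights of total s \<le> 1 produces the factor s powr (r - 1), which is at
  most 1. Terms with zero weight or zero value are discarded before convexity is used.\<close>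

lemma jensen_subweights:
  fixes w u :: "'i \<Rightarrow> real"
  assumes "finite S" "\<And>i. i \<in> S \<Longrightarrow> 0 \<le> w i" "(\<Sum>i\<in>S. w i) \<le> 1" "\<And>i. i \<in> S \<Longrightarrow> 0 \<le> u i" "1 \<le> r"
  shows "(\<Sum>i\<in>S. w i * u i) powr r \<le> (\<Sum>i\<in>S. w i * u i powr r)"
proof -
  define S' where "S' = {i\<in>S. w i > 0 \<and> u i > 0}"
  define s where "s = (\<Sum>i\<in>S'. w i)"
  have S': "finite S'" "S' \<subseteq> S" using assms(1) by (auto simp: S'_def)
  have e1: "(\<Sum>i\<in>S. w i * u i) = (\<Sum>i\<in>S'. w i * u i)"
    by (intro sum.mono_neutral_right assms S') (use assms in \<open>force simp: S'_def\<close>)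
  have e2: "(\<Sum>i\<in>S. w i * u i powr r) = (\<Sum>i\<in>S'. w i * u i powr r)"
    by (intro sum.mono_neutral_right assms S') (use assms in \<open>force simp: S'_def\<close>)
  show ?thesis
  proof (cases "S' = {}")
    case True then show ?thesis using e1 e2 by simp
  next
    case False
    have s: "s > 0" unfolding s_def using False S' by (intro sum_pos) (auto simp: S'_def)
    have "s \<le> (\<Sum>i\<in>S. w i)" unfolding s_def using assms S' by (intro sum_mono2) auto
    then have s1: "s \<le> 1" using assms by simp
    have "(\<Sum>i\<in>S'. (w i / s) *\<^sub>R u i) powr r \<le> (\<Sum>i\<in>S'. (w i / s) * u i powr r)"
      using False S' s assms(2)
      by (intro convex_on_sum[OF _ _ powr_convex[OF assms(5)]])
        (auto simp: S'_def sum_divide_distrib[symmetric] s_def[unfolded S'_def])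
    also have "\<dots> = (\<Sum>i\<in>S'. w i * u i powr r) / s" by (simp add: sum_divide_distrib)
    finally have "((\<Sum>i\<in>S'. w i * u i) / s) powr r \<le> (\<Sum>i\<in>S'. w i * u i powr r) / s"
      by (simp add: sum_divide_distrib)
    then have "(\<Sum>i\<in>S'. w i * u i) powr r \<le> (\<Sum>i\<in>S'. w i * u i powr r) * (s powr r / s)"
      using s by (subst (asm) powr_divide)
        (auto simp: field_simps S'_def intro!: sum_nonneg)
    also have "s powr r / s = s powr (r - 1)" using s by (simp add: powr_diff)
    also have "(\<Sum>i\<in>S'. w i * u i powr r) * s powr (r - 1) \<le> (\<Sum>i\<in>S'. w i * u i powr r) * 1"
      using s s1 assms(5) by (intro mult_left_mono powr_le1 sum_nonneg) (auto simp: S'_def)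
    finally show ?thesis using e1 e2 by simp
  qed
qed

lemma nn_integral_sum_grid_bump:
  assumes "0 < \<delta>" "\<And>c. c \<in> S \<Longrightarrow> 0 \<le> u c"
  shows "(\<integral>\<^sup>+x. ennreal (\<Sum>c\<in>S. grid_bump \<delta> c (x::real^'n) * u c) \<partial>lebesgue)
    = ennreal (bump_mass TYPE('n) * \<delta> ^ CARD('n) * (\<Sum>c\<in>S. u c))"
proof -
  have m[measurable]: "(\<lambda>x. ennreal (grid_bump \<delta> c x)) \<in> borel_measurable lebesgue" for c :: "'n \<Rightarrow> int"
    by (intro lebesgue_measurable_borel measurable_compose[OF grid_bump_borel measurable_ennreal])
  have "(\<integral>\<^sup>+x. ennreal (\<Sum>c\<in>S. grid_bump \<delta> c x * u c) \<partial>lebesgue)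
    = (\<integral>\<^sup>+x. (\<Sum>c\<in>S. ennreal (grid_bump \<delta> c x) * ennreal (u c)) \<partial>lebesgue)"
    using assms by (intro nn_integral_cong)
      (simp add: sum_ennreal[symmetric] ennreal_mult' grid_bump_bounds mult.commute)
  also have "\<dots> = (\<Sum>c\<in>S. ennreal (bump_mass TYPE('n) * \<delta> ^ CARD('n)) * ennreal (u c))"
    using assms by (subst nn_integral_sum) (simp_all add: nn_integral_multc nn_integral_grid_bump)
  also have "\<dots> = ennreal (bump_mass TYPE('n) * \<delta> ^ CARD('n) * (\<Sum>c\<in>S. u c))"
    using assms less_imp_le[OF bump_mass_pos[where 'n='n]]
    by (simp add: sum_distrib_left sum_ennreal[symmetric] ennreal_mult'')
  finally show ?thesis .
qed

text \<open>Jensen's inequality at each point, with the bumps as weights, moves the power onto the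
  coefficients; integration then only sees the mass of single bumps.\<close>

lemma power_integral_le_grid_sum:
  assumes "0 < \<delta>" "finite S" "\<And>c. c \<in> S \<Longrightarrow> 0 \<le> u c" "1 \<le> r"
    and "\<And>x::real^'n. norm (h x) \<le> (\<Sum>c\<in>S. grid_bump \<delta> c x * u c)"
  shows "power_integral r h \<le> ennreal (bump_mass TYPE('n) * \<delta> ^ CARD('n) * (\<Sum>c\<in>S. u c powr r))"
proof -
  have "power_integral r h \<le> (\<integral>\<^sup>+x. ennreal (\<Sum>c\<in>S. grid_bump \<delta> c (x::real^'n) * u c powr r) \<partial>lebesgue)"
    unfolding power_integral_def
  proof (intro nn_integral_mono ennreal_leI)
    fix x :: "real^'n"
    have "norm (h x) powr r \<le> (\<Sum>c\<in>S. grid_bump \<delta> c x * u c) powr r"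
      using assms by (intro powr_mono2) auto
    also have "\<dots> \<le> (\<Sum>c\<in>S. grid_bump \<delta> c x * u c powr r)"
      using assms by (intro jensen_subweights) (auto simp: grid_bump_bounds sum_grid_bump_le_1)
    finally show "norm (h x) powr r \<le> (\<Sum>c\<in>S. grid_bump \<delta> c x * u c powr r)" .
  qed
  then show ?thesis using assms(1) by (subst (asm) nn_integral_sum_grid_bump) auto
qed

lemma test_partition:
  assumes "f \<in> test_functions" "0 < \<delta>"
  obtains N where "\<And>x M. f x \<noteq> 0 \<Longrightarrow> N \<le> M \<Longrightarrow> (\<Sum>c\<in>grid_box M. grid_bump \<delta> c x) = 1"
proof -
  obtain \<rho> where \<rho>: "\<rho> > 0" "\<And>x. norm x > \<rho> \<Longrightarrow> f x = 0" using test_vanish[OF assms(1)] by blast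
  define N where "N = nat \<lceil>\<rho> / \<delta>\<rceil>"
  have "(\<Sum>c\<in>grid_box M. grid_bump \<delta> c x) = 1" if "f x \<noteq> 0" "N \<le> M" for x M
  proof (rule sum_grid_bump_eq_1[OF assms(2)])
    fix i
    have "\<bar>x $ i\<bar> \<le> norm x" by (rule component_le_norm_cart)
    also have "\<dots> \<le> \<rho>" using \<rho>(2)[of x] that by fastforce
    also have "\<dots> = \<rho> / \<delta> * \<delta>" using assms by simp
    also have "\<rho> / \<delta> \<le> real N" unfolding N_def by linarith
    also have "real N \<le> real M" using that by simp
    finally show "\<bar>x $ i\<bar> \<le> real M * \<delta>" using assms by simp
  qed
  then show ?thesis using that by blast
qed


section \<open>Suprema on grid cells\<close>

definition grid_sup :: "real \<Rightarrow> (real^'n \<Rightarrow> complex) \<Rightarrow> ('n \<Rightarrow> int) \<Rightarrow> real" where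
  "grid_sup \<delta> f c = (SUP x\<in>grid_cube \<delta> c. norm (f x))"

lemma grid_cube_nonempty: "0 < \<delta> \<Longrightarrow> (\<chi> i. \<delta> * of_int (c i)) \<in> grid_cube \<delta> c"
  by (simp add: grid_cube_def)

lemma norm_le_grid_sup:
  assumes "f \<in> test_functions" "x \<in> grid_cube \<delta> c"
  shows "norm (f x) \<le> grid_sup \<delta> f c"
proof -
  obtain M where "\<And>x. norm (f x) \<le> M" using test_bound[OF assms(1)] by blast
  then show ?thesis unfolding grid_sup_def
    using assms(2) by (intro cSUP_upper bdd_aboveI2[where M=M]) auto
qed

lemma grid_sup_le:
  assumes "0 < \<delta>" "\<And>x. x \<in> grid_cube \<delta> c \<Longrightarrow> norm (f x) \<le> M"
  shows "grid_sup \<delta> f c \<le> M"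
  unfolding grid_sup_def using assms grid_cube_nonempty[OF assms(1), of c] by (intro cSUP_least) auto

lemma grid_sup_nonneg: "0 < \<delta> \<Longrightarrow> f \<in> test_functions \<Longrightarrow> 0 \<le> grid_sup \<delta> f c"
  using norm_le_grid_sup[OF _ grid_cube_nonempty] norm_ge_zero order_trans by blast

lemma norm_grid_bump_mult_le:
  assumes "0 < \<delta>" "f \<in> test_functions"
  shows "grid_bump \<delta> c x * norm (f x) \<le> grid_bump \<delta> c x * grid_sup \<delta> f c"
proof (cases "x \<in> grid_cube \<delta> c")
  case True
  then show ?thesis using assms by (intro mult_left_mono norm_le_grid_sup grid_bump_bounds)
qed (simp add: assms grid_bump_eq_0)

lemma dist_grid_cube:
  fixes x y :: "real^'n"
  assumes "x \<in> grid_cube \<delta> c" "y \<in> grid_cube \<delta> c"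
  shows "dist x y \<le> 2 * \<delta> * CARD('n)"
proof -
  have "dist x y \<le> (\<Sum>i\<in>UNIV. \<bar>(x - y) $ i\<bar>)" unfolding dist_norm by (rule norm_le_l1_cart)
  also have "\<dots> \<le> (\<Sum>i\<in>(UNIV::'n set). 2 * \<delta>)"
  proof (rule sum_mono)
    fix i show "\<bar>(x - y) $ i\<bar> \<le> 2 * \<delta>"
      using assms unfolding grid_cube_def by (auto dest!: spec[of _ i])
  qed
  finally show ?thesis by (simp add: mult.commute)
qed

lemma grid_sup_eq_0:
  assumes "0 < \<delta>" "\<And>x. x \<in> grid_cube \<delta> c \<Longrightarrow> f x = 0"
  shows "grid_sup \<delta> f c = 0"
proof -
  have "(\<lambda>x. norm (f x)) ` grid_cube \<delta> c = {0}"
    using assms(2) grid_cube_nonempty[OF assms(1), of c] by force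
  then show ?thesis by (simp add: grid_sup_def)
qed

lemma powr_add_le:
  fixes a b :: real assumes "0 \<le> a" "0 \<le> b" "0 \<le> r"
  shows "(a + b) powr r \<le> 2 powr r * (a powr r + b powr r)"
proof -
  have "(a + b) powr r \<le> (2 * max a b) powr r" using assms by (intro powr_mono2) auto
  also have "\<dots> = 2 powr r * max a b powr r" using assms by (simp add: powr_mult)
  also have "max a b powr r \<le> a powr r + b powr r" by (simp add: max_def)
  finally show ?thesis by simp
qed

lemma grid_sup_eq_0_outside:
  fixes c :: "'n::finite \<Rightarrow> int"
  assumes "\<And>x. norm x > \<rho> \<Longrightarrow> f x = 0" "0 < \<delta>" "c \<notin> grid_box (nat \<lceil>\<rho> / \<delta>\<rceil> + 1)" "0 < \<rho>"
  shows "grid_sup \<delta> f c = 0"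
proof -
  \<comment> \<open>Such an index puts the centre of the cell farther than \<rho> + \<delta> from 0
    in one coordinate. The extra 1 in the box pays for the half-width \<delta> of the cell.\<close>
  obtain i where "c i \<notin> {- int (nat \<lceil>\<rho> / \<delta>\<rceil> + 1)..int (nat \<lceil>\<rho> / \<delta>\<rceil> + 1)}"
    using assms(3) unfolding grid_box_def by blast
  moreover have "0 \<le> \<lceil>\<rho> / \<delta>\<rceil>" using assms(2,4) by (simp add: less_le_trans[of "-1" 0])
  ultimately have i: "\<bar>c i\<bar> > \<lceil>\<rho> / \<delta>\<rceil> + 1" by auto
  have "f x = 0" if "x \<in> grid_cube \<delta> c" for x
  proof (rule assms(1))
    have "\<bar>real_of_int (c i)\<bar> > \<rho> / \<delta> + 1" using i by linarith
    then have "\<delta> * \<bar>real_of_int (c i)\<bar> > \<delta> * (\<rho> / \<delta> + 1)" using assms(2) by (intro mult_strict_left_mono)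
    then have "\<bar>\<delta> * real_of_int (c i)\<bar> > \<rho> + \<delta>" using assms(2) by (simp add: abs_mult ring_distribs)
    moreover have "\<bar>x $ i - \<delta> * of_int (c i)\<bar> \<le> \<delta>" using that by (simp add: grid_cube_def)
    ultimately have "\<bar>x $ i\<bar> > \<rho>" by linarith
    then show "norm x > \<rho>" using component_le_norm_cart[of x i] by linarith
  qed
  then show ?thesis by (rule grid_sup_eq_0[OF assms(2)])
qed

text \<open>Comparison of a Riemann sum with the integral: on a cell the supremum exceeds each value
  by at most \<omega>, which gives \<open>2 powr r\<close> times the integral plus an error. The
  choice of \<omega> keeps the error below one more copy of the integral, whence the
  \<open>+ 1\<close>. Only \<eta> depends on f.\<close>

lemma grid_sampling:
  fixes f :: "real^'n \<Rightarrow> complex"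
  assumes f: "f \<in> test_functions" and r: "0 < r"
  obtains \<eta> where "0 < \<eta>"
    "\<And>\<delta> S. 0 < \<delta> \<Longrightarrow> \<delta> < \<eta> \<Longrightarrow> finite S \<Longrightarrow>
      ennreal (bump_mass TYPE('n) * \<delta> ^ CARD('n) * (\<Sum>c\<in>S. grid_sup \<delta> f c powr r)) \<le> ennreal (2 powr r + 1) * power_integral r f"
proof (cases "\<forall>x. f x = 0")
  case True
  have "grid_sup \<delta> f c = 0" if "0 < \<delta>" for \<delta> c
    using True by (intro grid_sup_eq_0 that) simp
  then show ?thesis using that[of 1] by simp
next
  case False
  let ?\<kappa> = "bump_mass TYPE('n)"
  note \<kappa> = bump_mass_pos[where 'n='n]
  obtain \<rho> where \<rho>: "\<rho> > 0" "\<And>x. norm x > \<rho> \<Longrightarrow> f x = 0" using test_vanish[OF f] by blast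
  define I where "I = enn2real (power_integral r f)"
  have I: "power_integral r f = ennreal I" using power_integral_test_finite[OF f r] by (simp add: I_def)
  have m: "(\<lambda>x. ennreal (norm (f x) powr r)) \<in> borel_measurable lborel"
    using test_borel[OF f] by measurable
  \<comment> \<open>Positivity of the integral is what leaves room for a positive oscillation bound
    \<omega>; the zero function was treated separately.\<close>
  have "power_integral r f \<noteq> 0"
  proof
    assume "power_integral r f = 0"
    then have "AE x in lborel. f x = 0"
      using m by (simp add: power_integral_def nn_integral_completion nn_integral_0_iff_AE)
    moreover have op: "open {x. f x \<noteq> 0}"
      using test_continuous[OF f, of UNIV] by (intro open_Collect_neq) auto
    ultimately have "{x. f x \<noteq> 0} \<in> null_sets lborel"
      using borel_open[OF op] by (subst AE_iff_null_sets) auto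
    then have "negligible {x. f x \<noteq> 0}"
      by (simp add: negligible_iff_null_sets null_sets_completionI)
    then show False using op open_not_negligible False by blast
  qed
  then have "I > 0" using I by (simp add: ennreal_eq_0_iff not_le)
  \<comment> \<open>\<open>(2 * \<rho> + 5) ^ CARD('n)\<close> bounds \<delta>^n times the number of
    indices in the box outside which the suprema vanish: its half-width N is at most \<rho> /
    \<delta> + 2, and \<delta> < 1.\<close>
  define L where "L = 2 powr r * (?\<kappa> * (2 * \<rho> + 5) ^ CARD('n))"
  have "L > 0" using \<kappa> \<rho> by (simp add: L_def)
  define \<omega> where "\<omega> = (I / L) powr (1 / r)"
  have \<omega>: "\<omega> > 0" "\<omega> powr r = I / L" using \<open>I > 0\<close> \<open>L > 0\<close> r by (auto simp: \<omega>_def powr_powr)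
  obtain d where d: "d > 0" "\<And>x y. dist x y < d \<Longrightarrow> norm (f x - f y) < \<omega>"
    using test_uniformly_continuous[OF f \<omega>(1)] by blast
  define \<eta> where "\<eta> = min 1 (d / (2 * CARD('n)))"
  have \<eta>: "\<eta> > 0" using d by (simp add: \<eta>_def)
  have main: "ennreal (?\<kappa> * \<delta> ^ CARD('n) * (\<Sum>c\<in>S. grid_sup \<delta> f c powr r)) \<le> ennreal (2 powr r + 1) * power_integral r f"
    if \<delta>: "0 < \<delta>" "\<delta> < \<eta>" and S: "finite S" for \<delta> S
  proof -
    define N where "N = nat \<lceil>\<rho> / \<delta>\<rceil> + 1"
    define S' where "S' = S \<inter> grid_box N"
    have S': "finite S'" using S by (simp add: S'_def)
    have eq: "(\<Sum>c\<in>S. grid_sup \<delta> f c powr r) = (\<Sum>c\<in>S'. grid_sup \<delta> f c powr r)"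
      unfolding S'_def
    proof (intro sum.mono_neutral_right S ballI)
      fix c assume "c \<in> S - S \<inter> grid_box N"
      then have "grid_sup \<delta> f c = 0"
        using grid_sup_eq_0_outside[of \<rho> f \<delta> c] \<rho> \<delta>(1) by (auto simp: N_def)
      then show "grid_sup \<delta> f c powr r = 0" by simp
    qed auto
    have d1: "2 * \<delta> * CARD('n) < d"
      using \<delta> by (simp add: \<eta>_def pos_less_divide_eq mult.commute mult.left_commute)
    have osc: "grid_sup \<delta> f c \<le> norm (f y) + \<omega>" if "y \<in> grid_cube \<delta> c" for c y
    proof (rule grid_sup_le[OF \<delta>(1)])
      fix x assume "x \<in> grid_cube \<delta> c"
      then have "dist x y < d" using dist_grid_cube that d1 by fastforce
      then have "norm (f x - f y) < \<omega>" by (rule d)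
      then show "norm (f x) \<le> norm (f y) + \<omega>" using norm_triangle_sub[of "f x" "f y"] by linarith
    qed
    have pt: "(\<Sum>c\<in>S'. grid_bump \<delta> c x * grid_sup \<delta> f c powr r)
        \<le> 2 powr r * norm (f x) powr r + (\<Sum>c\<in>S'. grid_bump \<delta> c x * (2 powr r * \<omega> powr r))" for x
    proof -
      have "(\<Sum>c\<in>S'. grid_bump \<delta> c x * grid_sup \<delta> f c powr r)
         \<le> (\<Sum>c\<in>S'. grid_bump \<delta> c x * (2 powr r * norm (f x) powr r + 2 powr r * \<omega> powr r))"
      proof (rule sum_mono)
        fix c
        show "grid_bump \<delta> c x * grid_sup \<delta> f c powr r \<le> grid_bump \<delta> c x * (2 powr r * norm (f x) powr r + 2 powr r * \<omega> powr r)"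
        proof (cases "x \<in> grid_cube \<delta> c")
          case True
          have "grid_sup \<delta> f c powr r \<le> (norm (f x) + \<omega>) powr r"
            using osc[OF True] r grid_sup_nonneg[OF \<delta>(1) f] by (intro powr_mono2) auto
          also have "\<dots> \<le> 2 powr r * norm (f x) powr r + 2 powr r * \<omega> powr r"
            using powr_add_le[of "norm (f x)" \<omega> r] \<omega> r by (simp add: ring_distribs)
          finally show ?thesis by (intro mult_left_mono grid_bump_bounds)
        qed (simp add: grid_bump_eq_0 \<delta>)
      qed
      also have "\<dots> = (\<Sum>c\<in>S'. grid_bump \<delta> c x) * (2 powr r * norm (f x) powr r)
           + (\<Sum>c\<in>S'. grid_bump \<delta> c x * (2 powr r * \<omega> powr r))"
        by (simp only: ring_distribs sum.distrib sum_distrib_right)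
      also have "(\<Sum>c\<in>S'. grid_bump \<delta> c x) * (2 powr r * norm (f x) powr r) \<le> 1 * (2 powr r * norm (f x) powr r)"
        by (intro mult_right_mono sum_grid_bump_le_1 S') auto
      finally show ?thesis by simp
    qed
    have "ennreal (?\<kappa> * \<delta> ^ CARD('n) * (\<Sum>c\<in>S'. grid_sup \<delta> f c powr r))
      = (\<integral>\<^sup>+x. ennreal (\<Sum>c\<in>S'. grid_bump \<delta> c (x::real^'n) * grid_sup \<delta> f c powr r) \<partial>lebesgue)"
      by (rule nn_integral_sum_grid_bump[OF \<delta>(1), symmetric]) auto
    also have "\<dots> \<le> (\<integral>\<^sup>+x. ennreal (2 powr r) * ennreal (norm (f x) powr r) + ennreal (\<Sum>c\<in>S'. grid_bump \<delta> c x * (2 powr r * \<omega> powr r)) \<partial>lebesgue)"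
      using pt by (intro nn_integral_mono)
         (simp add: ennreal_mult'[symmetric] ennreal_plus[symmetric] sum_nonneg grid_bump_bounds del: ennreal_plus)
    also have "\<dots> = ennreal (2 powr r) * power_integral r f + ennreal (?\<kappa> * \<delta> ^ CARD('n) * (\<Sum>c\<in>S'. 2 powr r * \<omega> powr r))"
      unfolding power_integral_def
      apply (subst nn_integral_add)
      subgoal by (rule measurable_completion) (use m in measurable)
      subgoal by (intro lebesgue_measurable_borel measurable_compose[OF _ measurable_ennreal] borel_measurable_sum borel_measurable_times grid_bump_borel) auto
      apply (subst nn_integral_cmult)
      subgoal by (intro measurable_completion m)
      by (subst nn_integral_sum_grid_bump[OF \<delta>(1)]) auto
    also have "?\<kappa> * \<delta> ^ CARD('n) * (\<Sum>c\<in>S'. 2 powr r * \<omega> powr r) = ?\<kappa> * (2 powr r * \<omega> powr r) * (\<delta> ^ CARD('n) * real (card S'))"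
      by simp
    also have "\<dots> \<le> ?\<kappa> * (2 powr r * \<omega> powr r) * (2 * \<rho> + 5) ^ CARD('n)"
    proof (intro mult_left_mono)
      have "card S' \<le> card (grid_box N :: ('n \<Rightarrow> int) set)" unfolding S'_def by (intro card_mono finite_grid_box) auto
      then have "real (card S') \<le> (2 * real N + 1) ^ CARD('n)"
        unfolding card_grid_box by (metis (mono_tags) of_nat_1 of_nat_add of_nat_le_iff of_nat_mult of_nat_numeral of_nat_power)
      then have "\<delta> ^ CARD('n) * real (card S') \<le> \<delta> ^ CARD('n) * (2 * real N + 1) ^ CARD('n)"
        using \<delta> by (intro mult_left_mono) auto
      also have "\<dots> = (\<delta> * (2 * real N + 1)) ^ CARD('n)" by (simp add: power_mult_distrib)
      also have "\<dots> \<le> (2 * \<rho> + 5) ^ CARD('n)"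
      proof (rule power_mono)
        have "real N \<le> \<rho> / \<delta> + 2" unfolding N_def using \<rho>(1) \<delta>(1) by (simp add: of_nat_nat) linarith
        then have "\<delta> * (2 * real N + 1) \<le> \<delta> * (2 * (\<rho> / \<delta> + 2) + 1)" using \<delta> by (intro mult_left_mono) auto
        also have "\<dots> = 2 * \<rho> + 5 * \<delta>" using \<delta> by (simp add: field_simps)
        also have "\<dots> \<le> 2 * \<rho> + 5" using \<delta> by (simp add: \<eta>_def)
        finally show "\<delta> * (2 * real N + 1) \<le> 2 * \<rho> + 5" .
      qed (use \<delta> in auto)
      finally show "\<delta> ^ CARD('n) * real (card S') \<le> (2 * \<rho> + 5) ^ CARD('n)" .
    qed (use \<kappa> in auto)
    also have "\<dots> = L * \<omega> powr r" by (simp add: L_def)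
    also have "\<dots> = I" using \<open>L > 0\<close> \<omega>(2) by simp
    finally show ?thesis
      using eq I \<open>I > 0\<close> by (simp add: ring_distribs ennreal_mult'[symmetric] ennreal_plus[symmetric] del: ennreal_plus)
        (simp add: add_left_mono ennreal_leI)
  qed
  show ?thesis using that[OF \<eta> main] by blast
qed

section \<open>Stopping cubes\<close>

text \<open>The dyadic block of side \<open>2 ^ m\<close> around the node \<open>c\<close>, as a set
  of nodes. Flooring division names the block, also for negative indices.\<close>

definition dyadic_cube :: "nat \<Rightarrow> ('n::finite \<Rightarrow> int) \<Rightarrow> ('n \<Rightarrow> int) set" where
  "dyadic_cube m c = {e. \<forall>i. e i div 2 ^ m = c i div 2 ^ m}"

lemma dyadic_cube_refl: "c \<in> dyadic_cube m c"
  by (simp add: dyadic_cube_def)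

lemma dyadic_cube_0: "dyadic_cube 0 c = {c}"
  by (auto simp: dyadic_cube_def)

lemma dyadic_cube_eq: "e \<in> dyadic_cube m c \<Longrightarrow> dyadic_cube m e = dyadic_cube m c"
  by (auto simp: dyadic_cube_def)

lemma dyadic_cube_mono: "m \<le> m' \<Longrightarrow> dyadic_cube m c \<subseteq> dyadic_cube m' c"
proof
  fix e assume "m \<le> m'" and e: "e \<in> dyadic_cube m c"
  then obtain k where k: "m' = m + k" using le_Suc_ex by blast
  have "x div 2 ^ m' = x div 2 ^ m div 2 ^ k" for x :: int
    unfolding k power_add by (rule zdiv_zmult2_eq) simp
  then show "e \<in> dyadic_cube m' c" using e by (simp add: dyadic_cube_def)
qed

lemma dyadic_cube_PiE:
  "dyadic_cube m c = PiE UNIV (\<lambda>i. {2 ^ m * (c i div 2 ^ m)..<2 ^ m * (c i div 2 ^ m) + 2 ^ m})"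
proof -
  have "x div 2 ^ m = k \<longleftrightarrow> 2 ^ m * k \<le> x \<and> x < 2 ^ m * k + 2 ^ m" for x k :: int
  proof -
    have "x div 2 ^ m = k \<longleftrightarrow> \<lfloor>real_of_int x / real_of_int (2^m)\<rfloor> = k" by (simp only: floor_divide_of_int_eq)
    also have "\<dots> \<longleftrightarrow> real_of_int k \<le> real_of_int x / real_of_int (2^m) \<and> real_of_int x / real_of_int (2^m) < real_of_int k + 1"
      by (simp add: floor_eq_iff)
    also have "\<dots> \<longleftrightarrow> real_of_int (2^m * k) \<le> real_of_int x \<and> real_of_int x < real_of_int (2^m * k + 2^m)"
      by (simp add: pos_le_divide_eq pos_divide_less_eq algebra_simps)
    finally show ?thesis by (simp only: of_int_le_iff of_int_less_iff)
  qed
  then show ?thesis unfolding dyadic_cube_def by (auto simp: PiE_def Pi_def extensional_def)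
qed

lemma finite_dyadic_cube: "finite (dyadic_cube m c)"
  unfolding dyadic_cube_PiE by (intro finite_PiE) auto

lemma card_dyadic_cube: "card (dyadic_cube m (c :: 'n::finite \<Rightarrow> int)) = 2 ^ (m * CARD('n))"
  unfolding dyadic_cube_PiE by (subst card_PiE) (auto simp: power_mult nat_power_eq)

text \<open>The stopping cubes are indexed by some cell \<open>c\<close> they contain and their level \<open>m\<close>.\<close>

lemma discrete_calderon_zygmund:
  fixes w :: "('n::finite \<Rightarrow> int) \<Rightarrow> real"
  assumes w: "\<And>c. 0 \<le> w c" and fin: "finite {c. w c \<noteq> 0}" and \<alpha>: "0 < \<alpha>"
  obtains J :: "(nat \<times> ('n \<Rightarrow> int)) set" where "finite J"
    "\<And>i j. i \<in> J \<Longrightarrow> j \<in> J \<Longrightarrow> i \<noteq> j \<Longrightarrow> dyadic_cube (fst i) (snd i) \<inter> dyadic_cube (fst j) (snd j) = {}"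
    "\<And>m c. (m, c) \<in> J \<Longrightarrow> \<alpha> * 2 ^ (m * CARD('n)) < (\<Sum>e\<in>dyadic_cube m c. w e)"
    "\<And>m c. (m, c) \<in> J \<Longrightarrow> (\<Sum>e\<in>dyadic_cube m c. w e) \<le> 2 ^ CARD('n) * \<alpha> * 2 ^ (m * CARD('n))"
    "\<And>e. e \<notin> (\<Union>j\<in>J. dyadic_cube (fst j) (snd j)) \<Longrightarrow> w e \<le> \<alpha>"
proof -
  define heavy where "heavy m c \<longleftrightarrow> \<alpha> * 2 ^ (m * CARD('n)) < (\<Sum>e\<in>dyadic_cube m c. w e)" for m c
  define W where "W = (\<Sum>c | w c \<noteq> 0. w c)"
  have le_W: "(\<Sum>e\<in>dyadic_cube m c. w e) \<le> W" for m c
  proof -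
    have "(\<Sum>e\<in>dyadic_cube m c. w e) = (\<Sum>e\<in>dyadic_cube m c \<inter> {c. w c \<noteq> 0}. w e)"
      by (intro sum.mono_neutral_right finite_dyadic_cube) auto
    also have "\<dots> \<le> W" unfolding W_def using w by (intro sum_mono2 fin) auto
    finally show ?thesis .
  qed
  \<comment> \<open>A heavy cube satisfies 2^(m n) < W / \<alpha>, and m \<le> m n. Hence no level
    above M is heavy, and a greatest heavy level exists.\<close>
  obtain M :: nat where M: "W / \<alpha> < 2 ^ M" using real_arch_pow[of 2 "W / \<alpha>"] by auto
  have not_heavy: "m \<le> M" if "heavy m c" for m c
  proof (rule ccontr)
    assume "\<not> m \<le> M"
    have "\<alpha> * 2 ^ (m * CARD('n)) < W" using that le_W[of m c] by (simp add: heavy_def)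
    then have "2 ^ (m * CARD('n)) < W / \<alpha>" using \<alpha> by (simp add: pos_less_divide_eq mult.commute)
    also have "\<dots> < 2 ^ M" by (rule M)
    finally have "m * CARD('n) < M" by simp
    moreover have "m * 1 \<le> m * CARD('n)" by (intro mult_le_mono) auto
    ultimately show False using \<open>\<not> m \<le> M\<close> by simp
  qed
  define lev where "lev c = (GREATEST m. heavy m c)" for c
  have lev: "heavy (lev c) c" if "heavy m c" for m c
    unfolding lev_def by (rule GreatestI_nat[where P="\<lambda>m. heavy m c", OF that not_heavy])
  have lev_max: "m \<le> lev c" if "heavy m c" for m c
    unfolding lev_def by (rule Greatest_le_nat[where P="\<lambda>m. heavy m c", OF that not_heavy])
  have heavy_cong: "heavy m e \<longleftrightarrow> heavy m c" if "e \<in> dyadic_cube m c" for m e c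
    using dyadic_cube_eq[OF that] by (simp add: heavy_def)
  define cubes where "cubes = (\<lambda>c. dyadic_cube (lev c) c) ` {c. \<alpha> < w c}"
  \<comment> \<open>Many nodes may yield the same maximal cube. One of them is selected per cube, so
    that distinct indices in \<open>J\<close> belong to disjoint cubes.\<close>
  define rep where "rep Q = (SOME c. \<alpha> < w c \<and> Q = dyadic_cube (lev c) c)" for Q
  have rep: "\<alpha> < w (rep Q) \<and> Q = dyadic_cube (lev (rep Q)) (rep Q)" if "Q \<in> cubes" for Q
    unfolding rep_def by (rule someI_ex[where P="\<lambda>c. \<alpha> < w c \<and> Q = dyadic_cube (lev c) c"]) (use that in \<open>auto simp: cubes_def\<close>)
  define J where "J = (\<lambda>Q. (lev (rep Q), rep Q)) ` cubes"
  have finc: "finite {c. \<alpha> < w c}" by (rule finite_subset[OF _ fin]) (use \<alpha> in auto)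
  have h0: "heavy 0 c" if "\<alpha> < w c" for c using that by (simp add: heavy_def dyadic_cube_0)
  have J_D: "m = lev c" "\<alpha> < w c" "dyadic_cube m c \<in> cubes" "c = rep (dyadic_cube m c)" if mc: "(m, c) \<in> J" for m c
  proof -
    obtain Q where "Q \<in> cubes" "m = lev (rep Q)" "c = rep Q" using mc by (auto simp: J_def)
    then show "m = lev c" "\<alpha> < w c" "dyadic_cube m c \<in> cubes" "c = rep (dyadic_cube m c)" using rep[of Q] by auto
  qed
  have disj: "Q = Q'" if q: "Q \<in> cubes" "Q' \<in> cubes" "e \<in> Q" "e \<in> Q'" for Q Q' e
  proof -
    obtain c c' where c: "\<alpha> < w c" "Q = dyadic_cube (lev c) c" "\<alpha> < w c'" "Q' = dyadic_cube (lev c') c'"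
      using q(1,2) by (auto simp: cubes_def)
    \<comment> \<open>Two dyadic cubes that meet are nested. The larger one is heavy and also
      contains the node of the smaller, so maximality forces equal levels.\<close>
    have le: "lev c' \<le> lev c" if "lev c \<le> lev c'" "e \<in> dyadic_cube (lev c) c" "e \<in> dyadic_cube (lev c') c'"
       "\<alpha> < w c'" for c c'
    proof -
      have "e \<in> dyadic_cube (lev c') c" using that dyadic_cube_mono by blast
      then have "heavy (lev c') c" using that heavy_cong lev[OF h0] by blast
      then show ?thesis by (rule lev_max)
    qed
    have "lev c = lev c'" using le[of c c'] le[of c' c] q c by (metis le_antisym nat_le_linear)
    then show ?thesis using c q dyadic_cube_eq by metis
  qed
  show ?thesis
  proof (rule that)
    show "finite J" unfolding J_def cubes_def using finc by auto
    show "dyadic_cube (fst i) (snd i) \<inter> dyadic_cube (fst j) (snd j) = {}" if "i \<in> J" "j \<in> J" "i \<noteq> j" for i j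
    proof (rule ccontr)
      assume ne: "dyadic_cube (fst i) (snd i) \<inter> dyadic_cube (fst j) (snd j) \<noteq> {}"
      have "dyadic_cube (fst i) (snd i) = dyadic_cube (fst j) (snd j)"
        using ne disj J_D(3)[of "fst i" "snd i"] J_D(3)[of "fst j" "snd j"] that by auto
      then have "snd i = snd j" using J_D(4)[of "fst i" "snd i"] J_D(4)[of "fst j" "snd j"] that by simp
      then have "i = j" using J_D(1) that by (metis prod.collapse)
      then show False using that by simp
    qed
    show "\<alpha> * 2 ^ (m * CARD('n)) < (\<Sum>e\<in>dyadic_cube m c. w e)" if "(m, c) \<in> J" for m c
      using lev[OF h0[OF J_D(2)[OF that]]] J_D(1)[OF that] by (simp add: heavy_def)
    show "(\<Sum>e\<in>dyadic_cube m c. w e) \<le> 2 ^ CARD('n) * \<alpha> * 2 ^ (m * CARD('n))" if "(m, c) \<in> J" for m c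
    proof -
      \<comment> \<open>By maximality the parent is not heavy; it has \<open>2 ^ CARD('n)\<close>
        times as many nodes, which is the factor in the upper bound.\<close>
      have "\<not> heavy (Suc m) c" using lev_max[of "Suc m" c] J_D(1)[OF that] by auto
      then have "(\<Sum>e\<in>dyadic_cube (Suc m) c. w e) \<le> \<alpha> * 2 ^ (Suc m * CARD('n))" by (simp add: heavy_def)
      moreover have "(\<Sum>e\<in>dyadic_cube m c. w e) \<le> (\<Sum>e\<in>dyadic_cube (Suc m) c. w e)"
        using w by (intro sum_mono2 finite_dyadic_cube dyadic_cube_mono) auto
      ultimately show ?thesis by (simp add: power_add mult_ac)
    qed
    show "w e \<le> \<alpha>" if "e \<notin> (\<Union>j\<in>J. dyadic_cube (fst j) (snd j))" for e
    proof (rule ccontr)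
      assume "\<not> w e \<le> \<alpha>"
      then have "dyadic_cube (lev e) e \<in> cubes" by (auto simp: cubes_def)
      then have "e \<in> dyadic_cube (fst (lev (rep (dyadic_cube (lev e) e)), rep (dyadic_cube (lev e) e)))
         (snd (lev (rep (dyadic_cube (lev e) e)), rep (dyadic_cube (lev e) e)))"
        using rep[of "dyadic_cube (lev e) e"] dyadic_cube_refl[of e "lev e"] by simp
      with \<open>dyadic_cube (lev e) e \<in> cubes\<close> show False using that unfolding J_def by blast
    qed
  qed
qed

section \<open>Interpolation on test functions\<close>

lemma nn_integral_powr_below:
  assumes "a > -1" "c \<ge> 0"
  shows "(\<integral>\<^sup>+t. ennreal (t powr a) * indicator {0..c} t \<partial>lborel) = ennreal (c powr (a + 1) / (a + 1))"
  using assms by (intro nn_integral_has_integral_lebesgue' has_integral_powr_from_0) auto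

lemma nn_integral_powr_above:
  assumes "a < -1" "c > 0"
  shows "(\<integral>\<^sup>+t. ennreal (t powr a) * indicator {c..} t \<partial>lborel) = ennreal (- (c powr (a + 1)) / (a + 1))"
  using assms by (intro nn_integral_has_integral_lebesgue' has_integral_powr_to_inf) auto

text \<open>Tonelli's theorem on the region t < |u x|. As u is only Lebesgue measurable, a Borel
  version replaces it to obtain measurability on the product.\<close>

lemma nn_integral_powr_layer_cake:
  fixes u :: "'a::euclidean_space \<Rightarrow> real"
  assumes u: "u \<in> borel_measurable lebesgue" and p: "0 < p"
  shows "(\<integral>\<^sup>+x. ennreal (\<bar>u x\<bar> powr p) \<partial>lebesgue)
    = (\<integral>\<^sup>+t. ennreal (p * t powr (p - 1)) * indicator {0<..} t * emeasure lebesgue {x. t < \<bar>u x\<bar>} \<partial>lborel)"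
proof -
  obtain v where v[measurable]: "v \<in> borel_measurable borel" and uv: "AE x in lborel. u x = v x"
    using completion_ex_borel_measurable_real[OF u] by auto
  have em: "emeasure lebesgue {x. t < \<bar>u x\<bar>} = (\<integral>\<^sup>+x. indicator {t<..} \<bar>v x\<bar> \<partial>lborel)" for t
  proof -
    have "(\<lambda>x. \<bar>u x\<bar>) \<in> borel_measurable lebesgue" using u by measurable
    from borel_measurable_less[OF borel_measurable_const this, of t]
    have "{x. t < \<bar>u x\<bar>} \<in> sets lebesgue" by simp
    then have "emeasure lebesgue {x. t < \<bar>u x\<bar>} = (\<integral>\<^sup>+x. indicator {x. t < \<bar>u x\<bar>} x \<partial>lebesgue)"
      by simp
    also have "\<dots> = (\<integral>\<^sup>+x. indicator {x. t < \<bar>u x\<bar>} x \<partial>lborel)" by (rule nn_integral_completion)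
    also have "\<dots> = (\<integral>\<^sup>+x. indicator {t<..} \<bar>v x\<bar> \<partial>lborel)"
      using uv by (intro nn_integral_cong_AE) (auto simp: indicator_def)
    finally show ?thesis .
  qed
  have inner: "(\<integral>\<^sup>+t. ennreal (p * t powr (p - 1)) * indicator {0<..} t * indicator {t<..} s \<partial>lborel) = ennreal (s powr p)"
    if "s \<ge> 0" for s :: real
  proof -
    have "(\<integral>\<^sup>+t. ennreal (p * t powr (p - 1)) * indicator {0<..} t * indicator {t<..} s \<partial>lborel)
       = (\<integral>\<^sup>+t. ennreal p * (ennreal (t powr (p - 1)) * indicator {0..s} t) \<partial>lborel)"
    proof (intro nn_integral_cong_AE)
      \<comment> \<open>The two descriptions of the interval differ only at its endpoints 0 and s,
        which form a null set.\<close>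
      have "AE t in lborel. t \<noteq> 0" "AE t in lborel. t \<noteq> s" by (intro AE_lborel_singleton)+
      then show "AE t in lborel. ennreal (p * t powr (p - 1)) * indicator {0<..} t * indicator {t<..} s
         = ennreal p * (ennreal (t powr (p - 1)) * indicator {0..s} t)"
        by eventually_elim (use p in \<open>auto simp: indicator_def ennreal_mult'\<close>)
    qed
    also have "\<dots> = ennreal p * ennreal (s powr (p - 1 + 1) / (p - 1 + 1))"
      using p that by (subst nn_integral_cmult) (simp_all add: nn_integral_powr_below)
    also have "\<dots> = ennreal (s powr p)" using p by (simp add: ennreal_mult'[symmetric])
    finally show ?thesis .
  qed
  have "(\<integral>\<^sup>+x. ennreal (\<bar>u x\<bar> powr p) \<partial>lebesgue) = (\<integral>\<^sup>+x. ennreal (\<bar>v x\<bar> powr p) \<partial>lborel)"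
    unfolding nn_integral_completion using uv by (intro nn_integral_cong_AE) auto
  also have "\<dots> = (\<integral>\<^sup>+x. (\<integral>\<^sup>+t. ennreal (p * t powr (p - 1)) * indicator {0<..} t * indicator {t<..} \<bar>v x\<bar> \<partial>lborel) \<partial>lborel)"
    by (simp add: inner)
  also have "\<dots> = (\<integral>\<^sup>+t. (\<integral>\<^sup>+x. ennreal (p * t powr (p - 1)) * indicator {0<..} t * indicator {t<..} \<bar>v x\<bar> \<partial>lborel) \<partial>lborel)"
  proof (rule lborel_pair.Fubini')
    show "(\<lambda>(t, x). ennreal (p * t powr (p - 1)) * indicator {0<..} t * indicator {t<..} \<bar>v x\<bar>)
       \<in> borel_measurable (lborel \<Otimes>\<^sub>M lborel)"
      unfolding indicator_def greaterThan_iff by measurable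
  qed
  also have "\<dots> = (\<integral>\<^sup>+t. ennreal (p * t powr (p - 1)) * indicator {0<..} t * emeasure lebesgue {x. t < \<bar>u x\<bar>} \<partial>lborel)"
    unfolding em by (intro nn_integral_cong nn_integral_cmult) measurable
  finally show ?thesis .
qed

section \<open>Operators on test functions and the two halves of the level set estimate\<close>

definition ae_linear :: "(('a::euclidean_space \<Rightarrow> complex) \<Rightarrow> 'a \<Rightarrow> complex) \<Rightarrow> bool" where
  "ae_linear T \<longleftrightarrow> (\<forall>f\<in>test_functions. T f \<in> borel_measurable lebesgue) \<and>
    (\<forall>f\<in>test_functions. \<forall>g\<in>test_functions. \<forall>c. AE x in lebesgue. T (\<lambda>x. c * f x + g x) x = c * T f x + T g x)"

lemma ae_linear_measurable: "ae_linear T \<Longrightarrow> f \<in> test_functions \<Longrightarrow> T f \<in> borel_measurable lebesgue"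
  by (simp add: ae_linear_def)

lemma ae_linear_comb:
  "ae_linear T \<Longrightarrow> f \<in> test_functions \<Longrightarrow> g \<in> test_functions \<Longrightarrow> AE x in lebesgue. T (\<lambda>x. c * f x + g x) x = c * T f x + T g x"
  by (simp add: ae_linear_def)

lemma ae_linear_add:
  "ae_linear T \<Longrightarrow> f \<in> test_functions \<Longrightarrow> g \<in> test_functions \<Longrightarrow> AE x in lebesgue. T (\<lambda>x. f x + g x) x = T f x + T g x"
  using ae_linear_comb[of T f g 1] by simp

lemma ae_linear_zero: "ae_linear T \<Longrightarrow> AE x in lebesgue. T (\<lambda>x. 0) x = 0"
  using ae_linear_add[OF _ test_zero test_zero, of T] by simp

lemma ae_linear_sum:
  assumes "ae_linear T" "finite J" "\<And>j. j \<in> J \<Longrightarrow> f j \<in> test_functions"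
  shows "AE x in lebesgue. T (\<lambda>x. \<Sum>j\<in>J. f j x) x = (\<Sum>j\<in>J. T (f j) x)"
  using assms(2,3)
proof (induction rule: finite_induct)
  case empty then show ?case using ae_linear_zero[OF assms(1)] by simp
next
  case (insert i J)
  have "AE x in lebesgue. T (\<lambda>x. f i x + (\<Sum>j\<in>J. f j x)) x = T (f i) x + T (\<lambda>x. \<Sum>j\<in>J. f j x) x"
    using insert.prems by (intro ae_linear_add assms(1) test_sum) auto
  moreover have "AE x in lebesgue. T (\<lambda>x. \<Sum>j\<in>J. f j x) x = (\<Sum>j\<in>J. T (f j) x)"
    using insert by auto
  ultimately show ?case using insert.hyps by (auto elim!: AE_mp)
qed

text \<open>A weak type estimate restricted to functions bounded by t. The factor \<open>L\<close>
  in the threshold admits operators bounded with respect to the essential supremum, without a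
  separate treatment of an infinite exponent.\<close>

definition good_bound :: "(('a::euclidean_space \<Rightarrow> complex) \<Rightarrow> 'a \<Rightarrow> complex) \<Rightarrow> real \<Rightarrow> bool" where
  "good_bound T s \<longleftrightarrow> (\<exists>L C. 0 \<le> L \<and> 0 \<le> C \<and> (\<forall>t>0. \<forall>g\<in>test_functions. (\<forall>x. norm (g x) \<le> t) \<longrightarrow>
     emeasure lebesgue {x. L * t < norm (T g x)} \<le> ennreal (C * t powr (- s)) * power_integral s g))"

text \<open>Support, mean value and the single integrals feed the kernel estimate; the integral of
  the whole sum feeds the case of an operator already bounded with exponent q. Both kinds of bound
  are expressed through \<open>R j ^ CARD('n)\<close>, which is comparable to the volume of the ball
  carrying \<open>b j\<close>.\<close>

definition bad_family ::
  "real \<Rightarrow> real \<Rightarrow> real \<Rightarrow> 'j set \<Rightarrow> ('j \<Rightarrow> real^'n \<Rightarrow> complex) \<Rightarrow> ('j \<Rightarrow> real^'n) \<Rightarrow> ('j \<Rightarrow> real) \<Rightarrow> bool" where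
  "bad_family q M t J b y R \<longleftrightarrow> finite J \<and>
     (\<forall>j\<in>J. b j \<in> test_functions \<and> 0 < R j \<and> (\<forall>x. R j < norm (x - y j) \<longrightarrow> b j x = 0) \<and>
        integral\<^sup>L lebesgue (b j) = 0 \<and> power_integral q (b j) \<le> ennreal (M * t powr q * R j ^ CARD('n))) \<and>
     power_integral q (\<lambda>x. \<Sum>j\<in>J. b j x) \<le> ennreal (M * t powr q * (\<Sum>j\<in>J. R j ^ CARD('n)))"

text \<open>The constant may depend on the size parameter \<open>M\<close> but not on the family or
  the height. The index type is that of the stopping cubes, since a definition cannot quantify over
  types.\<close>

definition bad_bound :: "((real^'n \<Rightarrow> complex) \<Rightarrow> real^'n \<Rightarrow> complex) \<Rightarrow> real \<Rightarrow> bool" where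
  "bad_bound T q \<longleftrightarrow> (\<forall>M. \<exists>C\<ge>0. \<forall>t>0. \<forall>(J::(nat \<times> ('n \<Rightarrow> int)) set) b y R. bad_family q M t J b y R \<longrightarrow>
     emeasure lebesgue {x. t < norm (T (\<lambda>x. \<Sum>j\<in>J. b j x) x)} \<le> ennreal (C * (\<Sum>j\<in>J. R j ^ CARD('n))))"

lemma test_integrable: "f \<in> test_functions \<Longrightarrow> integrable lebesgue f"
proof -
  assume f: "f \<in> test_functions"
  have "power_integral 1 f < \<infinity>" by (rule power_integral_test_finite[OF f]) simp
  then have "(\<integral>\<^sup>+x. ennreal (norm (f x)) \<partial>lebesgue) < \<infinity>" by (simp add: power_integral_def)
  then show ?thesis by (intro integrableI_bounded test_lebesgue f)
qed

section \<open>A decomposition into smooth good and bad parts\<close>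

lemma finite_nonzero_grid_sup:
  assumes "f \<in> test_functions" "0 < \<delta>"
  shows "finite {c. grid_sup \<delta> f c \<noteq> 0}"
proof -
  obtain \<rho> where \<rho>: "\<rho> > 0" "\<And>x. norm x > \<rho> \<Longrightarrow> f x = 0" using test_vanish[OF assms(1)] by blast
  have "{c. grid_sup \<delta> f c \<noteq> 0} \<subseteq> grid_box (nat \<lceil>\<rho> / \<delta>\<rceil> + 1)"
    using grid_sup_eq_0_outside[of \<rho> f \<delta>] \<rho> assms(2) by blast
  then show ?thesis using finite_grid_box finite_subset by blast
qed

text \<open>Coordinates of nodes in one block differ by at most \<open>2 ^ m - 1\<close>, and the
  cell adds one mesh width. The centre of the ball is the node \<open>c\<close> that names the cube,
  not the centre of the cube; the factor \<open>CARD('n)\<close> comes from the l1 norm.\<close>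

lemma grid_cube_in_dyadic_ball:
  fixes x :: "real^'n" and \<delta> :: real
  assumes \<delta>: "0 < \<delta>" and e: "e \<in> dyadic_cube m c" and x: "x \<in> grid_cube \<delta> e"
  shows "norm (x - (\<chi> i. \<delta> * of_int (c i))) \<le> 2 * CARD('n) * \<delta> * 2 ^ m"
proof -
  have "norm (x - (\<chi> i. \<delta> * of_int (c i))) \<le> (\<Sum>i\<in>UNIV. \<bar>(x - (\<chi> i. \<delta> * of_int (c i))) $ i\<bar>)"
    by (rule norm_le_l1_cart)
  also have "\<dots> \<le> (\<Sum>i\<in>(UNIV::'n set). 2 * \<delta> * 2 ^ m)"
  proof (rule sum_mono)
    fix i
    have "c i div 2 ^ m = e i div 2 ^ m" using e by (simp add: dyadic_cube_def)
    then have "\<bar>e i - c i\<bar> = \<bar>e i mod 2 ^ m - c i mod 2 ^ m\<bar>"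
      by (metis add_diff_cancel_left mult_div_mod_eq)
    also have "\<dots> \<le> 2 ^ m - 1"
    proof -
      have "0 \<le> e i mod 2 ^ m" "e i mod 2 ^ m < 2 ^ m" "0 \<le> c i mod 2 ^ m" "c i mod 2 ^ m < 2 ^ m" by simp_all
      then show ?thesis by linarith
    qed
    finally have "\<bar>real_of_int (e i) - real_of_int (c i)\<bar> \<le> 2 ^ m - 1"
      by (metis (mono_tags, lifting) of_int_1 of_int_abs of_int_diff of_int_le_iff of_int_numeral of_int_power)
    then have "\<delta> * \<bar>real_of_int (e i) - real_of_int (c i)\<bar> \<le> \<delta> * (2 ^ m - 1)"
      using \<delta> by (intro mult_left_mono) auto
    moreover have "\<delta> * (2 ^ m - 1) = \<delta> * 2 ^ m - \<delta>" by (simp add: right_diff_distrib)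
    moreover have "\<bar>\<delta> * real_of_int (e i) - \<delta> * real_of_int (c i)\<bar> = \<delta> * \<bar>real_of_int (e i) - real_of_int (c i)\<bar>"
      using \<delta> by (simp add: abs_mult right_diff_distrib[symmetric])
    moreover have "\<bar>x $ i - \<delta> * real_of_int (e i)\<bar> \<le> \<delta>" using x by (simp add: grid_cube_def)
    ultimately have "\<bar>x $ i - \<delta> * real_of_int (c i)\<bar> \<le> \<delta> * 2 ^ m" by linarith
    moreover have "0 < \<delta> * 2 ^ m" using \<delta> by simp
    ultimately show "\<bar>(x - (\<chi> i. \<delta> * of_int (c i))) $ i\<bar> \<le> 2 * \<delta> * 2 ^ m" by simp
  qed
  finally show ?thesis by (simp add: mult_ac)
qed

text \<open>Each entry satisfies v \<le> t + t powr (1 - q) * v powr q, trivially if v \<le> t and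
  by monotonicity of the power otherwise. In this way q-averages at height t control plain averages
  without Hoelder's inequality.\<close>

lemma sum_le_of_sum_powr_le:
  fixes v :: "'i \<Rightarrow> real"
  assumes Q: "finite Q" and v: "\<And>c. 0 \<le> v c" and q: "1 \<le> q" and t: "0 < t" and k: "0 \<le> k"
    and le: "(\<Sum>c\<in>Q. v c powr q) \<le> k * t powr q * card Q"
  shows "(\<Sum>c\<in>Q. v c) \<le> (1 + k) * t * card Q"
proof -
  have "v c \<le> t + t powr (1 - q) * v c powr q" for c
  proof (cases "v c \<le> t")
    case True then show ?thesis by (simp add: add_increasing2)
  next
    case False
    have "v c = t powr (1 - q) * t powr (q - 1) * v c" using t by (simp add: powr_add[symmetric])
    also have "\<dots> \<le> t powr (1 - q) * v c powr (q - 1) * v c"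
      using False q t v by (intro mult_right_mono mult_left_mono powr_mono2) auto
    also have "\<dots> = t powr (1 - q) * v c powr q"
      using False t powr_add[of "v c" "q - 1" 1] by simp
    finally show ?thesis using t by simp
  qed
  then have "(\<Sum>c\<in>Q. v c) \<le> (\<Sum>c\<in>Q. t + t powr (1 - q) * v c powr q)" by (intro sum_mono)
  also have "\<dots> = t * card Q + t powr (1 - q) * (\<Sum>c\<in>Q. v c powr q)"
    by (simp add: sum.distrib sum_distrib_left mult.commute)
  also have "\<dots> \<le> t * card Q + t powr (1 - q) * (k * t powr q * card Q)"
    using le by (intro add_left_mono mult_left_mono) auto
  also have "t powr (1 - q) * (k * t powr q * card Q) = k * (t powr (1 - q) * t powr q) * card Q"
    by (simp add: mult_ac)
  also have "t powr (1 - q) * t powr q = t" using t by (simp add: powr_add[symmetric])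
  finally show ?thesis by (simp add: algebra_simps)
qed

text \<open>Entries up to t / 2 contribute at most t powr q / 2 each, hence at most half of the sum;
  the other half stems from larger entries. Restricting to these is what later makes the integral
  over large t converge.\<close>

lemma card_le_of_sum_powr_ge:
  fixes v :: "'i \<Rightarrow> real"
  assumes Q: "finite Q" and v: "\<And>c. 0 \<le> v c" and q: "1 \<le> q" and t: "0 < t"
    and heavy: "t powr q * card Q \<le> (\<Sum>c\<in>Q. v c powr q)"
  shows "real (card Q) \<le> 2 * t powr (- q) * (\<Sum>c\<in>Q. if t / 2 < v c then v c powr q else 0)"
proof -
  have "(\<Sum>c\<in>Q. v c powr q) \<le> (\<Sum>c\<in>Q. (if t / 2 < v c then v c powr q else 0) + t powr q / 2)"
  proof (rule sum_mono)
    fix c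
    show "v c powr q \<le> (if t / 2 < v c then v c powr q else 0) + t powr q / 2"
    proof (cases "t / 2 < v c")
      case False
      then have "v c powr q \<le> (t / 2) powr q" using v q by (intro powr_mono2) auto
      also have "\<dots> = t powr q / 2 powr q" using t by (simp add: powr_divide)
      also have "\<dots> \<le> t powr q / 2" using powr_mono[OF q, of 2] by (intro divide_left_mono) auto
      finally show ?thesis using False by simp
    qed simp
  qed
  also have "\<dots> = (\<Sum>c\<in>Q. if t / 2 < v c then v c powr q else 0) + t powr q / 2 * card Q"
    by (simp add: sum.distrib mult.commute)
  finally have "t powr q * card Q \<le> 2 * (\<Sum>c\<in>Q. if t / 2 < v c then v c powr q else 0)" using heavy by simp
  then have "t powr (- q) * (t powr q * card Q) \<le> t powr (- q) * (2 * (\<Sum>c\<in>Q. if t / 2 < v c then v c powr q else 0))"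
    by (intro mult_left_mono) auto
  moreover have "t powr (- q) * (t powr q * card Q) = (t powr (-q) * t powr q) * card Q" by simp
  moreover have "t powr (-q) * t powr q = 1" using t by (simp add: powr_add[symmetric])
  ultimately show ?thesis by (simp add: mult_ac)
qed

lemma grid_box_mono: "N \<le> M \<Longrightarrow> grid_box N \<subseteq> grid_box M"
proof
  fix c :: "'a \<Rightarrow> int" assume "N \<le> M" "c \<in> grid_box N"
  have "c i \<in> {- int M..int M}" for i
  proof -
    have "c i \<in> {- int N..int N}" using \<open>c \<in> grid_box N\<close> by (simp add: grid_box_def)
    then show ?thesis using \<open>N \<le> M\<close> by auto
  qed
  then show "c \<in> grid_box M" by (simp add: grid_box_def)
qed

lemma has_bochner_integral_sum_grid_bump:
  assumes "0 < \<delta>"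
  shows "has_bochner_integral lebesgue (\<lambda>x::real^'n. complex_of_real (\<Sum>e\<in>Q. grid_bump \<delta> e x))
     (complex_of_real (bump_mass TYPE('n) * \<delta> ^ CARD('n) * card Q))"
proof -
  have "has_bochner_integral lebesgue (\<lambda>x::real^'n. \<Sum>e\<in>Q. grid_bump \<delta> e x * 1)
     (bump_mass TYPE('n) * \<delta> ^ CARD('n) * (\<Sum>e\<in>Q. 1))"
    using bump_mass_pos[where 'n='n] assms
    by (intro has_bochner_integral_nn_integral nn_integral_sum_grid_bump lebesgue_measurable_borel
       borel_measurable_sum borel_measurable_times grid_bump_borel AE_I2 sum_nonneg)
      (auto simp: grid_bump_bounds)
  from has_bochner_integral_of_real[OF this] show ?thesis by simp
qed

text \<open>Sampling on a grid of mesh \<open>\<delta>\<close> makes the family of stopping cubes finite, so that both parts of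
  the decomposition remain test functions.\<close>

lemma calderon_zygmund_decomposition:
  fixes f :: "real^'n \<Rightarrow> complex" and \<delta> q t :: real
  defines "v \<equiv> grid_sup \<delta> f" and "\<kappa> \<equiv> bump_mass TYPE('n)" and "K \<equiv> 1 + 2 ^ CARD('n)"
  assumes f: "f \<in> test_functions" and \<delta>: "0 < \<delta>" and q: "1 \<le> q" and t: "0 < t"
  obtains J :: "(nat \<times> ('n \<Rightarrow> int)) set" and b g y R and \<Omega> :: "('n \<Rightarrow> int) set" where
    "g \<in> test_functions" "\<And>x. f x = g x + (\<Sum>j\<in>J. b j x)" "\<And>x. norm (g x) \<le> K * t"
    "bad_family q (\<kappa> * 2 powr q * (2 ^ CARD('n) + K powr q)) t J b y R"
    "(\<Sum>j\<in>J. R j ^ CARD('n)) = (2 * real CARD('n)) ^ CARD('n) * \<delta> ^ CARD('n) * card \<Omega>"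
    "\<And>s. 1 \<le> s \<Longrightarrow> power_integral s g \<le> ennreal (\<kappa> * \<delta> ^ CARD('n) * (card \<Omega> * (K * t) powr s + (\<Sum>c | v c \<noteq> 0. if v c \<le> t then v c powr s else 0)))"
    "real (card \<Omega>) \<le> 2 * t powr (- q) * (\<Sum>c | v c \<noteq> 0. if t / 2 < v c then v c powr q else 0)"
proof -
  have v0: "0 \<le> v c" for c unfolding v_def by (rule grid_sup_nonneg[OF \<delta> f])
  have fin: "finite {c. v c \<noteq> 0}" unfolding v_def by (rule finite_nonzero_grid_sup[OF f \<delta>])
  have \<kappa>: "\<kappa> > 0" unfolding \<kappa>_def by (rule bump_mass_pos)
  have K: "K > 1" by (simp add: K_def)
  obtain J :: "(nat \<times> ('n \<Rightarrow> int)) set" where J: "finite J"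
    and disj: "\<And>i j. i \<in> J \<Longrightarrow> j \<in> J \<Longrightarrow> i \<noteq> j \<Longrightarrow> dyadic_cube (fst i) (snd i) \<inter> dyadic_cube (fst j) (snd j) = {}"
    and lower: "\<And>m c. (m, c) \<in> J \<Longrightarrow> t powr q * 2 ^ (m * CARD('n)) < (\<Sum>e\<in>dyadic_cube m c. v e powr q)"
    and upper: "\<And>m c. (m, c) \<in> J \<Longrightarrow> (\<Sum>e\<in>dyadic_cube m c. v e powr q) \<le> 2 ^ CARD('n) * t powr q * 2 ^ (m * CARD('n))"
    and off: "\<And>e. e \<notin> (\<Union>j\<in>J. dyadic_cube (fst j) (snd j)) \<Longrightarrow> v e powr q \<le> t powr q"
  proof (rule discrete_calderon_zygmund[of "\<lambda>c. v c powr q" "t powr q"])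
    show "finite {c. v c powr q \<noteq> 0}" using fin by simp
  qed (use t in auto)
  define Q where "Q j = dyadic_cube (fst j) (snd j)" for j :: "nat \<times> ('n \<Rightarrow> int)"
  have finQ: "finite (Q j)" for j by (simp add: Q_def finite_dyadic_cube)
  have cardQ: "real (card (Q j)) = 2 ^ (fst j * CARD('n))" for j by (simp add: Q_def card_dyadic_cube)
  have upper': "(\<Sum>e\<in>Q j. v e powr q) \<le> 2 ^ CARD('n) * t powr q * card (Q j)" if "j \<in> J" for j
    using upper[of "fst j" "snd j"] that by (simp add: Q_def cardQ[unfolded Q_def])
  have lower': "t powr q * card (Q j) \<le> (\<Sum>e\<in>Q j. v e powr q)" if "j \<in> J" for j
    using lower[of "fst j" "snd j"] that by (simp add: Q_def cardQ[unfolded Q_def])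
  define \<Omega> where "\<Omega> = (\<Union>j\<in>J. Q j)"
  have fin\<Omega>: "finite \<Omega>" unfolding \<Omega>_def using J finQ by auto
  have sum\<Omega>: "(\<Sum>j\<in>J. \<Sum>e\<in>Q j. h e) = (\<Sum>e\<in>\<Omega>. h e)" for h :: "('n \<Rightarrow> int) \<Rightarrow> 'z::comm_monoid_add"
    unfolding \<Omega>_def using J finQ disj by (subst sum.UNION_disjoint) (auto simp: Q_def)
  have card\<Omega>: "(\<Sum>j\<in>J. real (card (Q j))) = real (card \<Omega>)"
    using sum\<Omega>[of "\<lambda>_. 1::real"] by simp
  have off': "v e \<le> t" if "e \<notin> \<Omega>" for e
  proof (rule ccontr)
    assume "\<not> v e \<le> t"
    then have "t powr q < v e powr q" using t q by (intro powr_less_mono2) auto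
    moreover have "v e powr q \<le> t powr q" using that by (intro off) (simp add: \<Omega>_def Q_def)
    ultimately show False by simp
  qed
  obtain N0 where N0: "\<And>x M. f x \<noteq> 0 \<Longrightarrow> N0 \<le> M \<Longrightarrow> (\<Sum>c\<in>grid_box M. grid_bump \<delta> c x) = 1"
    using test_partition[OF f \<delta>] by blast
  obtain N1 where N1: "\<Omega> \<subseteq> grid_box N1" using finite_subset_grid_box[OF fin\<Omega>] by blast
  define X where "X = (grid_box (max N0 N1) :: ('n \<Rightarrow> int) set)"
  have "(grid_box N1 :: ('n \<Rightarrow> int) set) \<subseteq> X" unfolding X_def by (rule grid_box_mono) simp
  then have X: "finite X" "\<Omega> \<subseteq> X" using N1 by (auto simp: X_def finite_grid_box)
  have part: "f x = (\<Sum>c\<in>X. grid_bump \<delta> c x) * f x" for x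
    using N0[of x "max N0 N1"] by (cases "f x = 0") (auto simp: X_def of_real_sum[symmetric] simp del: of_real_sum)
  \<comment> \<open>\<open>\<psi> j\<close> is a smooth substitute for the indicator of the cube,
    \<open>P j\<close> its integral and \<open>a j\<close> the weighted mean of f; subtracting it
    gives \<open>b j\<close> mean zero while keeping it a test function.\<close>
  define \<psi> where "\<psi> j x = (\<Sum>e\<in>Q j. grid_bump \<delta> e x)" for j and x :: "real^'n"
  define P where "P j = \<kappa> * \<delta> ^ CARD('n) * card (Q j)" for j
  have P: "P j > 0" for j using \<kappa> \<delta> by (simp add: P_def cardQ)
  define a where "a j = (\<integral>x. \<psi> j x * f x \<partial>lebesgue) / P j" for j
  have \<psi>_test: "(\<lambda>x. complex_of_real (\<psi> j x)) \<in> test_functions" for j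
    unfolding \<psi>_def of_real_sum by (intro test_sum test_grid_bump \<delta>)
  have \<psi>_int: "has_bochner_integral lebesgue (\<lambda>x. complex_of_real (\<psi> j x)) (complex_of_real (P j))" for j
    unfolding \<psi>_def P_def \<kappa>_def by (rule has_bochner_integral_sum_grid_bump[OF \<delta>])
  have a_le: "norm (a j) \<le> K * t" if j: "j \<in> J" for j
  proof -
    have 1: "integrable lebesgue (\<lambda>x. \<psi> j x * f x)"
      by (intro test_integrable test_mult test_smooth[OF \<psi>_test] f)
    have "ennreal (norm (\<integral>x. \<psi> j x * f x \<partial>lebesgue)) \<le> (\<integral>\<^sup>+x. ennreal (norm (\<psi> j x * f x)) \<partial>lebesgue)"
      by (rule integral_norm_bound_ennreal[OF 1])
    also have "\<dots> \<le> (\<integral>\<^sup>+x. ennreal (\<Sum>e\<in>Q j. grid_bump \<delta> e x * v e) \<partial>lebesgue)"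
    proof (intro nn_integral_mono ennreal_leI)
      fix x
      have "norm (\<psi> j x * f x) = (\<Sum>e\<in>Q j. grid_bump \<delta> e x * norm (f x))"
        unfolding \<psi>_def norm_mult norm_of_real by (simp add: sum_distrib_right sum_nonneg grid_bump_bounds)
      also have "\<dots> \<le> (\<Sum>e\<in>Q j. grid_bump \<delta> e x * v e)"
        unfolding v_def by (intro sum_mono norm_grid_bump_mult_le \<delta> f)
      finally show "norm (\<psi> j x * f x) \<le> (\<Sum>e\<in>Q j. grid_bump \<delta> e x * v e)" .
    qed
    also have "\<dots> = ennreal (\<kappa> * \<delta> ^ CARD('n) * (\<Sum>e\<in>Q j. v e))"
      unfolding \<kappa>_def by (rule nn_integral_sum_grid_bump[OF \<delta> v0])
    \<comment> \<open>The bound inherited from the parent enters with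
      \<open>k = 2 ^ CARD('n)\<close>; this is the origin of
      \<open>K = 1 + 2 ^ CARD('n)\<close>.\<close>
    also have "\<dots> \<le> ennreal (\<kappa> * \<delta> ^ CARD('n) * (K * t * card (Q j)))"
      using sum_le_of_sum_powr_le[OF finQ v0 q t _ upper'[OF j]] \<kappa> \<delta>
      by (intro ennreal_leI mult_left_mono) (auto simp: K_def)
    also have "\<kappa> * \<delta> ^ CARD('n) * (K * t * card (Q j)) = K * t * P j" by (simp add: P_def)
    finally have "norm (\<integral>x. \<psi> j x * f x \<partial>lebesgue) \<le> K * t * P j"
      using K t P[of j] by (subst (asm) ennreal_le_iff) auto
    then show ?thesis using P[of j] by (simp add: a_def norm_divide pos_divide_le_eq)
  qed
  define b where "b j x = complex_of_real (\<psi> j x) * (f x - a j)" for j x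
  define g where "g x = f x - (\<Sum>j\<in>J. b j x)" for x
  define R where "R j = 2 * real CARD('n) * \<delta> * 2 ^ fst j" for j :: "nat \<times> ('n \<Rightarrow> int)"
  define y where "y j = (\<chi> i. \<delta> * of_int (snd j i))" for j :: "nat \<times> ('n \<Rightarrow> int)"
  have b_alt: "b j = (\<lambda>x. \<psi> j x * f x - a j * \<psi> j x)" for j by (auto simp: b_def algebra_simps)
  have b_test: "b j \<in> test_functions" for j
    unfolding b_alt by (intro test_diff test_mult test_cmult \<psi>_test f test_smooth[OF \<psi>_test])
  have g_test: "g \<in> test_functions"
    unfolding g_def by (intro test_diff test_sum b_test f)
  have Rpow: "R j ^ CARD('n) = (2 * real CARD('n)) ^ CARD('n) * \<delta> ^ CARD('n) * card (Q j)" for j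
    by (simp add: R_def cardQ power_mult_distrib power_mult)
  have b_supp: "b j x = 0" if "R j < norm (x - y j)" for j x
  proof -
    have "grid_bump \<delta> e x = 0" if e: "e \<in> Q j" for e
      using grid_cube_in_dyadic_ball[OF \<delta>, of e "fst j" "snd j" x] e \<open>R j < norm (x - y j)\<close>
      by (intro grid_bump_eq_0 \<delta>) (auto simp: Q_def R_def y_def)
    then show ?thesis by (simp add: b_def \<psi>_def)
  qed
  have b_mean: "integral\<^sup>L lebesgue (b j) = 0" for j
  proof -
    have i1: "integrable lebesgue (\<lambda>x. \<psi> j x * f x)"
      by (intro test_integrable test_mult test_smooth[OF \<psi>_test] f)
    have i2: "integrable lebesgue (\<lambda>x. a j * \<psi> j x)" by (intro test_integrable test_cmult \<psi>_test)
    have "integral\<^sup>L lebesgue (b j) = (\<integral>x. \<psi> j x * f x \<partial>lebesgue) - a j * P j"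
      unfolding b_alt Bochner_Integration.integral_diff[OF i1 i2]
      using has_bochner_integral_integral_eq[OF has_bochner_integral_mult_right[OF \<psi>_int[of j], of "a j"]] by simp
    then show ?thesis using P[of j] by (simp add: a_def)
  qed
  have b_le: "norm (b j x) \<le> (\<Sum>e\<in>Q j. grid_bump \<delta> e x * (v e + K * t))" if "j \<in> J" for j x
  proof -
    have "norm (b j x) = (\<Sum>e\<in>Q j. grid_bump \<delta> e x * norm (f x - a j))"
      unfolding b_def \<psi>_def norm_mult norm_of_real by (simp add: sum_distrib_right sum_nonneg grid_bump_bounds)
    also have "\<dots> \<le> (\<Sum>e\<in>Q j. grid_bump \<delta> e x * norm (f x) + grid_bump \<delta> e x * (K * t))"
    proof (rule sum_mono)
      fix e
      have "norm (f x - a j) \<le> norm (f x) + K * t"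
        using norm_triangle_ineq4[of "f x" "a j"] a_le[OF that] by simp
      then have "grid_bump \<delta> e x * norm (f x - a j) \<le> grid_bump \<delta> e x * (norm (f x) + K * t)"
        by (intro mult_left_mono grid_bump_bounds)
      then show "grid_bump \<delta> e x * norm (f x - a j) \<le> grid_bump \<delta> e x * norm (f x) + grid_bump \<delta> e x * (K * t)"
        by (simp add: distrib_left)
    qed
    also have "\<dots> \<le> (\<Sum>e\<in>Q j. grid_bump \<delta> e x * v e + grid_bump \<delta> e x * (K * t))"
      unfolding v_def by (intro sum_mono add_right_mono norm_grid_bump_mult_le \<delta> f)
    finally show ?thesis by (simp add: distrib_left)
  qed
  have Kt: "0 \<le> K * t" using K t by simp
  have sum_Q: "(\<Sum>e\<in>Q j. (v e + K * t) powr q) \<le> 2 powr q * (2 ^ CARD('n) + K powr q) * t powr q * card (Q j)" if "j \<in> J" for j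
  proof -
    have "(\<Sum>e\<in>Q j. (v e + K * t) powr q) \<le> (\<Sum>e\<in>Q j. 2 powr q * (v e powr q + (K * t) powr q))"
      using v0 Kt q by (intro sum_mono powr_add_le) auto
    also have "\<dots> = 2 powr q * ((\<Sum>e\<in>Q j. v e powr q) + K powr q * t powr q * card (Q j))"
      using K t by (simp add: sum_distrib_left sum.distrib powr_mult distrib_left)
    also have "\<dots> \<le> 2 powr q * (2 ^ CARD('n) * t powr q * card (Q j) + K powr q * t powr q * card (Q j))"
      using upper'[OF that] by (intro mult_left_mono add_right_mono) auto
    finally show ?thesis by (simp add: algebra_simps)
  qed
  have n1: "1 \<le> (2 * real CARD('n)) ^ CARD('n)"
    by (intro one_le_power) (use zero_less_card_finite[where 'a='n] in linarith)
  \<comment> \<open>\<open>R j\<close> is \<open>2 * CARD('n)\<close> times the side length of the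
    cube, so passing from its volume to \<open>R j ^ CARD('n)\<close> inserts a factor that is at
    least 1.\<close>
  have scale: "\<kappa> * \<delta> ^ CARD('n) * (B * w) \<le> \<kappa> * B * ((2 * real CARD('n)) ^ CARD('n) * \<delta> ^ CARD('n) * w)" if "0 \<le> B" "0 \<le> w" for B w
  proof -
    have "\<kappa> * \<delta> ^ CARD('n) * (B * w) * 1 \<le> \<kappa> * \<delta> ^ CARD('n) * (B * w) * (2 * real CARD('n)) ^ CARD('n)"
      using \<kappa> \<delta> that n1 by (intro mult_left_mono) auto
    then show ?thesis by (simp add: mult_ac)
  qed
  let ?B = "2 powr q * (2 ^ CARD('n) + K powr q) * t powr q"
  have B0: "0 \<le> ?B" by simp
  have power_integral_b: "power_integral q (b j) \<le> ennreal (\<kappa> * ?B * R j ^ CARD('n))" if "j \<in> J" for j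
  proof -
    have "power_integral q (b j) \<le> ennreal (\<kappa> * \<delta> ^ CARD('n) * (\<Sum>e\<in>Q j. (v e + K * t) powr q))"
      unfolding \<kappa>_def using v0 Kt by (intro power_integral_le_grid_sum \<delta> finQ q b_le that) auto
    also have "\<dots> \<le> ennreal (\<kappa> * \<delta> ^ CARD('n) * (?B * card (Q j)))"
      using sum_Q[OF that] \<kappa> \<delta> by (intro ennreal_leI mult_left_mono) auto
    also have "\<dots> \<le> ennreal (\<kappa> * ?B * R j ^ CARD('n))"
      unfolding Rpow by (intro ennreal_leI scale B0) auto
    finally show ?thesis .
  qed
  have sumR: "(\<Sum>j\<in>J. R j ^ CARD('n)) = (2 * real CARD('n)) ^ CARD('n) * \<delta> ^ CARD('n) * card \<Omega>"
    unfolding Rpow card\<Omega>[symmetric] by (simp add: sum_distrib_left)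
  have sumb_le: "norm (\<Sum>j\<in>J. b j x) \<le> (\<Sum>e\<in>\<Omega>. grid_bump \<delta> e x * (v e + K * t))" for x
    unfolding sum\<Omega>[symmetric] by (rule order_trans[OF norm_sum]) (intro sum_mono b_le)
  have power_integral_sumb: "power_integral q (\<lambda>x. \<Sum>j\<in>J. b j x) \<le> ennreal (\<kappa> * ?B * (\<Sum>j\<in>J. R j ^ CARD('n)))"
  proof -
    have "power_integral q (\<lambda>x. \<Sum>j\<in>J. b j x) \<le> ennreal (\<kappa> * \<delta> ^ CARD('n) * (\<Sum>e\<in>\<Omega>. (v e + K * t) powr q))"
      unfolding \<kappa>_def using v0 Kt by (intro power_integral_le_grid_sum \<delta> fin\<Omega> q sumb_le) auto
    also have "(\<Sum>e\<in>\<Omega>. (v e + K * t) powr q) \<le> (\<Sum>j\<in>J. ?B * card (Q j))"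
      unfolding sum\<Omega>[symmetric] by (intro sum_mono sum_Q)
    also have "(\<Sum>j\<in>J. ?B * card (Q j)) = ?B * card \<Omega>"
      unfolding card\<Omega>[symmetric] by (rule sum_distrib_left[symmetric])
    also have "\<kappa> * \<delta> ^ CARD('n) * (?B * card \<Omega>) \<le> \<kappa> * ?B * (\<Sum>j\<in>J. R j ^ CARD('n))"
      unfolding sumR by (intro scale B0) auto
    finally show ?thesis using \<kappa> \<delta> by (auto simp: ennreal_leI mult_left_mono)
  qed
  \<comment> \<open>Coefficients of a majorant of g: the bound for the means on stopped nodes, and
    the cell supremum on the others, where it is at most t.\<close>
  define u where "u c = (if c \<in> \<Omega> then K * t else v c)" for c
  have u0: "0 \<le> u c" for c using v0 Kt by (simp add: u_def)
  have u_le: "u c \<le> K * t" for c using off'[of c] K t by (auto simp: u_def intro: order_trans[of _ t])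
  have g_le: "norm (g x) \<le> (\<Sum>c\<in>X. grid_bump \<delta> c x * u c)" for x
  proof -
    have 1: "(\<Sum>j\<in>J. b j x) = (\<Sum>e\<in>\<Omega>. grid_bump \<delta> e x) * f x - (\<Sum>j\<in>J. \<Sum>e\<in>Q j. grid_bump \<delta> e x * a j)"
      unfolding sum\<Omega>[symmetric] by (simp add: b_def \<psi>_def sum_distrib_right sum_subtractf right_diff_distrib)
    have 2: "(\<Sum>c\<in>X. grid_bump \<delta> c x) = (\<Sum>c\<in>\<Omega>. grid_bump \<delta> c x) + (\<Sum>c\<in>X - \<Omega>. grid_bump \<delta> c x)"
      by (subst sum.subset_diff[OF X(2,1)]) simp
    \<comment> \<open>On the stopped nodes f cancels and only the means remain; on the other nodes f
      itself survives.\<close>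
    have "g x = (\<Sum>c\<in>X - \<Omega>. grid_bump \<delta> c x) * f x + (\<Sum>j\<in>J. \<Sum>e\<in>Q j. grid_bump \<delta> e x * a j)"
      unfolding g_def 1 by (subst part) (simp add: 2 distrib_right)
    also have "norm \<dots> \<le> (\<Sum>c\<in>X - \<Omega>. grid_bump \<delta> c x * v c) + (\<Sum>e\<in>\<Omega>. grid_bump \<delta> e x * (K * t))"
    proof (rule order_trans[OF norm_triangle_ineq add_mono])
      have "norm (complex_of_real (\<Sum>c\<in>X - \<Omega>. grid_bump \<delta> c x) * f x) = (\<Sum>c\<in>X - \<Omega>. grid_bump \<delta> c x * norm (f x))"
        unfolding norm_mult norm_of_real by (simp add: sum_distrib_right sum_nonneg grid_bump_bounds)
      also have "\<dots> \<le> (\<Sum>c\<in>X - \<Omega>. grid_bump \<delta> c x * v c)"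
        unfolding v_def by (intro sum_mono norm_grid_bump_mult_le \<delta> f)
      finally show "norm (complex_of_real (\<Sum>c\<in>X - \<Omega>. grid_bump \<delta> c x) * f x) \<le> (\<Sum>c\<in>X - \<Omega>. grid_bump \<delta> c x * v c)" .
      show "norm (\<Sum>j\<in>J. \<Sum>e\<in>Q j. grid_bump \<delta> e x * a j) \<le> (\<Sum>e\<in>\<Omega>. grid_bump \<delta> e x * (K * t))"
        unfolding sum\<Omega>[symmetric]
      proof (intro order_trans[OF norm_sum] sum_mono)
        fix j e assume "j \<in> J"
        then show "norm (complex_of_real (grid_bump \<delta> e x) * a j) \<le> grid_bump \<delta> e x * (K * t)"
          unfolding norm_mult norm_of_real using a_le by (simp add: grid_bump_bounds mult_left_mono)
      qed
    qed
    also have "\<dots> = (\<Sum>c\<in>X - \<Omega>. grid_bump \<delta> c x * u c) + (\<Sum>c\<in>\<Omega>. grid_bump \<delta> c x * u c)"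
    proof -
      have "(\<Sum>c\<in>X - \<Omega>. grid_bump \<delta> c x * v c) = (\<Sum>c\<in>X - \<Omega>. grid_bump \<delta> c x * u c)"
        by (rule sum.cong) (auto simp: u_def)
      moreover have "(\<Sum>e\<in>\<Omega>. grid_bump \<delta> e x * (K * t)) = (\<Sum>c\<in>\<Omega>. grid_bump \<delta> c x * u c)"
        by (rule sum.cong) (auto simp: u_def)
      ultimately show ?thesis by simp
    qed
    also have "\<dots> = (\<Sum>c\<in>X. grid_bump \<delta> c x * u c)"
      by (rule sum.subset_diff[OF X(2,1), symmetric])
    finally show ?thesis .
  qed
  have g_bd: "norm (g x) \<le> K * t" for x
  proof -
    have "(\<Sum>c\<in>X. grid_bump \<delta> c x * u c) \<le> (\<Sum>c\<in>X. grid_bump \<delta> c x * (K * t))"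
      by (intro sum_mono mult_left_mono u_le grid_bump_bounds)
    also have "\<dots> = (\<Sum>c\<in>X. grid_bump \<delta> c x) * (K * t)" by (simp add: sum_distrib_right)
    also have "\<dots> \<le> 1 * (K * t)" by (intro mult_right_mono sum_grid_bump_le_1 X Kt)
    finally show ?thesis using g_le[of x] by simp
  qed
  have power_integral_g: "power_integral s g \<le> ennreal (\<kappa> * \<delta> ^ CARD('n) * (card \<Omega> * (K * t) powr s + (\<Sum>c | v c \<noteq> 0. if v c \<le> t then v c powr s else 0)))"
    if s: "1 \<le> s" for s
  proof -
    have "power_integral s g \<le> ennreal (\<kappa> * \<delta> ^ CARD('n) * (\<Sum>c\<in>X. u c powr s))"
      unfolding \<kappa>_def by (intro power_integral_le_grid_sum \<delta> X s g_le u0)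
    also have "(\<Sum>c\<in>X. u c powr s) = (\<Sum>c\<in>X - \<Omega>. u c powr s) + (\<Sum>c\<in>\<Omega>. u c powr s)"
      by (rule sum.subset_diff[OF X(2,1)])
    also have "(\<Sum>c\<in>\<Omega>. u c powr s) = card \<Omega> * (K * t) powr s" by (simp add: u_def)
    also have "(\<Sum>c\<in>X - \<Omega>. u c powr s) = (\<Sum>c\<in>X - \<Omega>. if v c \<le> t then v c powr s else 0)"
      by (intro sum.cong) (auto simp: u_def off')
    also have "\<dots> = (\<Sum>c\<in>(X - \<Omega>) \<inter> {c. v c \<noteq> 0}. if v c \<le> t then v c powr s else 0)"
      using X by (intro sum.mono_neutral_right) auto
    also have "\<dots> \<le> (\<Sum>c | v c \<noteq> 0. if v c \<le> t then v c powr s else 0)"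
      using fin by (intro sum_mono2) auto
    finally show ?thesis using \<kappa> \<delta> by (auto simp: ennreal_leI mult_left_mono add.commute)
  qed
  have card_le: "real (card \<Omega>) \<le> 2 * t powr (- q) * (\<Sum>c | v c \<noteq> 0. if t / 2 < v c then v c powr q else 0)"
  proof -
    have "real (card \<Omega>) \<le> (\<Sum>j\<in>J. 2 * t powr (- q) * (\<Sum>c\<in>Q j. if t / 2 < v c then v c powr q else 0))"
      unfolding card\<Omega>[symmetric] by (intro sum_mono card_le_of_sum_powr_ge finQ v0 q t lower')
    also have "\<dots> = 2 * t powr (- q) * (\<Sum>c\<in>\<Omega>. if t / 2 < v c then v c powr q else 0)"
      unfolding sum_distrib_left[symmetric] sum\<Omega> ..
    also have "(\<Sum>c\<in>\<Omega>. if t / 2 < v c then v c powr q else 0) = (\<Sum>c\<in>\<Omega> \<inter> {c. v c \<noteq> 0}. if t / 2 < v c then v c powr q else 0)"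
      using fin\<Omega> by (intro sum.mono_neutral_right) auto
    also have "\<dots> \<le> (\<Sum>c | v c \<noteq> 0. if t / 2 < v c then v c powr q else 0)"
      using fin by (intro sum_mono2) auto
    finally show ?thesis by (simp add: mult_left_mono)
  qed
  show ?thesis
  proof (rule that[of g b J y R \<Omega>])
    show "f x = g x + (\<Sum>j\<in>J. b j x)" for x by (simp add: g_def)
    show "bad_family q (\<kappa> * 2 powr q * (2 ^ CARD('n) + K powr q)) t J b y R"
      using J b_test b_supp b_mean power_integral_b power_integral_sumb \<delta> by (auto simp: bad_family_def R_def mult.assoc)
  qed (use g_test g_bd sumR power_integral_g card_le in auto)
qed

text \<open>Uniformity in the mesh is the point: with \<delta> fixed, the cell suprema on the right
  do not depend on t, so the sum can be integrated in t term by term.\<close>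

lemma interpolation_level_set:
  fixes T :: "(real^'n \<Rightarrow> complex) \<Rightarrow> real^'n \<Rightarrow> complex"
  assumes lin: "ae_linear T" and q: "1 \<le> q" and s: "1 \<le> s" and good: "good_bound T s" and bad: "bad_bound T q"
  obtains L C where "0 < L" "0 \<le> C"
    "\<And>f \<delta> t. f \<in> test_functions \<Longrightarrow> 0 < \<delta> \<Longrightarrow> 0 < t \<Longrightarrow>
      emeasure lebesgue {x. L * t < norm (T f x)} \<le> ennreal (C * \<delta> ^ CARD('n) *
        (\<Sum>c | grid_sup \<delta> f c \<noteq> 0. t powr (- s) * (if grid_sup \<delta> f c \<le> t then grid_sup \<delta> f c powr s else 0)
           + t powr (- q) * (if t / 2 < grid_sup \<delta> f c then grid_sup \<delta> f c powr q else 0)))"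
proof -
  let ?n = "CARD('n)"
  define K where "K = 1 + (2::real) ^ ?n"
  have K: "K > 1" by (simp add: K_def)
  define \<kappa> where "\<kappa> = bump_mass TYPE('n)"
  have \<kappa>: "\<kappa> > 0" unfolding \<kappa>_def by (rule bump_mass_pos)
  obtain L C1 where L: "0 \<le> L" "0 \<le> C1"
    and G: "\<And>t g. 0 < t \<Longrightarrow> g \<in> test_functions \<Longrightarrow> (\<forall>x. norm (g x) \<le> t) \<Longrightarrow>
       emeasure lebesgue {x. L * t < norm (T g x)} \<le> ennreal (C1 * t powr (- s)) * power_integral s g"
    using good unfolding good_bound_def by blast
  define M where "M = \<kappa> * 2 powr q * (2 ^ ?n + K powr q)"
  obtain C2 where C2: "0 \<le> C2"
    and B: "\<And>t (J::(nat \<times> ('n \<Rightarrow> int)) set) b y R. 0 < t \<Longrightarrow> bad_family q M t J b y R \<Longrightarrow>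
     emeasure lebesgue {x. t < norm (T (\<lambda>x. \<Sum>j\<in>J. b j x) x)} \<le> ennreal (C2 * (\<Sum>j\<in>J. R j ^ ?n))"
    using bad unfolding bad_bound_def by meson
  define N where "N = (2 * real ?n) ^ ?n"
  have N: "N \<ge> 0" by (simp add: N_def)
  \<comment> \<open>The factor 2 comes from the bound for the number of stopped nodes, which enters
    both the good and the bad part.\<close>
  define C where "C = 2 * (C1 * \<kappa> + C2 * N)"
  have C: "C \<ge> 0" using L C2 \<kappa> N by (simp add: C_def)
  have main: "emeasure lebesgue {x. (L * K + 1) * t < norm (T f x)} \<le> ennreal (C * \<delta> ^ ?n *
        (\<Sum>c | v c \<noteq> 0. t powr (- s) * (if v c \<le> t then v c powr s else 0)
           + t powr (- q) * (if t / 2 < v c then v c powr q else 0)))"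
    if f: "f \<in> test_functions" and \<delta>: "0 < \<delta>" and t: "0 < t" and v: "v = grid_sup \<delta> f" for f \<delta> t v
  proof -
    define SA where "SA = (\<Sum>c | v c \<noteq> 0. if v c \<le> t then v c powr s else 0)"
    define SB where "SB = (\<Sum>c | v c \<noteq> 0. if t / 2 < v c then v c powr q else 0)"
    have SA: "SA \<ge> 0" unfolding SA_def by (intro sum_nonneg) auto
    have SB: "SB \<ge> 0" unfolding SB_def by (intro sum_nonneg) auto
    obtain J :: "(nat \<times> ('n \<Rightarrow> int)) set" and b g y R and \<Omega> :: "('n \<Rightarrow> int) set" where
      g: "g \<in> test_functions" and fg: "\<And>x. f x = g x + (\<Sum>j\<in>J. b j x)" and gK: "\<And>x. norm (g x) \<le> K * t"
      and b: "bad_family q M t J b y R"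
      and sumR: "(\<Sum>j\<in>J. R j ^ ?n) = N * \<delta> ^ ?n * card \<Omega>"
      and Ipg: "\<And>s. 1 \<le> s \<Longrightarrow> power_integral s g \<le> ennreal (\<kappa> * \<delta> ^ ?n * (card \<Omega> * (K * t) powr s + (\<Sum>c | v c \<noteq> 0. if v c \<le> t then v c powr s else 0)))"
      and card: "real (card \<Omega>) \<le> 2 * t powr (- q) * SB"
      by (rule calderon_zygmund_decomposition[OF f \<delta> q t, folded \<kappa>_def K_def v, folded M_def N_def SB_def]) (rule that; assumption)
    let ?b = "\<lambda>x. \<Sum>j\<in>J. b j x"
    have bt: "?b \<in> test_functions" using b by (intro test_sum) (auto simp: bad_family_def)
    have eq: "f = (\<lambda>x. g x + ?b x)" using fg by auto
    have meas: "{x. r < norm (T h x)} \<in> sets lebesgue" if "h \<in> test_functions" for h r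
    proof -
      have "(\<lambda>x. norm (T h x)) \<in> borel_measurable lebesgue" using ae_linear_measurable[OF lin that] by measurable
      from borel_measurable_less[OF borel_measurable_const this, of r] show ?thesis by simp
    qed
    have "AE x in lebesgue. T f x = T g x + T ?b x" unfolding eq by (rule ae_linear_add[OF lin g bt])
    \<comment> \<open>As g is bounded by K t, its threshold is L K t; the remaining t is left to the
      bad part.\<close>
    then have "AE x in lebesgue. x \<in> {x. (L * K + 1) * t < norm (T f x)} \<longrightarrow> x \<in> {x. L * (K * t) < norm (T g x)} \<union> {x. t < norm (T ?b x)}"
    proof (eventually_elim, intro impI)
      fix x assume e: "T f x = T g x + T ?b x" and "x \<in> {x. (L * K + 1) * t < norm (T f x)}"
      then have "L * (K * t) + t < norm (T g x + T ?b x)" by (simp add: algebra_simps)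
      then have "L * (K * t) + t < norm (T g x) + norm (T ?b x)" using norm_triangle_ineq order.strict_trans2 by blast
      then show "x \<in> {x. L * (K * t) < norm (T g x)} \<union> {x. t < norm (T ?b x)}" by auto
    qed
    then have "emeasure lebesgue {x. (L * K + 1) * t < norm (T f x)}
       \<le> emeasure lebesgue ({x. L * (K * t) < norm (T g x)} \<union> {x. t < norm (T ?b x)})"
      by (intro emeasure_mono_AE sets.Un meas g bt)
    also have "\<dots> \<le> emeasure lebesgue {x. L * (K * t) < norm (T g x)} + emeasure lebesgue {x. t < norm (T ?b x)}"
      by (intro emeasure_subadditive meas g bt)
    also have "\<dots> \<le> ennreal (C1 * \<kappa> * \<delta> ^ ?n * (card \<Omega> + t powr (- s) * SA)) + ennreal (C2 * (N * \<delta> ^ ?n * card \<Omega>))"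
    proof (rule add_mono)
      have "emeasure lebesgue {x. L * (K * t) < norm (T g x)} \<le> ennreal (C1 * (K * t) powr (- s)) * power_integral s g"
        using K t gK by (intro G g) auto
      also have "\<dots> \<le> ennreal (C1 * (K * t) powr (- s)) * ennreal (\<kappa> * \<delta> ^ ?n * (card \<Omega> * (K * t) powr s + SA))"
        unfolding SA_def by (intro mult_left_mono Ipg s) auto
      also have "\<dots> = ennreal (C1 * \<kappa> * \<delta> ^ ?n * (card \<Omega> * ((K * t) powr (- s) * (K * t) powr s) + (K * t) powr (- s) * SA))"
        using L by (simp add: ennreal_mult'[symmetric] algebra_simps)
      also have "\<dots> \<le> ennreal (C1 * \<kappa> * \<delta> ^ ?n * (card \<Omega> + t powr (- s) * SA))"
      proof (intro ennreal_leI mult_left_mono add_mono)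
        show "card \<Omega> * ((K * t) powr (- s) * (K * t) powr s) \<le> card \<Omega>" using K t by (simp add: powr_add[symmetric])
        have "(K * t) powr (- s) \<le> t powr (- s)" using K t s by (intro powr_mono2') auto
        then show "(K * t) powr (- s) * SA \<le> t powr (- s) * SA" using SA by (rule mult_right_mono)
      qed (use L \<kappa> \<delta> in auto)
      finally show "emeasure lebesgue {x. L * (K * t) < norm (T g x)} \<le> ennreal (C1 * \<kappa> * \<delta> ^ ?n * (card \<Omega> + t powr (- s) * SA))" .
      show "emeasure lebesgue {x. t < norm (T ?b x)} \<le> ennreal (C2 * (N * \<delta> ^ ?n * card \<Omega>))"
        unfolding sumR[symmetric] by (rule B[OF t b])
    qed
    also have "\<dots> = ennreal (C1 * \<kappa> * \<delta> ^ ?n * (card \<Omega> + t powr (- s) * SA) + C2 * (N * \<delta> ^ ?n * card \<Omega>))"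
      using L C2 \<kappa> \<delta> N SA by (intro ennreal_plus[symmetric]) auto
    also have "C1 * \<kappa> * \<delta> ^ ?n * (card \<Omega> + t powr (- s) * SA) + C2 * (N * \<delta> ^ ?n * card \<Omega>)
        = \<delta> ^ ?n * (C1 * \<kappa> * (t powr (- s) * SA) + (C1 * \<kappa> + C2 * N) * card \<Omega>)"
      by (simp add: algebra_simps)
    also have "\<dots> \<le> \<delta> ^ ?n * (C * (t powr (- s) * SA) + (C1 * \<kappa> + C2 * N) * (2 * t powr (- q) * SB))"
    proof (intro mult_left_mono add_mono)
      have "0 \<le> C1 * \<kappa>" "0 \<le> C2 * N" using L C2 \<kappa> N by auto
      then show "C1 * \<kappa> * (t powr (- s) * SA) \<le> C * (t powr (- s) * SA)" using SA unfolding C_def by (intro mult_right_mono) auto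
      show "0 \<le> C1 * \<kappa> + C2 * N" using \<open>0 \<le> C1 * \<kappa>\<close> \<open>0 \<le> C2 * N\<close> by simp
    qed (use card \<delta> in auto)
    also have "\<dots> = C * \<delta> ^ ?n * (t powr (- s) * SA + t powr (- q) * SB)" by (simp add: C_def algebra_simps)
    also have "t powr (- s) * SA + t powr (- q) * SB = (\<Sum>c | v c \<noteq> 0. t powr (- s) * (if v c \<le> t then v c powr s else 0)
           + t powr (- q) * (if t / 2 < v c then v c powr q else 0))"
      by (simp only: SA_def SB_def sum_distrib_left sum.distrib)
    finally show ?thesis by (auto simp: ennreal_leI)
  qed
  show ?thesis
  proof (rule that[of "L * K + 1" C])
    show "0 < L * K + 1" using L K by (simp add: add_nonneg_pos)
  qed (use C main in auto)
qed

text \<open>After multiplication by t powr (p - 1), the first term lives on t \<ge> v and converges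
  at infinity because p < s; the second lives on t < 2 v and converges at 0 because q < p.\<close>

lemma nn_integral_level_weight:
  assumes v: "0 < v" and q: "q < p" and s: "p < s"
  shows "(\<integral>\<^sup>+t. ennreal (t powr (p - 1) * (t powr (- s) * (if v \<le> t then v powr s else 0)
           + t powr (- q) * (if t / 2 < v then v powr q else 0))) * indicator {0<..} t \<partial>lborel)
     \<le> ennreal ((1 / (s - p) + 2 powr (p - q) / (p - q)) * v powr p)"
proof -
  have "(\<integral>\<^sup>+t. ennreal (t powr (p - 1) * (t powr (- s) * (if v \<le> t then v powr s else 0)
           + t powr (- q) * (if t / 2 < v then v powr q else 0))) * indicator {0<..} t \<partial>lborel)
     \<le> (\<integral>\<^sup>+t. ennreal (v powr s) * (ennreal (t powr (p - 1 - s)) * indicator {v..} t) +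
            ennreal (v powr q) * (ennreal (t powr (p - 1 - q)) * indicator {0..2 * v} t) \<partial>lborel)"
  proof (rule nn_integral_mono)
    fix t :: real
    have e: "t powr (p - 1) * t powr (- s) = t powr (p - 1 - s)" "t powr (p - 1) * t powr (- q) = t powr (p - 1 - q)" if "t > 0"
      using that by (simp_all add: powr_add[symmetric])
    have "t powr (p - 1) * (t powr (- s) * (if v \<le> t then v powr s else 0) + t powr (- q) * (if t / 2 < v then v powr q else 0))
      \<le> v powr s * (t powr (p - 1 - s) * indicator {v..} t) + v powr q * (t powr (p - 1 - q) * indicator {0..2 * v} t)" if "t > 0"
    proof -
      have "t powr (p - 1) * (t powr (- s) * (if v \<le> t then v powr s else 0) + t powr (- q) * (if t / 2 < v then v powr q else 0))
        = t powr (p - 1 - s) * (if v \<le> t then v powr s else 0) + t powr (p - 1 - q) * (if t / 2 < v then v powr q else 0)"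
        unfolding e[OF that, symmetric] by (simp only: distrib_left mult.assoc)
      also have "\<dots> \<le> t powr (p - 1 - s) * (v powr s * indicator {v..} t) + t powr (p - 1 - q) * (v powr q * indicator {0..2 * v} t)"
        using that by (intro add_mono mult_left_mono) (auto simp: indicator_def)
      finally show ?thesis by (simp only: mult.left_commute)
    qed
    moreover have "ennreal (v powr s * (t powr (p - 1 - s) * indicator {v..} t) + v powr q * (t powr (p - 1 - q) * indicator {0..2 * v} t))
       = ennreal (v powr s) * (ennreal (t powr (p - 1 - s)) * indicator {v..} t) +
            ennreal (v powr q) * (ennreal (t powr (p - 1 - q)) * indicator {0..2 * v} t)"
      by (auto simp: indicator_def ennreal_mult' ennreal_plus)
    ultimately show "ennreal (t powr (p - 1) * (t powr (- s) * (if v \<le> t then v powr s else 0)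
           + t powr (- q) * (if t / 2 < v then v powr q else 0))) * indicator {0<..} t
       \<le> ennreal (v powr s) * (ennreal (t powr (p - 1 - s)) * indicator {v..} t) +
            ennreal (v powr q) * (ennreal (t powr (p - 1 - q)) * indicator {0..2 * v} t)"
      by (cases "t > 0") (metis ennreal_leI greaterThan_iff indicator_simps(1) mult.right_neutral, simp)
  qed
  also have "\<dots> = ennreal (v powr s) * ennreal (- (v powr (p - 1 - s + 1)) / (p - 1 - s + 1))
     + ennreal (v powr q) * ennreal ((2 * v) powr (p - 1 - q + 1) / (p - 1 - q + 1))"
    using assms by (subst nn_integral_add) (simp_all add: nn_integral_cmult nn_integral_powr_above nn_integral_powr_below)
  also have "\<dots> = ennreal (v powr s * (v powr (p - s) / (s - p)) + v powr q * ((2 * v) powr (p - q) / (p - q)))"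
    using assms by (simp add: ennreal_mult'[symmetric] minus_divide_right ennreal_plus[symmetric] del: ennreal_plus)
  also have "v powr s * (v powr (p - s) / (s - p)) + v powr q * ((2 * v) powr (p - q) / (p - q))
     = (v powr s * v powr (p - s)) / (s - p) + 2 powr (p - q) * (v powr q * v powr (p - q)) / (p - q)"
    using v by (simp add: powr_mult)
  also have "\<dots> = v powr p / (s - p) + 2 powr (p - q) * v powr p / (p - q)"
    using v by (simp add: powr_add[symmetric])
  finally show ?thesis by (simp add: distrib_right)
qed

theorem test_function_interpolation:
  fixes T :: "(real^'n \<Rightarrow> complex) \<Rightarrow> real^'n \<Rightarrow> complex"
  assumes lin: "ae_linear T" and q: "1 \<le> q" "q < p" and s: "p < s" and good: "good_bound T s" and bad: "bad_bound T q"
  obtains C where "0 \<le> C" "\<And>f. f \<in> test_functions \<Longrightarrow> power_integral p (T f) \<le> ennreal C * power_integral p f"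
proof -
  let ?n = "CARD('n)"
  define \<kappa> where "\<kappa> = bump_mass TYPE('n)"
  have \<kappa>: "\<kappa> > 0" unfolding \<kappa>_def by (rule bump_mass_pos)
  obtain L C where L: "0 < L" and C: "0 \<le> C" and level: "\<And>f \<delta> t. f \<in> test_functions \<Longrightarrow> 0 < \<delta> \<Longrightarrow> 0 < t \<Longrightarrow>
      emeasure lebesgue {x. L * t < norm (T f x)} \<le> ennreal (C * \<delta> ^ CARD('n) *
        (\<Sum>c | grid_sup \<delta> f c \<noteq> 0. t powr (- s) * (if grid_sup \<delta> f c \<le> t then grid_sup \<delta> f c powr s else 0)
           + t powr (- q) * (if t / 2 < grid_sup \<delta> f c then grid_sup \<delta> f c powr q else 0)))"
    by (rule interpolation_level_set[OF lin q(1) _ good bad]) (use q s in simp, rule that)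
  have p: "p > 0" "p \<ge> 1" using q by auto
  define A where "A = 1 / (s - p) + 2 powr (p - q) / (p - q)"
  have A: "A \<ge> 0" using q s by (simp add: A_def)
  define D where "D = L powr p * p * C * A"
  have D: "D \<ge> 0" using p C A by (simp add: D_def)
  have "power_integral p (T f) \<le> ennreal (D / \<kappa> * (2 powr p + 1)) * power_integral p f" if f: "f \<in> test_functions" for f
  proof -
    obtain \<eta> where \<eta>: "0 < \<eta>" and samp: "\<And>\<delta> S. 0 < \<delta> \<Longrightarrow> \<delta> < \<eta> \<Longrightarrow> finite S \<Longrightarrow>
      ennreal (\<kappa> * \<delta> ^ ?n * (\<Sum>c\<in>S. grid_sup \<delta> f c powr p)) \<le> ennreal (2 powr p + 1) * power_integral p f"
      by (rule grid_sampling[OF f p(1), folded \<kappa>_def]) (rule that)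
    \<comment> \<open>Any mesh below \<eta> would do. It is chosen once for f and stays fixed while
      t varies.\<close>
    define \<delta> where "\<delta> = \<eta> / 2"
    have \<delta>: "0 < \<delta>" "\<delta> < \<eta>" using \<eta> by (auto simp: \<delta>_def)
    define v where "v = grid_sup \<delta> f"
    have v0: "0 \<le> v c" for c unfolding v_def by (rule grid_sup_nonneg[OF \<delta>(1) f])
    define S where "S = {c. v c \<noteq> 0}"
    have S: "finite S" unfolding S_def v_def by (rule finite_nonzero_grid_sup[OF f \<delta>(1)])
    define w where "w c t = t powr (p - 1) * (t powr (- s) * (if v c \<le> t then v c powr s else 0)
           + t powr (- q) * (if t / 2 < v c then v c powr q else 0))" for c t
    have w0: "0 \<le> w c t" for c t by (auto simp: w_def)
    have wm: "w c \<in> borel_measurable borel" for c unfolding w_def by measurable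
    \<comment> \<open>Division by \<open>L\<close> turns the threshold \<open>L * t\<close> of the
      level set estimate into the height t of the layer cake formula.\<close>
    define u where "u x = norm (T f x) / L" for x
    have um: "u \<in> borel_measurable lebesgue" unfolding u_def using ae_linear_measurable[OF lin f] by measurable
    have "power_integral p (T f) = (\<integral>\<^sup>+x. ennreal (L powr p) * ennreal (\<bar>u x\<bar> powr p) \<partial>lebesgue)"
      unfolding power_integral_def u_def using L by (intro nn_integral_cong) (simp add: powr_divide ennreal_mult'[symmetric])
    also have "\<dots> = ennreal (L powr p) * (\<integral>\<^sup>+x. ennreal (\<bar>u x\<bar> powr p) \<partial>lebesgue)"
      using um by (intro nn_integral_cmult) measurable
    also have "\<dots> = ennreal (L powr p) * (\<integral>\<^sup>+t. ennreal (p * t powr (p - 1)) * indicator {0<..} t * emeasure lebesgue {x. t < \<bar>u x\<bar>} \<partial>lborel)"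
      unfolding nn_integral_powr_layer_cake[OF um p(1)] ..
    also have "\<dots> \<le> ennreal (L powr p) * (\<integral>\<^sup>+t. (\<Sum>c\<in>S. ennreal (p * C * \<delta> ^ ?n) * (ennreal (w c t) * indicator {0<..} t)) \<partial>lborel)"
    proof (intro mult_left_mono nn_integral_mono)
      fix t :: real
      show "ennreal (p * t powr (p - 1)) * indicator {0<..} t * emeasure lebesgue {x. t < \<bar>u x\<bar>}
         \<le> (\<Sum>c\<in>S. ennreal (p * C * \<delta> ^ ?n) * (ennreal (w c t) * indicator {0<..} t))"
      proof (cases "t > 0")
        case True
        have "{x. t < \<bar>u x\<bar>} = {x. L * t < norm (T f x)}" using L by (auto simp: u_def pos_less_divide_eq mult.commute)
        then have "emeasure lebesgue {x. t < \<bar>u x\<bar>} \<le> ennreal (C * \<delta> ^ ?n *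
          (\<Sum>c\<in>S. t powr (- s) * (if v c \<le> t then v c powr s else 0)
           + t powr (- q) * (if t / 2 < v c then v c powr q else 0)))"
          using level[OF f \<delta>(1) True, folded v_def, folded S_def] by simp
        then have "ennreal (p * t powr (p - 1)) * emeasure lebesgue {x. t < \<bar>u x\<bar>}
          \<le> ennreal (p * t powr (p - 1)) * ennreal (C * \<delta> ^ ?n *
          (\<Sum>c\<in>S. t powr (- s) * (if v c \<le> t then v c powr s else 0)
           + t powr (- q) * (if t / 2 < v c then v c powr q else 0)))" by (rule mult_left_mono) simp
        also have "\<dots> = ennreal (p * C * \<delta> ^ ?n * (\<Sum>c\<in>S. w c t))"
          using p by (subst ennreal_mult'[symmetric]) (simp_all add: w_def sum_distrib_left[symmetric] mult_ac)
        also have "\<dots> = (\<Sum>c\<in>S. ennreal (p * C * \<delta> ^ ?n) * ennreal (w c t))"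
          using p C \<delta> w0 by (simp add: sum_distrib_left sum_ennreal[symmetric] ennreal_mult'')
        finally show ?thesis using True by simp
      qed simp
    qed simp
    also have "\<dots> = ennreal (L powr p) * (\<Sum>c\<in>S. ennreal (p * C * \<delta> ^ ?n) * (\<integral>\<^sup>+t. ennreal (w c t) * indicator {0<..} t \<partial>lborel))"
      using wm by (subst nn_integral_sum) (simp_all add: nn_integral_cmult)
    also have "\<dots> \<le> ennreal (L powr p) * (\<Sum>c\<in>S. ennreal (p * C * \<delta> ^ ?n) * ennreal (A * v c powr p))"
    proof (intro mult_left_mono sum_mono)
      fix c assume "c \<in> S"
      then have "0 < v c" using v0[of c] by (auto simp: S_def)
      from nn_integral_level_weight[OF this q(2) s]
      show "(\<integral>\<^sup>+t. ennreal (w c t) * indicator {0<..} t \<partial>lborel) \<le> ennreal (A * v c powr p)"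
        unfolding w_def A_def .
    qed auto
    also have "\<dots> = ennreal (L powr p * (\<Sum>c\<in>S. p * C * \<delta> ^ ?n * (A * v c powr p)))"
      using p C \<delta> A by (simp add: ennreal_mult'[symmetric] sum_nonneg sum_ennreal)
    also have "L powr p * (\<Sum>c\<in>S. p * C * \<delta> ^ ?n * (A * v c powr p)) = D / \<kappa> * (\<kappa> * \<delta> ^ ?n * (\<Sum>c\<in>S. v c powr p))"
      using \<kappa> by (simp add: D_def sum_distrib_left mult_ac)
    also have "ennreal \<dots> = ennreal (D / \<kappa>) * ennreal (\<kappa> * \<delta> ^ ?n * (\<Sum>c\<in>S. v c powr p))"
      using D \<kappa> by (intro ennreal_mult') auto
    also have "\<dots> \<le> ennreal (D / \<kappa>) * (ennreal (2 powr p + 1) * power_integral p f)"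
      unfolding v_def by (intro mult_left_mono samp \<delta> S) auto
    also have "\<dots> = ennreal (D / \<kappa> * (2 powr p + 1)) * power_integral p f"
    proof -
      have "ennreal (D / \<kappa> * (2 powr p + 1)) = ennreal (D / \<kappa>) * ennreal (2 powr p + 1)"
        using D \<kappa> by (intro ennreal_mult) auto
      then show ?thesis by (simp only: mult.assoc)
    qed
    finally show ?thesis .
  qed
  then show ?thesis using that[of "D / \<kappa> * (2 powr p + 1)"] D \<kappa> by auto
qed

section \<open>The kernel estimate\<close>

lemma AE_lborel_affine:
  fixes t :: "'a::euclidean_space"
  assumes "AE x in lborel. P x" and c: "c \<noteq> 0"
  shows "AE x in lborel. P (t + c *\<^sub>R x)"
proof -
  obtain N where N: "{x \<in> space lborel. \<not> P x} \<subseteq> N" "N \<in> sets lborel" "emeasure lborel N = 0"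
    using AE_E[OF assms(1)] by (metis null_setsD1 null_setsD2)
  let ?N = "{x. t + c *\<^sub>R x \<in> N}"
  have Nb: "N \<in> sets borel" using N by simp
  have sets: "?N \<in> sets borel"
    using measurable_sets[of "\<lambda>x. t + c *\<^sub>R x" borel borel, OF _ Nb] by (simp add: vimage_def)
  have "emeasure lborel N = ennreal (\<bar>c\<bar> ^ DIM('a)) * (\<integral>\<^sup>+x. indicator N (t + c *\<^sub>R x) \<partial>lborel)"
    using nn_integral_affine[of "indicator N" c t] Nb c by simp
  also have "(\<lambda>x. indicator N (t + c *\<^sub>R x) :: ennreal) = indicator ?N" by (auto simp: indicator_def)
  also have "(\<integral>\<^sup>+x. indicator ?N x \<partial>lborel) = emeasure lborel ?N" using sets by simp
  finally have "ennreal (\<bar>c\<bar> ^ DIM('a)) * emeasure lborel ?N = 0" using N by simp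
  moreover have "0 < \<bar>c\<bar> ^ DIM('a)" using c by simp
  ultimately have "emeasure lborel ?N = 0" by (auto simp: ennreal_eq_0_iff)
  then have "?N \<in> null_sets lborel" using sets by auto
  then show ?thesis by (rule AE_I') (use N in auto)
qed

text \<open>Tonelli on products calls for a Borel version of the kernel. Setting it to 0 wherever
  the size bound fails makes the bound hold at every point; at the origin, division by zero makes
  the bound 0 and forces the value 0.\<close>

lemma borel_kernel:
  fixes K :: "real^'n \<Rightarrow> complex"
  assumes K: "K \<in> borel_measurable (lebesgue_on (- {0}))" and size: "\<And>x. x \<noteq> 0 \<Longrightarrow> norm (K x) \<le> A / norm x ^ CARD('n)"
  obtains K0 where "K0 \<in> borel_measurable borel" "\<And>x. norm (K0 x) \<le> A / norm x ^ CARD('n)" "AE x in lborel. K x = K0 x"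
proof -
  define K' where "K' x = (if x \<in> - {0} then K x else 0)" for x
  have K': "K' \<in> borel_measurable lebesgue"
    unfolding K'_def by (subst borel_measurable_if) (use K in auto)
  have "(\<lambda>x. Re (K' x)) \<in> borel_measurable lebesgue" "(\<lambda>x. Im (K' x)) \<in> borel_measurable lebesgue"
    using K' by measurable
  from completion_ex_borel_measurable_real[OF this(1)] completion_ex_borel_measurable_real[OF this(2)]
  obtain r i where r[measurable]: "r \<in> borel_measurable borel" and i[measurable]: "i \<in> borel_measurable borel"
    and AEs: "AE x in lborel. Re (K' x) = r x" "AE x in lborel. Im (K' x) = i x"
    by auto
  define K1 where "K1 x = complex_of_real (r x) + \<i> * complex_of_real (i x)" for x
  have K1[measurable]: "K1 \<in> borel_measurable borel" unfolding K1_def by measurable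
  define K0 where "K0 x = (if norm (K1 x) \<le> A / norm x ^ CARD('n) then K1 x else 0)" for x
  have m: "K0 \<in> borel_measurable borel" unfolding K0_def by measurable
  have A: "0 \<le> A"
  proof -
    obtain x :: "real^'n" where "norm x = 1" using vector_choose_size[of 1] by auto
    then show ?thesis using size[of x] norm_ge_zero[of "K x"] by (force simp del: norm_ge_zero)
  qed
  have "AE x in lborel. (x :: real^'n) \<noteq> 0" by (rule AE_lborel_singleton)
  with AEs have "AE x in lborel. K x = K0 x"
  proof eventually_elim
    fix x assume *: "Re (K' x) = r x" "Im (K' x) = i x" "x \<noteq> 0"
    then have "K1 x = K x" by (auto simp: K1_def K'_def complex_eq_iff)
    then show "K x = K0 x" using size[OF *(3)] by (simp add: K0_def)
  qed
  moreover have "norm (K0 x) \<le> A / norm x ^ CARD('n)" for x using A by (auto simp: K0_def)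
  ultimately show ?thesis using that m by blast
qed

text \<open>A normal form of the hypotheses from which the domain of \<open>T\<close> has
  disappeared, with a Borel kernel and integrals over \<open>lborel\<close>, so that product
  measurability is at hand.\<close>

definition cz_operator :: "(real^'n \<Rightarrow> complex) \<Rightarrow> real \<Rightarrow> ((real^'n \<Rightarrow> complex) \<Rightarrow> real^'n \<Rightarrow> complex) \<Rightarrow> bool" where
  "cz_operator K A T \<longleftrightarrow> ae_linear T \<and> K \<in> borel_measurable borel \<and> (\<forall>x. norm (K x) \<le> A / norm x ^ CARD('n)) \<and>
    (\<forall>f\<in>test_functions. AE x in lebesgue. x \<notin> supp f \<longrightarrow> T f x = (\<integral>y. K (x - y) * f y \<partial>lborel))"

lemma cz_operator_of_singular_integral:
  fixes K :: "real^'n \<Rightarrow> complex"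
  assumes "singular_integral_operator K D T" "K0 \<in> borel_measurable borel"
    "\<And>x. norm (K0 x) \<le> A / norm x ^ CARD('n)" "AE x in lborel. K x = K0 x"
  shows "cz_operator K0 A T"
proof -
  have D: "test_functions \<subseteq> D" and lin: "ae_linear T"
    using assms(1) unfolding singular_integral_operator_def ae_linear_def by blast+
  have "AE x in lebesgue. x \<notin> supp f \<longrightarrow> T f x = (\<integral>y. K0 (x - y) * f y \<partial>lborel)" if f: "f \<in> test_functions" for f
  proof -
    have "f \<in> D" "integrable lebesgue f" "compact (supp f)"
      using f D test_integrable by (auto simp: test_functions_iff)
    then have *: "AE x in lebesgue. x \<notin> supp f \<longrightarrow> T f x = (\<integral>y. K (x - y) * f y \<partial>lebesgue)"
      using assms(1) unfolding singular_integral_operator_def by blast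
    have "(\<integral>y. K (x - y) * f y \<partial>lebesgue) = (\<integral>y. K0 (x - y) * f y \<partial>lborel)" for x
    proof -
      have m: "(\<lambda>y. K0 (x - y) * f y) \<in> borel_measurable lborel"
        using assms(2) test_borel[OF f] by measurable
      have "AE y in lborel. K (x + (-1) *\<^sub>R y) = K0 (x + (-1) *\<^sub>R y)"
        by (rule AE_lborel_affine[OF assms(4)]) simp
      then have ae: "AE y in lborel. K (x - y) * f y = K0 (x - y) * f y" by eventually_elim simp
      have "(\<integral>y. K0 (x - y) * f y \<partial>lborel) = (\<integral>y. K0 (x - y) * f y \<partial>lebesgue)"
        using m by (simp add: integral_completion)
      also have "\<dots> = (\<integral>y. K (x - y) * f y \<partial>lebesgue)"
      proof (rule integral_cong_AE)
        show m': "(\<lambda>y. K0 (x - y) * f y) \<in> borel_measurable lebesgue" using m by (rule measurable_completion)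
        show ae': "AE y in lebesgue. K0 (x - y) * f y = K (x - y) * f y"
          using AE_completion[OF ae] by eventually_elim (rule sym)
        show "(\<lambda>y. K (x - y) * f y) \<in> borel_measurable lebesgue"
          by (rule borel_measurable_AE[OF m' ae'])
      qed
      finally show ?thesis ..
    qed
    with * show ?thesis by simp
  qed
  with lin assms show ?thesis by (simp add: cz_operator_def)
qed

text \<open>For fixed y both the kernel and its translate by y change on null sets only.\<close>

lemma hormander_inner_cong_AE:
  fixes K K0 :: "real^'n \<Rightarrow> complex"
  assumes "AE x in lborel. K x = K0 x"
  shows "hormander_inner K R = hormander_inner K0 R"
proof
  fix y
  have "AE x in lborel. K (- y + 1 *\<^sub>R x) = K0 (- y + 1 *\<^sub>R x)" by (rule AE_lborel_affine[OF assms]) simp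
  with assms have "AE x in lborel. K (x - y) - K x = K0 (x - y) - K0 x" by eventually_elim simp
  then show "hormander_inner K R y = hormander_inner K0 R y"
    unfolding hormander_inner_def nn_integral_completion by (intro nn_integral_cong_AE) auto
qed

lemma hormander_inner_borel:
  assumes K[measurable]: "K \<in> borel_measurable borel"
  shows "hormander_inner K R \<in> borel_measurable borel"
proof -
  have m: "(\<lambda>(y, x). ennreal (norm (K (x - y) - K x)) * indicator {x. norm x \<ge> 2 * R} x) \<in> borel_measurable (lborel \<Otimes>\<^sub>M lborel)"
    by measurable
  have "(\<lambda>y. \<integral>\<^sup>+x. (\<lambda>(y, x). ennreal (norm (K (x - y) - K x)) * indicator {x. norm x \<ge> 2 * R} x) (y, x) \<partial>lborel) \<in> borel_measurable lborel"
    by (rule lborel.borel_measurable_nn_integral_fst[OF m])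
  then show ?thesis unfolding hormander_inner_def[abs_def] nn_integral_completion by simp
qed

lemma supp_subset_cball: "(\<And>x. R < norm (x - y) \<Longrightarrow> b x = 0) \<Longrightarrow> supp b \<subseteq> cball y R"
  unfolding supp_def by (intro closure_minimal subsetI)
    (auto simp: dist_norm norm_minus_commute simp flip: not_less)

lemma lborel_translate:
  assumes [measurable]: "f \<in> borel_measurable borel"
  shows "(\<integral>\<^sup>+x. f x \<partial>lborel) = (\<integral>\<^sup>+x. f (t + x :: 'a::euclidean_space) \<partial>lborel)"
  using nn_integral_affine[of f 1 t] by simp

lemma kernel_le_outside:
  assumes "\<And>x. norm (K (x::real^'n)) \<le> A / norm x ^ CARD('n)" "0 \<le> A" "0 < r" "r \<le> norm x"
  shows "norm (K x) \<le> A / r ^ CARD('n)"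
  using assms(1)[of x] assms(2-)
  by (meson divide_left_mono order_trans power_mono less_imp_le mult_pos_pos zero_less_power order_less_le_trans)

lemma cz_operator_A: "cz_operator K A (T :: (real^'n \<Rightarrow> complex) \<Rightarrow> _) \<Longrightarrow> 0 \<le> A"
proof -
  assume T: "cz_operator K A T"
  obtain x :: "real^'n" where "norm x = 1" using vector_choose_size[of 1] by auto
  then have "norm (K x) \<le> A" using T unfolding cz_operator_def by (metis div_by_1 power_one)
  then show ?thesis using norm_ge_zero[of "K x"] by linarith
qed

text \<open>The vanishing mean allows \<open>K (x - y0)\<close> to be subtracted under the integral;
  Tonelli and a translation of the centre to 0 then produce \<open>hormander_inner\<close>. If x is
  at distance at least 2 R from the centre and y in the ball, then x and y are at least R apart, so
  the size bound gives integrability.\<close>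

lemma atom_far_estimate:
  fixes K :: "real^'n \<Rightarrow> complex"
  assumes T: "cz_operator K A T" and b: "b \<in> test_functions" and R: "0 < R"
    and b0: "\<And>x. R < norm (x - y0) \<Longrightarrow> b x = 0" and mean: "integral\<^sup>L lebesgue b = 0"
  shows "(\<integral>\<^sup>+x. ennreal (norm (T b x)) * indicator {x. 2 * R \<le> norm (x - y0)} x \<partial>lebesgue)
     \<le> (\<integral>\<^sup>+z. ennreal (norm (b (y0 + z))) * hormander_inner K R z \<partial>lborel)"
proof -
  have K[measurable]: "K \<in> borel_measurable borel" and size: "\<And>x. norm (K x) \<le> A / norm x ^ CARD('n)"
    using T by (auto simp: cz_operator_def)
  note A = cz_operator_A[OF T]
  have bm[measurable]: "b \<in> borel_measurable borel" by (rule test_borel[OF b])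
  have bi: "integrable lborel b" using test_integrable[OF b] by (simp add: integrable_completion)
  have mean': "integral\<^sup>L lborel b = 0" using mean by (simp add: integral_completion)
  have "AE x in lebesgue. x \<notin> supp b \<longrightarrow> T b x = (\<integral>y. K (x - y) * b y \<partial>lborel)"
    using T b unfolding cz_operator_def by blast
  then have "AE x in lebesgue. ennreal (norm (T b x)) * indicator {x. 2 * R \<le> norm (x - y0)} x
     \<le> (\<integral>\<^sup>+y. ennreal (norm (K (x - y) - K (x - y0))) * ennreal (norm (b y)) * indicator {x. 2 * R \<le> norm (x - y0)} x \<partial>lborel)"
  proof eventually_elim
    case (elim x)
    show ?case
    proof (cases "2 * R \<le> norm (x - y0)")
      case True
      have "x \<notin> cball y0 R" using True R by (auto simp: dist_norm norm_minus_commute)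
      then have "x \<notin> supp b" using supp_subset_cball[of R y0 b] b0 by blast
      then have Tb: "T b x = (\<integral>y. K (x - y) * b y \<partial>lborel)" using elim by blast
      have i1: "integrable lborel (\<lambda>y. K (x - y) * b y)"
      proof (rule Bochner_Integration.integrable_bound[where f="\<lambda>y. of_real (A / R ^ CARD('n)) * b y"])
        show "integrable lborel (\<lambda>y. of_real (A / R ^ CARD('n)) * b y)" using bi by simp
        show "AE y in lborel. norm (K (x - y) * b y) \<le> norm (of_real (A / R ^ CARD('n)) * b y)"
        proof (rule AE_I2)
          fix y
          show "norm (K (x - y) * b y) \<le> norm (of_real (A / R ^ CARD('n)) * b y)"
          proof (cases "b y = 0")
            case False
            then have "norm (y - y0) \<le> R" using b0[of y] by fastforce
            then have "R \<le> norm (x - y)" using True norm_triangle_ineq[of "x - y" "y - y0"] by simp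
            then have "norm (K (x - y)) \<le> A / R ^ CARD('n)" by (rule kernel_le_outside[OF size A R])
            then have "norm (K (x - y)) * norm (b y) \<le> \<bar>A / R ^ CARD('n)\<bar> * norm (b y)"
              by (intro mult_right_mono order_trans[OF _ abs_ge_self]) auto
            then show ?thesis by (simp only: norm_mult norm_of_real)
          qed simp
        qed
      qed measurable
      have i2: "integrable lborel (\<lambda>y. K (x - y0) * b y)" using bi by simp
      have "T b x = (\<integral>y. K (x - y) * b y - K (x - y0) * b y \<partial>lborel)"
        using mean' unfolding Tb Bochner_Integration.integral_diff[OF i1 i2] by simp
      then have "ennreal (norm (T b x)) \<le> (\<integral>\<^sup>+y. ennreal (norm (K (x - y) * b y - K (x - y0) * b y)) \<partial>lborel)"
        using integral_norm_bound_ennreal[OF Bochner_Integration.integrable_diff[OF i1 i2]] by simp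
      also have "\<dots> = (\<integral>\<^sup>+y. ennreal (norm (K (x - y) - K (x - y0))) * ennreal (norm (b y)) \<partial>lborel)"
        by (simp add: left_diff_distrib[symmetric] norm_mult ennreal_mult')
      finally show ?thesis using True by simp
    qed simp
  qed
  then have "(\<integral>\<^sup>+x. ennreal (norm (T b x)) * indicator {x. 2 * R \<le> norm (x - y0)} x \<partial>lebesgue)
     \<le> (\<integral>\<^sup>+x. (\<integral>\<^sup>+y. ennreal (norm (K (x - y) - K (x - y0))) * ennreal (norm (b y)) * indicator {x. 2 * R \<le> norm (x - y0)} x \<partial>lborel) \<partial>lebesgue)"
    by (rule nn_integral_mono_AE)
  also have "\<dots> = (\<integral>\<^sup>+x. (\<integral>\<^sup>+y. ennreal (norm (K (x - y) - K (x - y0))) * ennreal (norm (b y)) * indicator {x. 2 * R \<le> norm (x - y0)} x \<partial>lborel) \<partial>lborel)"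
    by (rule nn_integral_completion)
  also have "\<dots> = (\<integral>\<^sup>+y. (\<integral>\<^sup>+x. ennreal (norm (K (x - y) - K (x - y0))) * ennreal (norm (b y)) * indicator {x. 2 * R \<le> norm (x - y0)} x \<partial>lborel) \<partial>lborel)"
    by (rule lborel_pair.Fubini') measurable
  also have "\<dots> = (\<integral>\<^sup>+z. (\<integral>\<^sup>+x. ennreal (norm (K (x - (y0 + z)) - K (x - y0))) * ennreal (norm (b (y0 + z))) * indicator {x. 2 * R \<le> norm (x - y0)} x \<partial>lborel) \<partial>lborel)"
    by (rule lborel_translate[of _ y0]) measurable
  also have "\<dots> = (\<integral>\<^sup>+z. ennreal (norm (b (y0 + z))) * hormander_inner K R z \<partial>lborel)"
  proof (rule nn_integral_cong)
    fix z
    have "(\<integral>\<^sup>+x. ennreal (norm (K (x - (y0 + z)) - K (x - y0))) * ennreal (norm (b (y0 + z))) * indicator {x. 2 * R \<le> norm (x - y0)} x \<partial>lborel)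
      = (\<integral>\<^sup>+x. ennreal (norm (K (y0 + x - (y0 + z)) - K (y0 + x - y0))) * ennreal (norm (b (y0 + z))) * indicator {x. 2 * R \<le> norm (x - y0)} (y0 + x) \<partial>lborel)"
      by (rule lborel_translate[of _ y0]) measurable
    also have "\<dots> = (\<integral>\<^sup>+x. ennreal (norm (b (y0 + z))) * (ennreal (norm (K (x - z) - K x)) * indicator {x. 2 * R \<le> norm x} x) \<partial>lborel)"
      by (intro nn_integral_cong) (auto simp: indicator_def mult.commute)
    also have "\<dots> = ennreal (norm (b (y0 + z))) * (\<integral>\<^sup>+x. ennreal (norm (K (x - z) - K x)) * indicator {x. 2 * R \<le> norm x} x \<partial>lborel)"
      by (rule nn_integral_cmult) measurable
    finally show "(\<integral>\<^sup>+x. ennreal (norm (K (x - (y0 + z)) - K (x - y0))) * ennreal (norm (b (y0 + z))) * indicator {x. 2 * R \<le> norm (x - y0)} x \<partial>lborel)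
      = ennreal (norm (b (y0 + z))) * hormander_inner K R z"
      by (simp add: hormander_inner_def nn_integral_completion)
  qed
  finally show ?thesis .
qed


section \<open>Level sets of the bad and the good part\<close>

lemma nn_integral_markov_powr:
  fixes h :: "'a::euclidean_space \<Rightarrow> complex"
  assumes h: "h \<in> borel_measurable lebesgue" and t: "0 < t" and q: "0 < q"
  shows "emeasure lebesgue {x. t < norm (h x)} \<le> ennreal (t powr (- q)) * power_integral q h"
proof -
  have m: "(\<lambda>x. norm (h x)) \<in> borel_measurable lebesgue" using h by measurable
  from borel_measurable_less[OF borel_measurable_const this, of t]
  have "{x. t < norm (h x)} \<in> sets lebesgue" by simp
  then have "emeasure lebesgue {x. t < norm (h x)} = (\<integral>\<^sup>+x. indicator {x. t < norm (h x)} x \<partial>lebesgue)" by simp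
  also have "\<dots> \<le> (\<integral>\<^sup>+x. ennreal (t powr (- q)) * ennreal (norm (h x) powr q) \<partial>lebesgue)"
  proof (rule nn_integral_mono)
    fix x
    have "1 \<le> t powr (- q) * norm (h x) powr q" if "t < norm (h x)"
    proof -
      have "1 = t powr (- q) * t powr q" using t by (simp add: powr_add[symmetric])
      also have "\<dots> \<le> t powr (- q) * norm (h x) powr q" using that t q by (intro mult_left_mono powr_mono2) auto
      finally show ?thesis .
    qed
    then show "indicator {x. t < norm (h x)} x \<le> ennreal (t powr (- q)) * ennreal (norm (h x) powr q)"
      by (auto simp: indicator_def ennreal_mult'[symmetric])
  qed
  also have "\<dots> = ennreal (t powr (- q)) * power_integral q h"
    unfolding power_integral_def using h by (intro nn_integral_cmult) measurable
  finally show ?thesis .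
qed

text \<open>An additive form of Hoelder's inequality with the height t as free parameter, which
  covers q = 1 and q > 1 alike. For a member of a \<open>bad_family\<close> at height t, both terms
  are at most constant multiples of \<open>t * R ^ CARD('n)\<close>.\<close>

definition kernel_averages_bounded :: "real \<Rightarrow> (real^'n \<Rightarrow> complex) \<Rightarrow> bool" where
  "kernel_averages_bounded q K \<longleftrightarrow> (\<exists>H\<ge>0. \<forall>R>0. \<forall>t>0. \<forall>b. b \<in> borel_measurable borel \<longrightarrow> (\<forall>x. R < norm x \<longrightarrow> b x = (0::complex)) \<longrightarrow>
     (\<integral>\<^sup>+z. ennreal (norm (b z)) * hormander_inner K R z \<partial>lborel)
       \<le> ennreal H * (ennreal (t * R ^ CARD('n)) + ennreal (t powr (1 - q)) * power_integral q b))"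

lemma power_integral_translate:
  assumes [measurable]: "b \<in> borel_measurable borel"
  shows "power_integral q (\<lambda>z. b (y + z)) = power_integral q b"
  unfolding power_integral_def nn_integral_completion by (rule lborel_translate[symmetric]) measurable

text \<open>The doubled balls are given up at the cost of their volume. Outside them Chebyshev's
  inequality applies to the sum of |T b_j|: each term integrates to at most a multiple of t R_j^n,
  and division by t leaves R_j^n.\<close>

lemma bad_bound_of_kernel:
  fixes K :: "real^'n \<Rightarrow> complex"
  assumes T: "cz_operator K A T" and q: "1 \<le> q" and H: "kernel_averages_bounded q K"
  shows "bad_bound T q"
  unfolding bad_bound_def
proof (rule allI)
  fix M :: real
  let ?n = "CARD('n)"
  have lin: "ae_linear T" using T by (simp add: cz_operator_def)
  obtain H where H0: "0 \<le> H" and H: "\<And>R t b. 0 < R \<Longrightarrow> 0 < t \<Longrightarrow> b \<in> borel_measurable borel \<Longrightarrow> (\<forall>x. R < norm x \<longrightarrow> b x = (0::complex)) \<Longrightarrow>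
     (\<integral>\<^sup>+z. ennreal (norm (b z)) * hormander_inner K R z \<partial>lborel)
       \<le> ennreal H * (ennreal (t * R ^ ?n) + ennreal (t powr (1 - q)) * power_integral q b)"
    using H unfolding kernel_averages_bounded_def by meson
  define V where "V = unit_ball_vol (real ?n) * 2 ^ ?n"
  have V: "0 \<le> V" by (simp add: V_def)
  \<comment> \<open>\<open>M\<close> is arbitrary and may be negative; the maximum with 0 keeps the
    constants nonnegative.\<close>
  define M' where "M' = max M 0"
  have M': "0 \<le> M'" by (simp add: M'_def)
  define C where "C = V + H * (1 + M')"
  have main: "emeasure lebesgue {x. t < norm (T (\<lambda>x. \<Sum>j\<in>J. b j x) x)} \<le> ennreal (C * (\<Sum>j\<in>J. R j ^ ?n))"
    if t: "0 < t" and bad: "bad_family q M t J b y R" for t b y R and J :: "(nat \<times> ('n \<Rightarrow> int)) set"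
  proof -
    have J: "finite J" and b: "\<And>j. j \<in> J \<Longrightarrow> b j \<in> test_functions" and R: "\<And>j. j \<in> J \<Longrightarrow> 0 < R j"
      and b0: "\<And>j x. j \<in> J \<Longrightarrow> R j < norm (x - y j) \<Longrightarrow> b j x = 0"
      and mean: "\<And>j. j \<in> J \<Longrightarrow> integral\<^sup>L lebesgue (b j) = 0"
      and Ipb: "\<And>j. j \<in> J \<Longrightarrow> power_integral q (b j) \<le> ennreal (M * t powr q * R j ^ ?n)"
      using bad unfolding bad_family_def by blast+
    have far: "(\<integral>\<^sup>+x. ennreal (norm (T (b j) x)) * indicator {x. 2 * R j \<le> norm (x - y j)} x \<partial>lebesgue)
       \<le> ennreal (H * (1 + M') * t * R j ^ ?n)" if j: "j \<in> J" for j
    proof -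
      have bm[measurable]: "b j \<in> borel_measurable borel" by (rule test_borel[OF b[OF j]])
      have "(\<integral>\<^sup>+x. ennreal (norm (T (b j) x)) * indicator {x. 2 * R j \<le> norm (x - y j)} x \<partial>lebesgue)
        \<le> (\<integral>\<^sup>+z. ennreal (norm (b j (y j + z))) * hormander_inner K (R j) z \<partial>lborel)"
        by (rule atom_far_estimate[OF T b[OF j] R[OF j] b0[OF j] mean[OF j]])
      also have "\<dots> \<le> ennreal H * (ennreal (t * R j ^ ?n) + ennreal (t powr (1 - q)) * power_integral q (\<lambda>z. b j (y j + z)))"
      proof (rule H[OF R[OF j] t])
        show "(\<lambda>z. b j (y j + z)) \<in> borel_measurable borel" by measurable
        show "\<forall>x. R j < norm x \<longrightarrow> b j (y j + x) = 0" using b0[OF j] by simp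
      qed
      also have "\<dots> \<le> ennreal H * (ennreal (t * R j ^ ?n) + ennreal (t powr (1 - q)) * ennreal (M' * t powr q * R j ^ ?n))"
      proof (intro mult_left_mono add_left_mono)
        have "power_integral q (b j) \<le> ennreal (M * t powr q * R j ^ ?n)" by (rule Ipb[OF j])
        also have "\<dots> \<le> ennreal (M' * t powr q * R j ^ ?n)"
          using R[OF j] by (intro ennreal_leI mult_right_mono) (auto simp: M'_def)
        finally show "power_integral q (\<lambda>z. b j (y j + z)) \<le> ennreal (M' * t powr q * R j ^ ?n)"
          unfolding power_integral_translate[OF bm] .
      qed auto
      also have "\<dots> = ennreal (H * (t * R j ^ ?n + t powr (1 - q) * (M' * t powr q * R j ^ ?n)))"
        using H0 t R[OF j] M' by (simp add: ennreal_mult'[symmetric] ennreal_plus[symmetric] del: ennreal_plus)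
      also have "t powr (1 - q) * (M' * t powr q * R j ^ ?n) = M' * (t powr (1 - q) * t powr q) * R j ^ ?n" by (simp add: mult_ac)
      also have "t powr (1 - q) * t powr q = t" using t by (simp add: powr_add[symmetric])
      also have "H * (t * R j ^ ?n + M' * t * R j ^ ?n) = H * (1 + M') * t * R j ^ ?n" by (simp add: algebra_simps)
      finally show ?thesis .
    qed
    let ?E = "\<Union>j\<in>J. cball (y j) (2 * R j)"
    let ?S = "\<lambda>x. \<Sum>j\<in>J. ennreal (norm (T (b j) x)) * indicator {x. 2 * R j \<le> norm (x - y j)} x"
    have E: "?E \<in> sets lebesgue" using J by (intro sets.finite_UN) auto
    have EV: "emeasure lebesgue ?E \<le> ennreal (V * (\<Sum>j\<in>J. R j ^ ?n))"
    proof -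
      have "emeasure lebesgue ?E \<le> (\<Sum>j\<in>J. emeasure lebesgue (cball (y j) (2 * R j)))"
        using J by (intro emeasure_subadditive_finite) auto
      also have "\<dots> = (\<Sum>j\<in>J. ennreal (V * R j ^ ?n))"
      proof (rule sum.cong[OF refl])
        fix j assume "j \<in> J"
        then show "emeasure lebesgue (cball (y j) (2 * R j)) = ennreal (V * R j ^ ?n)"
          using R[of j] by (simp add: emeasure_cball V_def power_mult_distrib mult.assoc)
      qed
      also have "\<dots> = ennreal (V * (\<Sum>j\<in>J. R j ^ ?n))"
        using V R by (simp add: sum_distrib_left sum_ennreal less_imp_le)
      finally show ?thesis .
    qed
    have Tm: "(\<lambda>x. norm (T (b j) x)) \<in> borel_measurable lebesgue" if "j \<in> J" for j
      using ae_linear_measurable[OF lin b[OF that]] by measurable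
    have ind: "(\<lambda>x. indicator {x. 2 * R j \<le> norm (x - y j)} x :: ennreal) \<in> borel_measurable lebesgue" for j
      by (intro measurable_completion borel_measurable_indicator) measurable
    have Sm1: "(\<lambda>x. ennreal (norm (T (b j) x)) * indicator {x. 2 * R j \<le> norm (x - y j)} x) \<in> borel_measurable lebesgue" if "j \<in> J" for j
      using Tm[OF that] ind[of j] by measurable
    have Sm: "?S \<in> borel_measurable lebesgue" using Sm1 by (intro borel_measurable_sum) auto
    have "AE x in lebesgue. T (\<lambda>x. \<Sum>j\<in>J. b j x) x = (\<Sum>j\<in>J. T (b j) x)"
      by (rule ae_linear_sum[OF lin J b])
    then have "AE x in lebesgue. x \<in> {x. t < norm (T (\<lambda>x. \<Sum>j\<in>J. b j x) x)} \<longrightarrow> x \<in> ?E \<union> {x. ennreal t < ?S x}"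
    proof (eventually_elim, intro impI)
      fix x assume e: "T (\<lambda>x. \<Sum>j\<in>J. b j x) x = (\<Sum>j\<in>J. T (b j) x)" and "x \<in> {x. t < norm (T (\<lambda>x. \<Sum>j\<in>J. b j x) x)}"
      then have tl: "t < norm (\<Sum>j\<in>J. T (b j) x)" by simp
      show "x \<in> ?E \<union> {x. ennreal t < ?S x}"
      proof (cases "x \<in> ?E")
        case False
        then have "2 * R j \<le> norm (x - y j)" if "j \<in> J" for j
          using that by (force simp: dist_norm norm_minus_commute not_le)
        then have "?S x = (\<Sum>j\<in>J. ennreal (norm (T (b j) x)))" by (intro sum.cong) auto
        also have "\<dots> = ennreal (\<Sum>j\<in>J. norm (T (b j) x))" by (intro sum_ennreal) auto
        also have "\<dots> \<ge> ennreal (norm (\<Sum>j\<in>J. T (b j) x))" by (intro ennreal_leI norm_sum)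
        finally have "ennreal (norm (\<Sum>j\<in>J. T (b j) x)) \<le> ?S x" .
        moreover have "ennreal t < ennreal (norm (\<Sum>j\<in>J. T (b j) x))" using tl t by (intro ennreal_lessI) auto
        ultimately have "ennreal t < ?S x" by (rule order_less_le_trans[rotated])
        then show ?thesis by simp
      qed simp
    qed
    moreover have St: "{x. ennreal t < ?S x} \<in> sets lebesgue"
      using borel_measurable_less[OF borel_measurable_const Sm, of "ennreal t"]
      by (simp only: space_completion space_lborel space_borel UNIV_I simp_thms)
    ultimately have "emeasure lebesgue {x. t < norm (T (\<lambda>x. \<Sum>j\<in>J. b j x) x)} \<le> emeasure lebesgue (?E \<union> {x. ennreal t < ?S x})"
      using E by (intro emeasure_mono_AE sets.Un)
    also have "\<dots> \<le> emeasure lebesgue ?E + emeasure lebesgue {x. ennreal t < ?S x}"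
      by (intro emeasure_subadditive E St)
    also have "emeasure lebesgue {x. ennreal t < ?S x} \<le> ennreal (H * (1 + M') * (\<Sum>j\<in>J. R j ^ ?n))"
    proof -
      have "emeasure lebesgue {x. ennreal t < ?S x} = (\<integral>\<^sup>+x. indicator {x. ennreal t < ?S x} x \<partial>lebesgue)"
        by (rule nn_integral_indicator[OF St, symmetric])
      also have "\<dots> \<le> (\<integral>\<^sup>+x. ennreal (1 / t) * ?S x \<partial>lebesgue)"
      proof (rule nn_integral_mono)
        fix x
        have "1 \<le> ennreal (1 / t) * ?S x" if "ennreal t < ?S x"
        proof -
          have "1 = ennreal (1 / t) * ennreal t" using t by (simp add: ennreal_mult'[symmetric])
          also have "\<dots> \<le> ennreal (1 / t) * ?S x" using that by (intro mult_left_mono) auto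
          finally show ?thesis .
        qed
        then show "indicator {x. ennreal t < ?S x} x \<le> ennreal (1 / t) * ?S x"
          by (auto simp: indicator_def)
      qed
      also have "\<dots> = ennreal (1 / t) * (\<Sum>j\<in>J. \<integral>\<^sup>+x. ennreal (norm (T (b j) x)) * indicator {x. 2 * R j \<le> norm (x - y j)} x \<partial>lebesgue)"
        unfolding nn_integral_cmult[OF Sm] by (subst nn_integral_sum[OF Sm1]) auto
      also have "\<dots> \<le> ennreal (1 / t) * (\<Sum>j\<in>J. ennreal (H * (1 + M') * t * R j ^ ?n))"
        by (intro mult_left_mono sum_mono far) auto
      also have "\<dots> = ennreal (1 / t) * ennreal (\<Sum>j\<in>J. H * (1 + M') * t * R j ^ ?n)"
        using H0 M' t R by (subst sum_ennreal) (auto simp: less_imp_le)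
      also have "\<dots> = ennreal (1 / t * (\<Sum>j\<in>J. H * (1 + M') * t * R j ^ ?n))"
        using t by (intro ennreal_mult'[symmetric]) simp
      also have "1 / t * (\<Sum>j\<in>J. H * (1 + M') * t * R j ^ ?n) = H * (1 + M') * (\<Sum>j\<in>J. R j ^ ?n)"
        using t by (simp add: sum_distrib_left mult.assoc)
      finally show ?thesis .
    qed
    also have "emeasure lebesgue ?E \<le> ennreal (V * (\<Sum>j\<in>J. R j ^ ?n))" by (rule EV)
    also have "ennreal (V * (\<Sum>j\<in>J. R j ^ ?n)) + ennreal (H * (1 + M') * (\<Sum>j\<in>J. R j ^ ?n)) = ennreal (C * (\<Sum>j\<in>J. R j ^ ?n))"
    proof -
      have "0 \<le> (\<Sum>j\<in>J. R j ^ ?n)" using R by (intro sum_nonneg) (simp add: less_imp_le)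
      then show ?thesis using V H0 M' by (subst ennreal_plus[symmetric]) (auto simp: C_def distrib_right)
    qed
    finally show ?thesis by (simp add: add_mono)
  qed
  then show "\<exists>C\<ge>0. \<forall>t>0. \<forall>(J::(nat \<times> ('n \<Rightarrow> int)) set) b y R. bad_family q M t J b y R \<longrightarrow>
     emeasure lebesgue {x. t < norm (T (\<lambda>x. \<Sum>j\<in>J. b j x) x)} \<le> ennreal (C * (\<Sum>j\<in>J. R j ^ CARD('n)))"
    using V H0 M' by (intro exI[of _ C]) (simp add: C_def)
qed

lemma bad_bound_of_Ip:
  fixes T :: "(real^'n \<Rightarrow> complex) \<Rightarrow> real^'n \<Rightarrow> complex"
  assumes lin: "ae_linear T" and q: "0 < q" and C: "0 \<le> C" "\<And>f. f \<in> test_functions \<Longrightarrow> power_integral q (T f) \<le> ennreal C * power_integral q f"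
  shows "bad_bound T q"
  unfolding bad_bound_def
proof (intro allI exI conjI impI)
  fix M t :: real and J :: "(nat \<times> ('n \<Rightarrow> int)) set"
    and b :: "nat \<times> ('n \<Rightarrow> int) \<Rightarrow> real^'n \<Rightarrow> complex" and y :: "nat \<times> ('n \<Rightarrow> int) \<Rightarrow> real^'n" and R
  show "0 \<le> C * max M 0" using C by simp
  assume t: "0 < t" and bad: "bad_family q M t J b y R"
  let ?b = "\<lambda>x. \<Sum>j\<in>J. b j x"
  let ?R = "\<Sum>j\<in>J. R j ^ CARD('n)"
  have bt: "?b \<in> test_functions" using bad by (intro test_sum) (auto simp: bad_family_def)
  have R0: "0 \<le> ?R" using bad by (intro sum_nonneg) (auto simp: bad_family_def less_imp_le)
  have "emeasure lebesgue {x. t < norm (T ?b x)} \<le> ennreal (t powr (- q)) * power_integral q (T ?b)"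
    by (rule nn_integral_markov_powr[OF ae_linear_measurable[OF lin bt] t q])
  also have "\<dots> \<le> ennreal (t powr (- q)) * (ennreal C * power_integral q ?b)" by (intro mult_left_mono C bt) auto
  also have "\<dots> \<le> ennreal (t powr (- q)) * (ennreal C * ennreal (max M 0 * t powr q * ?R))"
  proof (intro mult_left_mono)
    have "power_integral q ?b \<le> ennreal (M * t powr q * ?R)" using bad by (simp add: bad_family_def)
    also have "\<dots> \<le> ennreal (max M 0 * t powr q * ?R)" using R0 by (intro ennreal_leI mult_right_mono) auto
    finally show "power_integral q ?b \<le> ennreal (max M 0 * t powr q * ?R)" .
  qed auto
  also have "\<dots> = ennreal (t powr (- q) * (C * (max M 0 * t powr q * ?R)))"
    using C R0 by (simp add: ennreal_mult'[symmetric])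
  also have "t powr (- q) * (C * (max M 0 * t powr q * ?R)) = (t powr (-q) * t powr q) * (C * max M 0 * ?R)"
    by (simp only: mult_ac)
  also have "t powr (-q) * t powr q = 1" using t by (simp add: powr_add[symmetric])
  finally show "emeasure lebesgue {x. t < norm (T ?b x)} \<le> ennreal (C * max M 0 * ?R)" by simp
qed

lemma good_bound_of_Ip:
  fixes T :: "('a::euclidean_space \<Rightarrow> complex) \<Rightarrow> 'a \<Rightarrow> complex"
  assumes lin: "ae_linear T" and s: "0 < s" and C: "0 \<le> C" "\<And>f. f \<in> test_functions \<Longrightarrow> power_integral s (T f) \<le> ennreal C * power_integral s f"
  shows "good_bound T s"
  unfolding good_bound_def
proof (intro exI conjI allI impI ballI)
  fix t :: real and g :: "'a \<Rightarrow> complex" assume t: "0 < t" and g: "g \<in> test_functions"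
  have "emeasure lebesgue {x. 1 * t < norm (T g x)} \<le> ennreal (t powr (- s)) * power_integral s (T g)"
    using nn_integral_markov_powr[OF ae_linear_measurable[OF lin g] t s] by simp
  also have "\<dots> \<le> ennreal (t powr (- s)) * (ennreal C * power_integral s g)" by (intro mult_left_mono C g) auto
  also have "\<dots> = ennreal (C * t powr (- s)) * power_integral s g" using C by (simp add: ennreal_mult' mult_ac)
  finally show "emeasure lebesgue {x. 1 * t < norm (T g x)} \<le> ennreal (C * t powr (- s)) * power_integral s g" .
qed (use C in auto)

section \<open>Conjugate exponents and the averaged kernel condition\<close>

lemma holder_conjugate_cases:
  assumes "holder_conjugate p p'"
  obtains (top_one) "p = \<infinity>" "p' = 1" | (one_top) "p = 1" "p' = \<infinity>"
    | (real) a b where "p = ennreal a" "p' = ennreal b" "1 < a" "1 < b" "1 / a + 1 / b = 1"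
proof -
  have *: "1 / p + 1 / p' = 1" using assms by (simp add: holder_conjugate_def)
  have inv_1: "x = 1" if "1 / x = 1" for x :: ennreal
  proof (cases x)
    case (real r)
    then have "r \<noteq> 0" using that by (cases "r = 0") (auto simp: divide_ennreal_def)
    then show ?thesis using that real
      by (simp add: divide_ennreal ennreal_1[symmetric] del: ennreal_1)
  next
    case top then show ?thesis using that by (simp add: divide_ennreal_def)
  qed
  have inv_0: "x = \<infinity>" if "1 / x = 0" for x :: ennreal
    using that by (simp add: divide_ennreal_def)
  show ?thesis
  proof (cases p)
    case top
    then have "1 / p' = 1" using * by (simp add: divide_ennreal_def)
    then show ?thesis using inv_1 top top_one by simp
  next
    case (real a)
    show ?thesis
    proof (cases p')
      case top
      then have "1 / p = 1" using * by (simp add: divide_ennreal_def)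
      then show ?thesis using inv_1 top one_top by simp
    next
      case (real b)
      note a = \<open>p = ennreal a\<close> \<open>0 \<le> a\<close> and b = real
      \<comment> \<open>In \<open>ennreal\<close> the quotient 1 / 0 is infinite, which excludes the
        exponent 0.\<close>
      have "a \<noteq> 0"
      proof
        assume "a = 0" then have "1 / p = \<infinity>" using a by (simp add: divide_ennreal_def)
        then show False using * by simp
      qed
      moreover have "b \<noteq> 0"
      proof
        assume "b = 0" then have "1 / p' = \<infinity>" using b by (simp add: divide_ennreal_def)
        then show False using * by simp
      qed
      ultimately have ab: "a > 0" "b > 0" using a b by auto
      have "ennreal (1 / a + 1 / b) = ennreal 1"
        using * a b ab by (simp add: divide_ennreal ennreal_1[symmetric] ennreal_plus[symmetric] del: ennreal_1 ennreal_plus)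
      then have s: "1 / a + 1 / b = 1" using ab by (subst (asm) ennreal_inj) auto
      have "1 / a < 1" "1 / b < 1" using s ab by (smt (verit) divide_pos_pos)+
      then have "1 < a" "1 < b" using ab by (auto simp: divide_less_eq)
      then show ?thesis using that(3) a b s by blast
    qed
  qed
qed

lemma young_powr:
  fixes a b :: real
  assumes "1 < q" "1 < r" "1 / q + 1 / r = 1" "0 \<le> a" "0 \<le> b"
  shows "a * b \<le> a powr q + b powr r"
proof -
  have "a * b \<le> a powr q / q + b powr r / r" by (rule Youngs_inequality[OF assms])
  also have "\<dots> \<le> a powr q + b powr r"
    using assms by (intro add_mono) (auto simp: divide_le_eq mult_le_cancel_left1)
  finally show ?thesis .
qed

lemma ennreal_powr_leD:
  assumes "ennreal_powr X (1 / r) \<le> ennreal c" "0 < r" "0 \<le> c"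
  shows "X \<le> ennreal (c powr r)"
proof (cases X)
  case (real x)
  then have "x powr (1 / r) \<le> c" using assms by (simp add: ennreal_powr_def)
  then have "(x powr (1 / r)) powr r \<le> c powr r" using assms by (intro powr_mono2) auto
  then show ?thesis using real assms by (simp add: powr_powr ennreal_leI)
next
  case top
  then show ?thesis using assms by (simp add: ennreal_powr_def top_unique)
qed

lemma ennreal_powr_measurable [measurable]:
  "(\<lambda>x. ennreal_powr x a) \<in> borel_measurable borel"
  unfolding ennreal_powr_def by measurable

text \<open>For q = 1 the condition bounds an essential supremum. Otherwise Young's inequality is
  applied to |b| / t and the inner integral h, and the average of h powr r over the ball accounts
  for the second term.\<close>

lemma kernel_averages_bounded_of_hormander:
  fixes K :: "real^'n \<Rightarrow> complex"
  assumes K: "K \<in> borel_measurable borel" and q: "1 \<le> q" and conj: "holder_conjugate (ennreal q) q'"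
    and fin: "hormander_const q' K < \<infinity>"
  shows "kernel_averages_bounded q K"
proof -
  let ?n = "CARD('n)"
  define c where "c = enn2real (hormander_const q' K)"
  have c: "hormander_const q' K = ennreal c" "0 \<le> c" using fin by (auto simp: c_def)
  note hb[measurable] = hormander_inner_borel[OF K]
  have pm[measurable]: "(\<lambda>z. ennreal_powr (hormander_inner K R z) r) \<in> borel_measurable borel" for R r
    by (rule measurable_compose[OF hb ennreal_powr_measurable])
  have upper: "(if q' = \<infinity> then esssup (lebesgue_on (cball 0 R)) (hormander_inner K R)
    else ennreal_powr
      (ennreal (1 / (measure lebesgue (ball 0 1 :: (real^'n) set) * R ^ CARD('n))) *
        (\<integral>\<^sup>+y\<in>cball 0 R. ennreal_powr (hormander_inner K R y) (enn2real q') \<partial>lebesgue))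
      (1 / enn2real q')) \<le> ennreal c" if "0 < R" for R
    unfolding c(1)[symmetric] hormander_const_def using that by (intro SUP_upper2[where i=R]) auto
  from conj show ?thesis
  proof (cases rule: holder_conjugate_cases)
    case top_one then show ?thesis by simp
  next
    case one_top
    then have q1: "q = 1" by simp
    show ?thesis unfolding kernel_averages_bounded_def
    proof (intro exI[of _ c] conjI c allI impI)
      fix R t :: real and b :: "real^'n \<Rightarrow> complex"
      assume R: "0 < R" and t: "0 < t" and b[measurable]: "b \<in> borel_measurable borel" and b0: "\<forall>x. R < norm x \<longrightarrow> b x = 0"
      have "AE x in lebesgue_on (cball 0 R). hormander_inner K R x \<le> esssup (lebesgue_on (cball 0 R)) (hormander_inner K R)"
        by (rule esssup_AE)
      then have "AE x in lebesgue_on (cball 0 R). hormander_inner K R x \<le> ennreal c"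
        using upper[OF R] one_top by (auto elim!: eventually_mono)
      then have "AE x in lebesgue. x \<in> cball 0 R \<longrightarrow> hormander_inner K R x \<le> ennreal c"
        by (subst (asm) AE_restrict_space_iff) auto
      then have "AE x in lebesgue. ennreal (norm (b x)) * hormander_inner K R x \<le> ennreal c * ennreal (norm (b x))"
      proof eventually_elim
        case (elim x)
        show ?case
        proof (cases "norm x \<le> R")
          case True
          then have "ennreal (norm (b x)) * hormander_inner K R x \<le> ennreal (norm (b x)) * ennreal c"
            using elim by (intro mult_left_mono) auto
          then show ?thesis by (simp add: mult.commute)
        qed (use b0 in auto)
      qed
      then have "(\<integral>\<^sup>+z. ennreal (norm (b z)) * hormander_inner K R z \<partial>lebesgue) \<le> (\<integral>\<^sup>+z. ennreal c * ennreal (norm (b z)) \<partial>lebesgue)"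
        by (rule nn_integral_mono_AE)
      also have "\<dots> = ennreal c * power_integral q b"
        unfolding power_integral_def q1 nn_integral_completion by (subst nn_integral_cmult) auto
      also have "\<dots> \<le> ennreal c * (ennreal (t * R ^ ?n) + ennreal (t powr (1 - q)) * power_integral q b)"
        using t by (intro mult_left_mono) (auto simp: q1)
      finally show "(\<integral>\<^sup>+z. ennreal (norm (b z)) * hormander_inner K R z \<partial>lborel)
        \<le> ennreal c * (ennreal (t * R ^ ?n) + ennreal (t powr (1 - q)) * power_integral q b)"
        by (simp only: nn_integral_completion)
    qed
  next
    case (real a r)
    then have qr: "1 < q" "1 < r" "1 / q + 1 / r = 1" using q by auto
    have q': "q' \<noteq> \<infinity>" "enn2real q' = r" using real by auto
    define m where "m = measure lebesgue (ball 0 1 :: (real^'n) set)"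
    have m: "m > 0" unfolding m_def by (simp add: content_ball)
    have avg: "(\<integral>\<^sup>+y. ennreal_powr (hormander_inner K R y) r * indicator (cball 0 R) y \<partial>lborel) \<le> ennreal (m * c powr r * R ^ ?n)"
      if R: "0 < R" for R
    proof -
      let ?I = "\<integral>\<^sup>+y. ennreal_powr (hormander_inner K R y) r * indicator (cball 0 R) y \<partial>lborel"
      have "ennreal (1 / (m * R ^ ?n)) * ?I \<le> ennreal (c powr r)"
        using upper[OF R] q' qr c by (intro ennreal_powr_leD) (auto simp: nn_integral_completion m_def)
      then have "ennreal (m * R ^ ?n) * (ennreal (1 / (m * R ^ ?n)) * ?I) \<le> ennreal (m * R ^ ?n) * ennreal (c powr r)"
        by (rule mult_left_mono) simp
      moreover have "ennreal (m * R ^ ?n) * ennreal (1 / (m * R ^ ?n)) = 1"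
        using m R by (subst ennreal_mult'[symmetric]) auto
      moreover have "ennreal (m * R ^ ?n) * ennreal (c powr r) = ennreal (m * c powr r * R ^ ?n)"
        using m R by (subst ennreal_mult'[symmetric]) (auto simp: mult_ac)
      ultimately show ?thesis by (simp only: mult.assoc[symmetric] mult_1)
    qed
    \<comment> \<open>The term with \<open>power_integral q b\<close> has coefficient 1, the volume
      term has coefficient \<open>m * c powr r\<close>; one constant must dominate both.\<close>
    define H where "H = max 1 (m * c powr r)"
    show ?thesis unfolding kernel_averages_bounded_def
    proof (intro exI[of _ H] conjI allI impI)
      show "0 \<le> H" by (simp add: H_def)
      fix R t :: real and b :: "real^'n \<Rightarrow> complex"
      assume R: "0 < R" and t: "0 < t" and b[measurable]: "b \<in> borel_measurable borel" and b0: "\<forall>x. R < norm x \<longrightarrow> b x = 0"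
      have "(\<integral>\<^sup>+z. ennreal (norm (b z)) * hormander_inner K R z \<partial>lborel)
        \<le> (\<integral>\<^sup>+z. ennreal (t powr (1 - q)) * ennreal (norm (b z) powr q)
            + ennreal t * (ennreal_powr (hormander_inner K R z) r * indicator (cball 0 R) z) \<partial>lborel)"
      proof (rule nn_integral_mono)
        fix z
        show "ennreal (norm (b z)) * hormander_inner K R z \<le> ennreal (t powr (1 - q)) * ennreal (norm (b z) powr q)
            + ennreal t * (ennreal_powr (hormander_inner K R z) r * indicator (cball 0 R) z)"
        proof (cases "norm z \<le> R")
          case False then show ?thesis using b0 by simp
        next
          case True
          show ?thesis
          proof (cases "hormander_inner K R z")
            \<comment> \<open>An infinite inner integral makes the right-hand side infinite as well,
              since z lies in the ball and t > 0.\<close>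
            case top
            then show ?thesis using True t by (simp add: ennreal_powr_def ennreal_mult_top)
          next
            case (real k)
            have "norm (b z) * k = t * ((norm (b z) / t) * k)" using t by simp
            also have "\<dots> \<le> t * ((norm (b z) / t) powr q + k powr r)"
              using t real qr by (intro mult_left_mono young_powr) auto
            also have "\<dots> = t * (norm (b z) powr q / t powr q) + t * k powr r"
              using t by (simp add: powr_divide distrib_left)
            also have "t * (norm (b z) powr q / t powr q) = t powr (1 - q) * norm (b z) powr q"
              using t by (simp add: powr_diff)
            finally have "ennreal (norm (b z) * k) \<le> ennreal (t powr (1 - q) * norm (b z) powr q + t * k powr r)"
              by (rule ennreal_leI)
            then show ?thesis using True real t
              by (simp add: ennreal_powr_def ennreal_mult' ennreal_plus)
          qed
        qed
      qed
      also have "\<dots> = ennreal (t powr (1 - q)) * power_integral q b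
          + ennreal t * (\<integral>\<^sup>+z. ennreal_powr (hormander_inner K R z) r * indicator (cball 0 R) z \<partial>lborel)"
      proof -
        have "(\<lambda>z. ennreal_powr (hormander_inner K R z) r * indicator (cball 0 R) z) \<in> borel_measurable lborel"
          using pm[of R r] by (intro borel_measurable_times_ennreal borel_measurable_indicator) auto
        then show ?thesis
          unfolding power_integral_def nn_integral_completion by (subst nn_integral_add) (simp_all add: nn_integral_cmult)
      qed
      also have "\<dots> \<le> ennreal (t powr (1 - q)) * power_integral q b + ennreal t * ennreal (m * c powr r * R ^ ?n)"
        by (intro add_left_mono mult_left_mono avg R) auto
      also have "\<dots> = 1 * (ennreal (t powr (1 - q)) * power_integral q b) + ennreal (m * c powr r) * ennreal (t * R ^ ?n)"
        using t m by (simp add: ennreal_mult'[symmetric] mult_ac)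
      also have "\<dots> \<le> ennreal H * (ennreal (t powr (1 - q)) * power_integral q b) + ennreal H * ennreal (t * R ^ ?n)"
        unfolding H_def by (intro add_mono mult_right_mono) (auto simp: ennreal_leI ennreal_1[symmetric] simp del: ennreal_1)
      also have "\<dots> = ennreal H * (ennreal (t * R ^ ?n) + ennreal (t powr (1 - q)) * power_integral q b)"
        by (simp add: distrib_left add.commute)
      finally show "(\<integral>\<^sup>+z. ennreal (norm (b z)) * hormander_inner K R z \<partial>lborel)
        \<le> ennreal H * (ennreal (t * R ^ ?n) + ennreal (t powr (1 - q)) * power_integral q b)" .
    qed
  qed
qed

section \<open>Duality\<close>

lemma lborel_eq_distr_uminus: "(lborel :: 'a::euclidean_space measure) = distr lborel borel uminus"
proof -
  have "(lborel :: 'a measure) = density (distr lborel borel (\<lambda>x. 0 + (- 1) *\<^sub>R x)) (\<lambda>_. ennreal (\<bar>- 1\<bar> ^ DIM('a)))"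
    by (rule lborel_affine) simp
  then show ?thesis by (simp add: density_1)
qed

lemma lborel_integral_uminus:
  fixes f :: "'a::euclidean_space \<Rightarrow> 'b::{banach, second_countable_topology}"
  assumes [measurable]: "f \<in> borel_measurable borel"
  shows "(\<integral>x. f (- x) \<partial>lborel) = (\<integral>x. f x \<partial>lborel)"
  by (subst (2) lborel_eq_distr_uminus) (simp add: integral_distr)

lemma power_integral_reflect:
  fixes f :: "'a::euclidean_space \<Rightarrow> complex"
  assumes [measurable]: "f \<in> borel_measurable borel"
  shows "power_integral r (\<lambda>x. f (- x)) = power_integral r f"
  unfolding power_integral_def nn_integral_completion
  by (subst (2) lborel_eq_distr_uminus) (simp add: nn_integral_distr)

text \<open>Bilinear, without complex conjugation, so that it describes the transpose of
  \<open>T\<close> rather than the adjoint.\<close>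

definition pairing :: "(('a::euclidean_space \<Rightarrow> complex) \<Rightarrow> 'a \<Rightarrow> complex) \<Rightarrow> ('a \<Rightarrow> complex) \<Rightarrow> ('a \<Rightarrow> complex) \<Rightarrow> complex" where
  "pairing T f g = (\<integral>x. T f x * g x \<partial>lebesgue)"

lemma power_integral_eq_0_imp:
  assumes h: "h \<in> borel_measurable lebesgue" and "power_integral r h = 0"
  shows "AE x in lebesgue. h x = 0"
proof -
  have "(\<lambda>x. ennreal (norm (h x) powr r)) \<in> borel_measurable lebesgue" using h by measurable
  from nn_integral_0_iff_AE[OF this] assms(2) have "AE x in lebesgue. ennreal (norm (h x) powr r) = 0"
    by (simp add: power_integral_def)
  then show ?thesis by eventually_elim (simp add: ennreal_eq_0_iff powr_eq_0_iff)
qed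

lemma norm_powr_measurable:
  fixes h :: "'a::euclidean_space \<Rightarrow> complex"
  shows "h \<in> borel_measurable lebesgue \<Longrightarrow> (\<lambda>x. ennreal (norm (h x) powr r)) \<in> borel_measurable lebesgue"
  by measurable

lemma nn_integral_mult_young:
  fixes h g :: "'a::euclidean_space \<Rightarrow> complex"
  assumes hm: "h \<in> borel_measurable lebesgue" "g \<in> borel_measurable lebesgue"
    and pp: "1 < p" "1 < p'" "1 / p + 1 / p' = 1"
  shows "(\<integral>\<^sup>+x. ennreal (norm (h x * g x)) \<partial>lebesgue) \<le> power_integral p h + power_integral p' g"
proof -
  have "(\<integral>\<^sup>+x. ennreal (norm (h x * g x)) \<partial>lebesgue)
    \<le> (\<integral>\<^sup>+x. ennreal (norm (h x) powr p) + ennreal (norm (g x) powr p') \<partial>lebesgue)"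
    using young_powr[OF pp] by (intro nn_integral_mono) (simp add: norm_mult ennreal_plus[symmetric] ennreal_leI del: ennreal_plus)
  also have "\<dots> = power_integral p h + power_integral p' g"
    unfolding power_integral_def by (intro nn_integral_add norm_powr_measurable hm)
  finally show ?thesis .
qed

text \<open>The operator is bounded with exponent p; everything in this context prepares the bound
  with the conjugate exponent p'.\<close>

locale dual_pair =
  fixes K :: "real^'n \<Rightarrow> complex" and A :: real and T :: "(real^'n \<Rightarrow> complex) \<Rightarrow> real^'n \<Rightarrow> complex"
    and p p' C :: real
  assumes T: "cz_operator K A T" and pp: "1 < p" "1 < p'" "1 / p + 1 / p' = 1"
    and C: "0 \<le> C" "\<And>f. f \<in> test_functions \<Longrightarrow> power_integral p (T f) \<le> ennreal C * power_integral p f"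
begin

lemma lin: "ae_linear T" using T by (simp add: cz_operator_def)

lemma Tm: "f \<in> test_functions \<Longrightarrow> T f \<in> borel_measurable lebesgue"
  by (rule ae_linear_measurable[OF lin])

lemma pairing_le:
  assumes "f \<in> test_functions" "g \<in> test_functions"
  shows "(\<integral>\<^sup>+x. ennreal (norm (T f x * g x)) \<partial>lebesgue) \<le> ennreal C * power_integral p f + power_integral p' g"
  using nn_integral_mult_young[OF Tm[OF assms(1)] test_lebesgue[OF assms(2)] pp] C(2)[OF assms(1)]
  by (meson add_right_mono order_trans)

lemma pairing_integrable:
  assumes "f \<in> test_functions" "g \<in> test_functions"
  shows "integrable lebesgue (\<lambda>x. T f x * g x)"
proof (rule integrableI_bounded)
  show "(\<lambda>x. T f x * g x) \<in> borel_measurable lebesgue"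
    using Tm[OF assms(1)] test_lebesgue[OF assms(2)] by measurable
  have "power_integral p f < \<infinity>" "power_integral p' g < \<infinity>"
    using pp power_integral_test_finite[OF assms(1), of p] power_integral_test_finite[OF assms(2), of p'] by simp_all
  then have "ennreal C * power_integral p f + power_integral p' g < \<infinity>" by (simp add: ennreal_mult_less_top)
  then show "(\<integral>\<^sup>+x. ennreal (norm (T f x * g x)) \<partial>lebesgue) < \<infinity>"
    using pairing_le[OF assms] by (rule order_le_less_trans[rotated])
qed

lemma norm_pairing_le:
  assumes "f \<in> test_functions" "g \<in> test_functions"
  shows "ennreal (norm (pairing T f g)) \<le> ennreal C * power_integral p f + power_integral p' g"
  unfolding pairing_def
  using integral_norm_bound_ennreal[OF pairing_integrable[OF assms]] pairing_le[OF assms] by (rule order_trans)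

text \<open>Young's inequality is applied to T f / u and g / w: after this scaling both power
  integrals are at most multiples of m, and undoing it yields the product u w. If u or w is 0 the
  scaling is impossible, but then one factor vanishes almost everywhere.\<close>

lemma norm_pairing_scaled:
  assumes f: "f \<in> test_functions" and g: "g \<in> test_functions" and uw: "0 \<le> u" "0 \<le> w" and m: "0 \<le> m"
    and fu: "power_integral p f \<le> ennreal (u powr p * m)" and gw: "power_integral p' g \<le> ennreal (w powr p' * m)"
  shows "norm (pairing T f g) \<le> u * w * ((C + 1) * m)"
proof (cases "u = 0 \<or> w = 0")
  case True
  then have "AE x in lebesgue. T f x * g x = 0"
  proof
    assume "u = 0"
    then have "power_integral p f = 0" using fu by simp
    then have "power_integral p (T f) = 0" using C(2)[OF f] by simp
    from power_integral_eq_0_imp[OF Tm[OF f] this] show ?thesis by eventually_elim simp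
  next
    assume "w = 0"
    then have "power_integral p' g = 0" using gw by simp
    from power_integral_eq_0_imp[OF test_lebesgue[OF g] this] show ?thesis by eventually_elim simp
  qed
  then have "pairing T f g = 0" unfolding pairing_def by (rule integral_eq_zero_AE)
  then show ?thesis using uw m C by simp
next
  case False
  then have u: "0 < u" and w: "0 < w" using uw by auto
  have meas: "T f \<in> borel_measurable lebesgue" "g \<in> borel_measurable lebesgue" by (rule Tm[OF f], rule test_lebesgue[OF g])
  have mm: "(\<lambda>x. T f x / u) \<in> borel_measurable lebesgue" "(\<lambda>x. g x / w) \<in> borel_measurable lebesgue"
    unfolding divide_inverse by (intro borel_measurable_times meas borel_measurable_const)+
  have scale: "power_integral r (\<lambda>x. h x / complex_of_real a) = ennreal (a powr (- r)) * power_integral r h"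
    if "h \<in> borel_measurable lebesgue" "0 < a" for r a and h :: "real^'n \<Rightarrow> complex"
  proof -
    have "power_integral r (\<lambda>x. h x / complex_of_real a) = (\<integral>\<^sup>+x. ennreal (a powr (- r)) * ennreal (norm (h x) powr r) \<partial>lebesgue)"
      unfolding power_integral_def using that(2)
      by (intro nn_integral_cong) (simp add: norm_divide powr_divide powr_minus_divide ennreal_mult'[symmetric])
    also have "\<dots> = ennreal (a powr (- r)) * power_integral r h"
      unfolding power_integral_def using that(1) by (intro nn_integral_cmult) measurable
    finally show ?thesis .
  qed
  have "ennreal (norm (pairing T f g)) \<le> (\<integral>\<^sup>+x. ennreal (norm (T f x * g x)) \<partial>lebesgue)"
    unfolding pairing_def by (rule integral_norm_bound_ennreal[OF pairing_integrable[OF f g]])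
  also have "\<dots> = (\<integral>\<^sup>+x. ennreal (u * w) * ennreal (norm ((T f x / u) * (g x / w))) \<partial>lebesgue)"
    using u w by (intro nn_integral_cong) (simp add: norm_mult norm_divide ennreal_mult'[symmetric])
  also have "\<dots> = ennreal (u * w) * (\<integral>\<^sup>+x. ennreal (norm ((T f x / u) * (g x / w))) \<partial>lebesgue)"
    by (intro nn_integral_cmult measurable_compose[OF borel_measurable_times[OF mm], of "\<lambda>z. ennreal (norm z)"]) measurable
  also have "\<dots> \<le> ennreal (u * w) * (power_integral p (\<lambda>x. T f x / u) + power_integral p' (\<lambda>x. g x / w))"
    by (intro mult_left_mono nn_integral_mult_young pp mm) simp
  also have "\<dots> = ennreal (u * w) * (ennreal (u powr (- p)) * power_integral p (T f) + ennreal (w powr (- p')) * power_integral p' g)"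
    using scale[OF meas(1) u] scale[OF meas(2) w] by simp
  also have "\<dots> \<le> ennreal (u * w) * (ennreal (u powr (- p)) * (ennreal C * ennreal (u powr p * m)) + ennreal (w powr (- p')) * ennreal (w powr p' * m))"
    by (intro mult_left_mono add_mono order_trans[OF C(2)[OF f]] fu gw) auto
  also have "\<dots> = ennreal (u * w * (C * (u powr (- p) * u powr p) * m + (w powr (- p') * w powr p') * m))"
    using u w C m by (simp add: ennreal_mult'[symmetric] ennreal_plus[symmetric] mult_ac del: ennreal_plus)
  also have "u powr (- p) * u powr p = 1" using u by (simp add: powr_add[symmetric])
  also have "w powr (- p') * w powr p' = 1" using w by (simp add: powr_add[symmetric])
  finally show ?thesis using u w C m by (subst (asm) ennreal_le_iff) (auto simp: algebra_simps)
qed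

lemma pairing_sum:
  assumes "finite I" "finite J" "\<And>i. i \<in> I \<Longrightarrow> f i \<in> test_functions" "\<And>j. j \<in> J \<Longrightarrow> g j \<in> test_functions"
  shows "pairing T (\<lambda>x. \<Sum>i\<in>I. f i x) (\<lambda>x. \<Sum>j\<in>J. g j x) = (\<Sum>i\<in>I. \<Sum>j\<in>J. pairing T (f i) (g j))"
proof -
  have int: "integrable lebesgue (\<lambda>x. T (f i) x * g j x)" if "i \<in> I" "j \<in> J" for i j
    using that assms by (intro pairing_integrable) auto
  have "AE x in lebesgue. T (\<lambda>x. \<Sum>i\<in>I. f i x) x = (\<Sum>i\<in>I. T (f i) x)"
    using assms by (intro ae_linear_sum lin)
  then have ae: "AE x in lebesgue. T (\<lambda>x. \<Sum>i\<in>I. f i x) x * (\<Sum>j\<in>J. g j x) = (\<Sum>i\<in>I. \<Sum>j\<in>J. T (f i) x * g j x)"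
    by eventually_elim (simp add: sum_product)
  have "pairing T (\<lambda>x. \<Sum>i\<in>I. f i x) (\<lambda>x. \<Sum>j\<in>J. g j x) = (\<integral>x. (\<Sum>i\<in>I. \<Sum>j\<in>J. T (f i) x * g j x) \<partial>lebesgue)"
    unfolding pairing_def
  proof (rule integral_cong_AE[OF _ _ ae])
    show "(\<lambda>x. T (\<lambda>x. \<Sum>i\<in>I. f i x) x * (\<Sum>j\<in>J. g j x)) \<in> borel_measurable lebesgue"
      using assms by (intro borel_measurable_times Tm test_sum test_lebesgue) auto
    show "(\<lambda>x. \<Sum>i\<in>I. \<Sum>j\<in>J. T (f i) x * g j x) \<in> borel_measurable lebesgue"
      using assms by (intro borel_measurable_sum borel_measurable_times Tm test_lebesgue) auto
  qed
  also have "\<dots> = (\<Sum>i\<in>I. \<Sum>j\<in>J. pairing T (f i) (g j))"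
    unfolding pairing_def using int by (simp add: Bochner_Integration.integral_sum)
  finally show ?thesis .
qed

lemma pairing_disjoint_supports:
  assumes f: "f \<in> test_functions" and g: "g \<in> test_functions" and disj: "supp f \<inter> supp g = {}"
  shows "pairing T f g = (\<integral>x. (\<integral>y. K (x - y) * f y * g x \<partial>lborel) \<partial>lborel)"
proof -
  have Kb[measurable]: "K \<in> borel_measurable borel" using T by (simp add: cz_operator_def)
  note [measurable] = test_borel[OF f] test_borel[OF g]
  have "AE x in lebesgue. x \<notin> supp f \<longrightarrow> T f x = (\<integral>y. K (x - y) * f y \<partial>lborel)"
    using T f unfolding cz_operator_def by blast
  then have ae: "AE x in lebesgue. T f x * g x = (\<integral>y. K (x - y) * f y * g x \<partial>lborel)"
  proof eventually_elim
    case (elim x)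
    then show ?case using disj supp_superset[of g x] by (cases "g x = 0") auto
  qed
  have m: "(\<lambda>x. \<integral>y. K (x - y) * f y * g x \<partial>lborel) \<in> borel_measurable lborel"
    by measurable
  have "pairing T f g = (\<integral>x. (\<integral>y. K (x - y) * f y * g x \<partial>lborel) \<partial>lebesgue)"
    unfolding pairing_def
    using Tm[OF f] test_lebesgue[OF g] measurable_completion[OF m]
    by (intro integral_cong_AE ae) measurable
  also have "\<dots> = (\<integral>x. (\<integral>y. K (x - y) * f y * g x \<partial>lborel) \<partial>lborel)"
    using m by (simp add: integral_completion)
  finally show ?thesis .
qed

lemma supp_reflect:
  fixes f :: "'a::euclidean_space \<Rightarrow> complex"
  shows "supp (\<lambda>x. f (- x)) = uminus ` supp f"
proof -
  have "{x. f (- x) \<noteq> 0} = uminus ` {x. f x \<noteq> 0}"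
    by (auto simp: image_iff) (metis minus_minus)
  moreover have "closure (uminus ` S) = uminus ` closure S" for S :: "'a set"
    using closure_scaleR[of "-1" S] by simp
  ultimately show ?thesis unfolding supp_def by simp
qed

text \<open>The substitution of -x, -y for x, y turns \<open>K (x - y)\<close> into
  \<open>K (y - x)\<close>, and exchanging the roles of the variables restores
  \<open>K (x - y)\<close>. The exchange is legitimate because the supports have a positive distance
  d and K is bounded at distances of at least d.\<close>

lemma pairing_reflect_disjoint:
  assumes f: "f \<in> test_functions" and g: "g \<in> test_functions" and disj: "supp f \<inter> supp g = {}"
  shows "pairing T (\<lambda>x. g (- x)) (\<lambda>x. f (- x)) = pairing T f g"
proof -
  have Kb[measurable]: "K \<in> borel_measurable borel" and size: "\<And>x. norm (K x) \<le> A / norm x ^ CARD('n)"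
    using T by (auto simp: cz_operator_def)
  note A = cz_operator_A[OF T]
  note fm[measurable] = test_borel[OF f] and gm[measurable] = test_borel[OF g]
  have disj': "supp (\<lambda>x. g (- x)) \<inter> supp (\<lambda>x. f (- x)) = {}"
    using disj unfolding supp_reflect by auto
  have "compact (supp f)" "closed (supp g)" using f by (auto simp: test_functions_iff supp_def)
  then obtain d where d: "0 < d" "\<And>x y. x \<in> supp f \<Longrightarrow> y \<in> supp g \<Longrightarrow> d \<le> dist x y"
    using separate_compact_closed[of "supp f" "supp g"] disj by blast
  have int: "integrable (lborel \<Otimes>\<^sub>M lborel) (\<lambda>(x, y). K (x - y) * f y * g x)"
  proof (rule integrableI_bounded)
    show "(\<lambda>(x, y). K (x - y) * f y * g x) \<in> borel_measurable (lborel \<Otimes>\<^sub>M lborel)" by measurable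
    have "(\<integral>\<^sup>+z. ennreal (norm (case z of (x, y) \<Rightarrow> K (x - y) * f y * g x)) \<partial>(lborel \<Otimes>\<^sub>M lborel))
      \<le> (\<integral>\<^sup>+z. (case z of (x, y) \<Rightarrow> ennreal (A / d ^ CARD('n)) * (ennreal (norm (g x)) * ennreal (norm (f y)))) \<partial>(lborel \<Otimes>\<^sub>M lborel))"
    proof (rule nn_integral_mono, clarify)
      fix x y :: "real^'n"
      show "ennreal (norm (K (x - y) * f y * g x)) \<le> ennreal (A / d ^ CARD('n)) * (ennreal (norm (g x)) * ennreal (norm (f y)))"
      proof (cases "f y = 0 \<or> g x = 0")
        case False
        then have "d \<le> dist y x" using d supp_superset[of f y] supp_superset[of g x] by blast
        then have "norm (K (x - y)) \<le> A / d ^ CARD('n)"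
          using kernel_le_outside[OF size A d(1), of "x - y"] by (simp add: dist_norm norm_minus_commute)
        then have "norm (K (x - y)) * (norm (g x) * norm (f y)) \<le> A / d ^ CARD('n) * (norm (g x) * norm (f y))"
          by (rule mult_right_mono) simp
        moreover have "0 \<le> A / d ^ CARD('n)" using A d by simp
        ultimately show ?thesis by (simp add: norm_mult ennreal_mult'[symmetric] mult_ac ennreal_leI)
      qed auto
    qed
    also have "\<dots> = (\<integral>\<^sup>+x. (\<integral>\<^sup>+y. ennreal (A / d ^ CARD('n)) * (ennreal (norm (g x)) * ennreal (norm (f y))) \<partial>lborel) \<partial>lborel)"
    proof (subst lborel.nn_integral_fst[symmetric])
      have "(\<lambda>z. ennreal (A / d ^ CARD('n)) * (ennreal (norm (g (fst z))) * ennreal (norm (f (snd z))))) \<in> borel_measurable (lborel \<Otimes>\<^sub>M lborel)"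
        by measurable
      then show "(\<lambda>(x, y). ennreal (A / d ^ CARD('n)) * (ennreal (norm (g x)) * ennreal (norm (f y)))) \<in> borel_measurable (lborel \<Otimes>\<^sub>M lborel)"
        by (simp add: case_prod_beta')
    qed simp
    also have "\<dots> = ennreal (A / d ^ CARD('n)) * ((\<integral>\<^sup>+x. ennreal (norm (g x)) \<partial>lborel) * (\<integral>\<^sup>+y. ennreal (norm (f y)) \<partial>lborel))"
      by (simp add: nn_integral_cmult nn_integral_multc)
    also have "\<dots> < \<infinity>"
    proof -
      have "integrable lborel f" "integrable lborel g" using test_integrable[OF f] test_integrable[OF g] by (simp_all add: integrable_completion)
      then show ?thesis by (simp add: integrable_iff_bounded ennreal_mult_less_top)
    qed
    finally show "(\<integral>\<^sup>+z. ennreal (norm (case z of (x, y) \<Rightarrow> K (x - y) * f y * g x)) \<partial>(lborel \<Otimes>\<^sub>M lborel)) < \<infinity>" .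
  qed
  have "pairing T (\<lambda>x. g (- x)) (\<lambda>x. f (- x)) = (\<integral>x. (\<integral>y. K (x - y) * g (- y) * f (- x) \<partial>lborel) \<partial>lborel)"
    by (rule pairing_disjoint_supports[OF test_reflect[OF g] test_reflect[OF f] disj'])
  also have "\<dots> = (\<integral>x. (\<integral>y. K (x - (- y)) * g (- (- y)) * f (- x) \<partial>lborel) \<partial>lborel)"
  proof (rule Bochner_Integration.integral_cong[OF refl])
    fix x
    show "(\<integral>y. K (x - y) * g (- y) * f (- x) \<partial>lborel) = (\<integral>y. K (x - (- y)) * g (- (- y)) * f (- x) \<partial>lborel)"
      by (rule lborel_integral_uminus[symmetric]) measurable
  qed
  also have "\<dots> = (\<integral>x. (\<integral>y. K (- x - (- y)) * g (- (- y)) * f (- (- x)) \<partial>lborel) \<partial>lborel)"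
    by (rule lborel_integral_uminus[symmetric]) measurable
  also have "\<dots> = (\<integral>x. (\<integral>y. K (y - x) * f x * g y \<partial>lborel) \<partial>lborel)"
    by (simp add: mult_ac)
  also have "\<dots> = (\<integral>x. (\<integral>y. K (x - y) * f y * g x \<partial>lborel) \<partial>lborel)"
    using lborel_pair.Fubini_integral[OF int] by simp
  also have "\<dots> = pairing T f g" by (rule pairing_disjoint_supports[OF f g disj, symmetric])
  finally show ?thesis .
qed

end

section \<open>Pieces on grid cells and the diagonal part of the form\<close>

lemma grid_neighbours_card:
  fixes c :: "'n::finite \<Rightarrow> int"
  assumes "0 < \<delta>"
  shows "finite {d. grid_cube \<delta> c \<inter> grid_cube \<delta> d \<noteq> {}}"
    "card {d. grid_cube \<delta> c \<inter> grid_cube \<delta> d \<noteq> {}} \<le> 5 ^ CARD('n)"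
proof -
  \<comment> \<open>A common point of two cubes forces their indices to differ by at most 2 in each
    coordinate, which leaves 5 values.\<close>
  let ?B = "PiE UNIV (\<lambda>i. {c i - 2..c i + 2})"
  have fin: "finite ?B" by (intro finite_PiE) auto
  have sub: "{d. grid_cube \<delta> c \<inter> grid_cube \<delta> d \<noteq> {}} \<subseteq> ?B"
  proof clarify
    fix d assume "grid_cube \<delta> c \<inter> grid_cube \<delta> d \<noteq> {}"
    then obtain x where x: "x \<in> grid_cube \<delta> c" "x \<in> grid_cube \<delta> d" by auto
    have "d i \<in> {c i - 2..c i + 2}" for i
    proof -
      have "\<bar>x $ i - \<delta> * of_int (c i)\<bar> \<le> \<delta>" "\<bar>x $ i - \<delta> * of_int (d i)\<bar> \<le> \<delta>"
        using x by (simp_all add: grid_cube_def)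
      then have "\<bar>\<delta> * of_int (d i) - \<delta> * of_int (c i)\<bar> \<le> \<delta> * 2" by linarith
      moreover have "\<bar>\<delta> * of_int (d i) - \<delta> * of_int (c i)\<bar> = \<delta> * \<bar>real_of_int (d i - c i)\<bar>"
        using assms by (simp add: abs_mult right_diff_distrib[symmetric])
      ultimately have "\<bar>real_of_int (d i - c i)\<bar> \<le> 2" using assms by simp
      then show ?thesis by auto
    qed
    then show "d \<in> ?B" by (simp add: PiE_UNIV_domain)
  qed
  show "finite {d. grid_cube \<delta> c \<inter> grid_cube \<delta> d \<noteq> {}}" using finite_subset[OF sub fin] .
  have "card {d. grid_cube \<delta> c \<inter> grid_cube \<delta> d \<noteq> {}} \<le> card ?B" by (rule card_mono[OF fin sub])
  also have "card ?B = 5 ^ CARD('n)" by (subst card_PiE) (auto simp: nat_add_distrib)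
  finally show "card {d. grid_cube \<delta> c \<inter> grid_cube \<delta> d \<noteq> {}} \<le> 5 ^ CARD('n)" .
qed

lemma test_grid_piece: "0 < \<delta> \<Longrightarrow> f \<in> test_functions \<Longrightarrow> (\<lambda>x. complex_of_real (grid_bump \<delta> c x) * f x) \<in> test_functions"
  by (intro test_mult smooth_grid_bump)

text \<open>A piece on one cell is measured by the same supremum for every exponent r. This is what
  allows p and p' to be exchanged in the estimate of the diagonal part.\<close>

lemma power_integral_grid_piece:
  fixes f :: "real^'n \<Rightarrow> complex"
  assumes "0 < \<delta>" "f \<in> test_functions" "1 \<le> r"
  shows "power_integral r (\<lambda>x. complex_of_real (grid_bump \<delta> c x) * f x) \<le> ennreal (grid_sup \<delta> f c powr r * (bump_mass TYPE('n) * \<delta> ^ CARD('n)))"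
proof -
  have "power_integral r (\<lambda>x. complex_of_real (grid_bump \<delta> c x) * f x)
    \<le> ennreal (bump_mass TYPE('n) * \<delta> ^ CARD('n) * (\<Sum>c\<in>{c}. grid_sup \<delta> f c powr r))"
  proof (rule power_integral_le_grid_sum[OF assms(1) _ _ assms(3)])
    fix x :: "real^'n"
    show "norm (complex_of_real (grid_bump \<delta> c x) * f x) \<le> (\<Sum>c\<in>{c}. grid_bump \<delta> c x * grid_sup \<delta> f c)"
      using norm_grid_bump_mult_le[OF assms(1,2)] by (simp add: norm_mult grid_bump_bounds)
  qed (use grid_sup_nonneg[OF assms(1,2)] in auto)
  then show ?thesis by (simp add: mult.commute)
qed

lemma supp_grid_piece: "0 < \<delta> \<Longrightarrow> supp (\<lambda>x. complex_of_real (grid_bump \<delta> c x) * f x) \<subseteq> grid_cube \<delta> c"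
  unfolding supp_def by (intro closure_minimal closed_grid_cube) (auto intro: ccontr simp: grid_bump_eq_0)

context dual_pair
begin

text \<open>Off the diagonal the form \<open>(f, g) \<mapsto> \<langle>T f, g\<rangle>\<close> only depends on \<open>K\<close>, and both \<open>T\<close> and its transpose
  conjugated by \<open>x \<mapsto> - x\<close> have kernel \<open>K\<close>. The difference of the two forms is supported on the diagonal,
  hence it is dominated by \<open>\<integral>\<bar>f\<bar>\<bar>g\<bar>\<close> as soon as it scales correctly on cubes.\<close>

lemma pairing_diff_le:
  obtains M where "0 \<le> M"
    "\<And>f g. f \<in> test_functions \<Longrightarrow> g \<in> test_functions \<Longrightarrow>
      ennreal (norm (pairing T f g - pairing T (\<lambda>x. g (- x)) (\<lambda>x. f (- x)))) \<le> ennreal M * (power_integral p' f + power_integral p g)"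
proof -
  let ?n = "CARD('n)"
  define \<kappa> where "\<kappa> = bump_mass TYPE('n)"
  have \<kappa>: "\<kappa> > 0" unfolding \<kappa>_def by (rule bump_mass_pos)
  define P where "P = max (2 powr p + 1) (2 powr p' + 1)"
  have P: "2 powr p + 1 \<le> P" "2 powr p' + 1 \<le> P" "0 \<le> P" unfolding P_def by (auto intro: le_max_iff_disj[THEN iffD2])
  define M where "M = 2 * (C + 1) * 5 ^ ?n * P"
  have main: "ennreal (norm (pairing T f g - pairing T (\<lambda>x. g (- x)) (\<lambda>x. f (- x)))) \<le> ennreal M * (power_integral p' f + power_integral p g)"
    if f: "f \<in> test_functions" and g: "g \<in> test_functions" for f g
  proof -
    obtain \<eta>1 where \<eta>1: "0 < \<eta>1" "\<And>\<delta> S. 0 < \<delta> \<Longrightarrow> \<delta> < \<eta>1 \<Longrightarrow> finite S \<Longrightarrow>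
      ennreal (\<kappa> * \<delta> ^ ?n * (\<Sum>c\<in>S. grid_sup \<delta> f c powr p')) \<le> ennreal (2 powr p' + 1) * power_integral p' f"
      by (rule grid_sampling[OF f, folded \<kappa>_def, of p']) (use pp in simp, rule that)
    obtain \<eta>2 where \<eta>2: "0 < \<eta>2" "\<And>\<delta> S. 0 < \<delta> \<Longrightarrow> \<delta> < \<eta>2 \<Longrightarrow> finite S \<Longrightarrow>
      ennreal (\<kappa> * \<delta> ^ ?n * (\<Sum>c\<in>S. grid_sup \<delta> g c powr p)) \<le> ennreal (2 powr p + 1) * power_integral p g"
      by (rule grid_sampling[OF g, folded \<kappa>_def, of p]) (use pp in simp, rule that)
    \<comment> \<open>One mesh fine enough for f with exponent p' and for g with exponent p. These
      are the exponents of the conclusion, opposite to those in which the form is known to be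
      bounded.\<close>
    define \<delta> where "\<delta> = min \<eta>1 \<eta>2 / 2"
    have \<delta>: "0 < \<delta>" "\<delta> < \<eta>1" "\<delta> < \<eta>2" using \<eta>1(1) \<eta>2(1) by (auto simp: \<delta>_def)
    obtain N1 where N1: "\<And>x M. f x \<noteq> 0 \<Longrightarrow> N1 \<le> M \<Longrightarrow> (\<Sum>c\<in>grid_box M. grid_bump \<delta> c x) = 1"
      using test_partition[OF f \<delta>(1)] by blast
    obtain N2 where N2: "\<And>x M. g x \<noteq> 0 \<Longrightarrow> N2 \<le> M \<Longrightarrow> (\<Sum>c\<in>grid_box M. grid_bump \<delta> c x) = 1"
      using test_partition[OF g \<delta>(1)] by blast
    define X where "X = (grid_box (max N1 N2) :: ('n \<Rightarrow> int) set)"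
    have X: "finite X" by (simp add: X_def finite_grid_box)
    define F where "F c x = complex_of_real (grid_bump \<delta> c x) * f x" for c x
    define G where "G c x = complex_of_real (grid_bump \<delta> c x) * g x" for c x
    have F: "F c \<in> test_functions" and G: "G c \<in> test_functions" for c
      unfolding F_def G_def using test_grid_piece \<delta>(1) f g by blast+
    have f_eq: "f = (\<lambda>x. \<Sum>c\<in>X. F c x)"
    proof
      fix x show "f x = (\<Sum>c\<in>X. F c x)"
        using N1[of x "max N1 N2"]
        by (cases "f x = 0") (simp_all add: F_def X_def sum_distrib_right[symmetric] of_real_sum[symmetric] del: of_real_sum)
    qed
    have g_eq: "g = (\<lambda>x. \<Sum>c\<in>X. G c x)"
    proof
      fix x show "g x = (\<Sum>c\<in>X. G c x)"
        using N2[of x "max N1 N2"]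
        by (cases "g x = 0") (simp_all add: G_def X_def sum_distrib_right[symmetric] of_real_sum[symmetric] del: of_real_sum)
    qed
    define E where "E c d = pairing T (F c) (G d) - pairing T (\<lambda>x. G d (- x)) (\<lambda>x. F c (- x))" for c d
    define m where "m = \<kappa> * \<delta> ^ ?n"
    have m: "0 < m" using \<kappa> \<delta> by (simp add: m_def)
    define u where "u = grid_sup \<delta> f"
    define w where "w = grid_sup \<delta> g"
    have u0: "0 \<le> u c" and w0: "0 \<le> w c" for c
      unfolding u_def w_def using grid_sup_nonneg[OF \<delta>(1)] f g by auto
    have "pairing T f g = (\<Sum>c\<in>X. \<Sum>d\<in>X. pairing T (F c) (G d))"
      by (subst f_eq, subst g_eq) (intro pairing_sum X F G)
    moreover have "pairing T (\<lambda>x. g (- x)) (\<lambda>x. f (- x)) = (\<Sum>d\<in>X. \<Sum>c\<in>X. pairing T (\<lambda>x. G d (- x)) (\<lambda>x. F c (- x)))"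
      by (subst f_eq, subst g_eq) (intro pairing_sum X test_reflect F G)
    ultimately have E_eq: "pairing T f g - pairing T (\<lambda>x. g (- x)) (\<lambda>x. f (- x)) = (\<Sum>c\<in>X. \<Sum>d\<in>X. E c d)"
      unfolding E_def sum_subtractf by (simp add: sum.swap[of "\<lambda>d c. pairing T (\<lambda>x. G d (- x)) (\<lambda>x. F c (- x))"])
    have IF: "power_integral r (F c) \<le> ennreal (u c powr r * m)" and IG: "power_integral r (G c) \<le> ennreal (w c powr r * m)" if "1 \<le> r" for r c
      unfolding F_def G_def u_def w_def m_def \<kappa>_def using power_integral_grid_piece[OF \<delta>(1) _ that] f g by blast+
    have IRF: "power_integral r (\<lambda>x. F c (- x)) \<le> ennreal (u c powr r * m)" and IRG: "power_integral r (\<lambda>x. G c (- x)) \<le> ennreal (w c powr r * m)" if "1 \<le> r" for r c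
      using IF[OF that] IG[OF that] power_integral_reflect[OF test_borel[OF F]] power_integral_reflect[OF test_borel[OF G]] by simp_all
    have p1: "1 \<le> p" "1 \<le> p'" using pp by auto
    let ?meet = "\<lambda>c d. grid_cube \<delta> c \<inter> grid_cube \<delta> d \<noteq> {}"
    \<comment> \<open>Pairs of cells that do not meet contribute nothing. On the others, boundedness
      with exponent p gives a multiple of u w m, and Young's inequality with the exponents exchanged
      splits the product into u powr p' and w powr p.\<close>
    have E_le: "norm (E c d) \<le> (if ?meet c d then 2 * (C + 1) * m * (u c powr p' + w d powr p) else 0)" for c d
    proof (cases "?meet c d")
      case False
      have "supp (F c) \<inter> supp (G d) = {}"
        using False supp_grid_piece[OF \<delta>(1), of c f] supp_grid_piece[OF \<delta>(1), of d g] unfolding F_def G_def by blast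
      from pairing_reflect_disjoint[OF F G this] show ?thesis using False by (simp add: E_def)
    next
      case True
      have "norm (pairing T (F c) (G d)) \<le> u c * w d * ((C + 1) * m)"
        by (intro norm_pairing_scaled F G u0 w0 less_imp_le[OF m] IF IG p1)
      moreover have "norm (pairing T (\<lambda>x. G d (- x)) (\<lambda>x. F c (- x))) \<le> w d * u c * ((C + 1) * m)"
        by (intro norm_pairing_scaled test_reflect F G u0 w0 less_imp_le[OF m] IRF IRG p1)
      ultimately have "norm (E c d) \<le> u c * w d * ((C + 1) * m) + w d * u c * ((C + 1) * m)"
        unfolding E_def by (meson add_mono norm_triangle_ineq4 order_trans)
      also have "\<dots> = 2 * (C + 1) * m * (u c * w d)" by (simp add: algebra_simps)
      also have "\<dots> \<le> 2 * (C + 1) * m * (u c powr p' + w d powr p)"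
        using C m pp u0 w0 by (intro mult_left_mono young_powr) (auto simp: add.commute)
      finally show ?thesis using True by simp
    qed
    have "norm (\<Sum>c\<in>X. \<Sum>d\<in>X. E c d) \<le> (\<Sum>c\<in>X. \<Sum>d\<in>X. if ?meet c d then 2 * (C + 1) * m * (u c powr p' + w d powr p) else 0)"
      by (intro order_trans[OF norm_sum] sum_mono order_trans[OF norm_sum] E_le)
    also have "\<dots> = 2 * (C + 1) * m * (\<Sum>c\<in>X. \<Sum>d\<in>X. (if ?meet c d then u c powr p' else 0) + (if ?meet c d then w d powr p else 0))"
      by (simp add: sum_distrib_left if_distrib cong: if_cong)
    also have "(\<Sum>c\<in>X. \<Sum>d\<in>X. (if ?meet c d then u c powr p' else 0) + (if ?meet c d then w d powr p else 0))
      = (\<Sum>c\<in>X. \<Sum>d\<in>X. if ?meet c d then u c powr p' else 0) + (\<Sum>d\<in>X. \<Sum>c\<in>X. if ?meet d c then w d powr p else 0)"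
      by (simp add: sum.distrib sum.swap[of "\<lambda>c d. if ?meet c d then w d powr p else 0"] Int_commute)
    \<comment> \<open>Each power depends on one index only and occurs once for every neighbour of
      that cell.\<close>
    also have "\<dots> \<le> (\<Sum>c\<in>X. 5 ^ ?n * u c powr p') + (\<Sum>d\<in>X. 5 ^ ?n * w d powr p)"
    proof -
      have *: "(\<Sum>d\<in>X. if ?meet c d then a else 0) \<le> 5 ^ ?n * a" if "0 \<le> a" for a :: real and c
      proof -
        have "(\<Sum>d\<in>X. if ?meet c d then a else 0) = real (card {d\<in>X. ?meet c d}) * a"
          using X by (simp add: sum.inter_filter[symmetric])
        also have "\<dots> \<le> 5 ^ ?n * a"
        proof (rule mult_right_mono[OF _ that])
          have "card {d\<in>X. ?meet c d} \<le> card {d. ?meet c d}"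
            using grid_neighbours_card(1)[OF \<delta>(1), of c] by (intro card_mono) auto
          also have "\<dots> \<le> 5 ^ ?n" by (rule grid_neighbours_card(2)[OF \<delta>(1)])
          finally have "real (card {d\<in>X. ?meet c d}) \<le> real (5 ^ ?n)" by (rule of_nat_mono)
          then show "real (card {d\<in>X. ?meet c d}) \<le> 5 ^ ?n" by (simp only: of_nat_power of_nat_numeral)
        qed
        finally show ?thesis .
      qed
      show ?thesis by (intro add_mono sum_mono *) auto
    qed
    also have "\<dots> = 5 ^ ?n * ((\<Sum>c\<in>X. u c powr p') + (\<Sum>d\<in>X. w d powr p))"
      by (simp add: sum_distrib_left distrib_left)
    finally have "norm (\<Sum>c\<in>X. \<Sum>d\<in>X. E c d) \<le> 2 * (C + 1) * m * (5 ^ ?n * ((\<Sum>c\<in>X. u c powr p') + (\<Sum>d\<in>X. w d powr p)))"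
      using C m by (simp add: mult_left_mono)
    also have "\<dots> = 2 * (C + 1) * 5 ^ ?n * (m * (\<Sum>c\<in>X. u c powr p') + m * (\<Sum>d\<in>X. w d powr p))"
      by (simp add: algebra_simps)
    finally have "ennreal (norm (\<Sum>c\<in>X. \<Sum>d\<in>X. E c d))
      \<le> ennreal (2 * (C + 1) * 5 ^ ?n * (m * (\<Sum>c\<in>X. u c powr p') + m * (\<Sum>d\<in>X. w d powr p)))" by (rule ennreal_leI)
    also have "\<dots> = ennreal (2 * (C + 1) * 5 ^ ?n) * (ennreal (m * (\<Sum>c\<in>X. u c powr p')) + ennreal (m * (\<Sum>d\<in>X. w d powr p)))"
      using C m by (simp add: ennreal_mult'[symmetric] ennreal_plus[symmetric] sum_nonneg del: ennreal_plus)
    also have "\<dots> \<le> ennreal (2 * (C + 1) * 5 ^ ?n) * (ennreal P * power_integral p' f + ennreal P * power_integral p g)"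
    proof (intro mult_left_mono add_mono)
      have "ennreal (m * (\<Sum>c\<in>X. u c powr p')) \<le> ennreal (2 powr p' + 1) * power_integral p' f"
        unfolding m_def u_def by (intro \<eta>1 \<delta> X)
      also have "\<dots> \<le> ennreal P * power_integral p' f" using P by (intro mult_right_mono ennreal_leI) auto
      finally show "ennreal (m * (\<Sum>c\<in>X. u c powr p')) \<le> ennreal P * power_integral p' f" .
      have "ennreal (m * (\<Sum>c\<in>X. w c powr p)) \<le> ennreal (2 powr p + 1) * power_integral p g"
        unfolding m_def w_def by (intro \<eta>2 \<delta> X)
      also have "\<dots> \<le> ennreal P * power_integral p g" using P by (intro mult_right_mono ennreal_leI) auto
      finally show "ennreal (m * (\<Sum>c\<in>X. w c powr p)) \<le> ennreal P * power_integral p g" .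
    qed auto
    also have "\<dots> = ennreal (2 * (C + 1) * 5 ^ ?n) * ennreal P * (power_integral p' f + power_integral p g)"
      by (simp only: distrib_left mult.assoc)
    also have "ennreal (2 * (C + 1) * 5 ^ ?n) * ennreal P = ennreal M"
      unfolding M_def using C P by (intro ennreal_mult[symmetric]) auto
    finally show ?thesis unfolding E_eq .
  qed
  show ?thesis by (rule that[of M, OF _ main]) (use C P in \<open>simp add: M_def\<close>)
qed

text \<open>In the reflected form the operator acts on the reflection of g, so boundedness with
  exponent p already gives the desired right-hand side. The difference of the two forms is the
  diagonal part.\<close>

lemma pairing_dual_le:
  obtains M where "0 < M"
    "\<And>f g. f \<in> test_functions \<Longrightarrow> g \<in> test_functions \<Longrightarrow>
      ennreal (norm (pairing T f g)) \<le> ennreal M * (power_integral p' f + power_integral p g)"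
proof -
  obtain M where M: "0 \<le> M" "\<And>f g. f \<in> test_functions \<Longrightarrow> g \<in> test_functions \<Longrightarrow>
      ennreal (norm (pairing T f g - pairing T (\<lambda>x. g (- x)) (\<lambda>x. f (- x)))) \<le> ennreal M * (power_integral p' f + power_integral p g)"
    using pairing_diff_le by blast
  have "ennreal (norm (pairing T f g)) \<le> ennreal (M + (C + 1)) * (power_integral p' f + power_integral p g)"
    if f: "f \<in> test_functions" and g: "g \<in> test_functions" for f g
  proof -
    let ?E = "pairing T f g - pairing T (\<lambda>x. g (- x)) (\<lambda>x. f (- x))"
    have "norm (pairing T f g) \<le> norm ?E + norm (pairing T (\<lambda>x. g (- x)) (\<lambda>x. f (- x)))"
      using norm_triangle_ineq[of ?E "pairing T (\<lambda>x. g (- x)) (\<lambda>x. f (- x))"] by simp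
    then have "ennreal (norm (pairing T f g)) \<le> ennreal (norm ?E) + ennreal (norm (pairing T (\<lambda>x. g (- x)) (\<lambda>x. f (- x))))"
      by (simp add: ennreal_plus[symmetric] ennreal_leI del: ennreal_plus)
    also have "\<dots> \<le> ennreal M * (power_integral p' f + power_integral p g) + ennreal (C + 1) * (power_integral p' f + power_integral p g)"
    proof (rule add_mono[OF M(2)[OF f g]])
      have "ennreal (norm (pairing T (\<lambda>x. g (- x)) (\<lambda>x. f (- x)))) \<le> ennreal C * power_integral p g + power_integral p' f"
        using norm_pairing_le[OF test_reflect[OF g] test_reflect[OF f]] power_integral_reflect[OF test_borel[OF f]] power_integral_reflect[OF test_borel[OF g]]
        by simp
      also have "\<dots> \<le> ennreal (C + 1) * power_integral p g + ennreal (C + 1) * power_integral p' f"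
        using C mult_right_mono[of 1 "ennreal (C + 1)" "power_integral p' f"]
        by (intro add_mono mult_right_mono) (auto simp: ennreal_leI)
      finally show "ennreal (norm (pairing T (\<lambda>x. g (- x)) (\<lambda>x. f (- x)))) \<le> ennreal (C + 1) * (power_integral p' f + power_integral p g)"
        by (simp add: distrib_left add.commute)
    qed
    also have "\<dots> = ennreal (M + (C + 1)) * (power_integral p' f + power_integral p g)"
      using M C by (subst ennreal_plus) (auto simp: distrib_right)
    finally show ?thesis .
  qed
  then show ?thesis using that[of "M + (C + 1)"] M C by (simp add: add_nonneg_pos)
qed

end

section \<open>Converse Hoelder inequality by testing against smooth functions\<close>

lemma test_approximation:
  fixes g :: "real^'n \<Rightarrow> complex"
  assumes gm: "g \<in> borel_measurable lebesgue" and M: "0 < M" "\<And>x. norm (g x) \<le> M"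
    and \<rho>: "0 < \<rho>" "\<And>x. \<rho> < norm x \<Longrightarrow> g x = 0"
  obtains G :: "nat \<Rightarrow> real^'n \<Rightarrow> complex" and \<rho>' where "\<And>k. G k \<in> test_functions" "\<And>k x. norm (G k x) \<le> M"
    "\<And>k x. \<rho>' < norm x \<Longrightarrow> G k x = 0" "AE x in lebesgue. (\<lambda>k. G k x) \<longlonglongrightarrow> g x"
proof -
  have "g measurable_on UNIV" using gm by (intro lebesgue_measurable_imp_measurable_on) auto
  then obtain N g' where N: "negligible N" and g'c: "\<And>k::nat. continuous_on UNIV (g' k)"
    and g'l: "\<And>x. x \<notin> N \<Longrightarrow> (\<lambda>k. g' k x) \<longlonglongrightarrow> g x"
    unfolding measurable_on_def by auto
  \<comment> \<open>The nearest point projection onto the ball is continuous, imposes the bound M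
    and fixes the values of g, so the limit is unchanged.\<close>
  let ?cl = "closest_point (cball (0::complex) M)"
  have ne: "cball (0::complex) M \<noteq> {}" using M(1) by simp
  define h where "h k x = ?cl (g' k x)" for k x
  have hc: "continuous_on UNIV (h k)" for k
    unfolding h_def using continuous_on_compose2[OF continuous_on_closest_point[OF convex_cball closed_cball ne, of UNIV] g'c[of k]] by simp
  have hM: "norm (h k x) \<le> M" for k x
    using closest_point_in_set[OF closed_cball ne, of "g' k x"] by (simp add: h_def)
  have hl: "(\<lambda>k. h k x) \<longlonglongrightarrow> g x" if "x \<notin> N" for x
  proof -
    have "(\<lambda>k. ?cl (g' k x)) \<longlonglongrightarrow> ?cl (g x)"
      by (rule isCont_tendsto_compose[OF continuous_at_closest_point[OF convex_cball closed_cball ne] g'l[OF that]])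
    moreover have "?cl (g x) = g x" using M(2) by (intro closest_point_self) simp
    ultimately show ?thesis by (simp add: h_def)
  qed
  define N0 where "N0 = nat \<lceil>\<rho>\<rceil>"
  \<comment> \<open>A smooth cut-off equal to 1 wherever g may be nonzero; it gives all approximants
    a common bounded support.\<close>
  define cut where "cut x = (\<Sum>c\<in>grid_box N0. grid_bump 1 c x)" for x :: "real^'n"
  have cut_test: "(\<lambda>x. complex_of_real (cut x)) \<in> test_functions"
    unfolding cut_def of_real_sum by (intro test_sum test_grid_bump) simp
  have cut01: "0 \<le> cut x" "cut x \<le> 1" for x
    unfolding cut_def by (auto intro!: sum_nonneg grid_bump_bounds sum_grid_bump_le_1 finite_grid_box)
  have cut1: "cut x = 1" if "norm x \<le> \<rho>" for x
    unfolding cut_def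
  proof (rule sum_grid_bump_eq_1)
    fix i
    have "\<rho> \<le> real N0" unfolding N0_def by linarith
    then show "\<bar>x $ i\<bar> \<le> real N0 * 1" using that component_le_norm_cart[of x i] by simp
  qed simp
  obtain \<rho>' where \<rho>': "0 < \<rho>'" "\<And>x. \<rho>' < norm x \<Longrightarrow> complex_of_real (cut x) = 0"
    using test_vanish[OF cut_test] by blast
  \<comment> \<open>Smoothing without convolution: the values of \<open>h k\<close> at the nodes are
    spread by the bumps. Weights of total at most 1 preserve the bound M, and uniform continuity
    controls the error.\<close>
  have ex: "\<exists>s. s \<in> test_functions \<and> (\<forall>x. norm (s x) \<le> M) \<and> (\<forall>x. norm x \<le> \<rho>' \<longrightarrow> norm (s x - h k x) \<le> 1 / (real k + 1))" for k
  proof -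
    define \<epsilon> where "\<epsilon> = 1 / (real k + 1)"
    have \<epsilon>: "0 < \<epsilon>" by (simp add: \<epsilon>_def)
    have "uniformly_continuous_on (cball 0 (\<rho>' + 1)) (h k)"
      by (intro compact_uniformly_continuous continuous_on_subset[OF hc]) auto
    then obtain d where d: "0 < d" "\<And>x y. x \<in> cball 0 (\<rho>' + 1) \<Longrightarrow> y \<in> cball 0 (\<rho>' + 1) \<Longrightarrow> dist y x < d \<Longrightarrow> dist (h k y) (h k x) < \<epsilon>"
      unfolding uniformly_continuous_on_def using \<epsilon> by metis
    \<comment> \<open>The diameter bound \<open>2 * \<delta> * CARD('n)\<close> of a cell becomes
      half of \<open>min 1 d\<close>. The 1 keeps the relevant nodes within the ball of radius
      \<open>\<rho>' + 1\<close>, where the modulus of continuity is valid.\<close>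
    define \<delta> where "\<delta> = min 1 d / (4 * CARD('n))"
    have n: "0 < real CARD('n)" by simp
    have \<delta>: "0 < \<delta>" using d n by (simp add: \<delta>_def)
    have \<delta>n: "2 * \<delta> * CARD('n) = min 1 d / 2" by (simp add: \<delta>_def)
    define p where "p c = (\<chi> i. \<delta> * of_int (c i))" for c :: "'n \<Rightarrow> int"
    define L where "L = nat \<lceil>\<rho>' / \<delta>\<rceil>"
    define s where "s x = (\<Sum>c\<in>grid_box L. complex_of_real (grid_bump \<delta> c x) * h k (p c))" for x
    have "s \<in> test_functions"
      unfolding s_def by (intro test_sum) (use test_cmult[OF test_grid_bump[OF \<delta>]] in \<open>simp add: mult.commute\<close>)
    moreover have "norm (s x) \<le> M" for x
    proof -
      have "norm (s x) \<le> (\<Sum>c\<in>grid_box L. grid_bump \<delta> c x * M)"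
        unfolding s_def
      proof (intro order_trans[OF norm_sum] sum_mono)
        fix c show "norm (complex_of_real (grid_bump \<delta> c x) * h k (p c)) \<le> grid_bump \<delta> c x * M"
          unfolding norm_mult norm_of_real using hM[of k "p c"] grid_bump_bounds[of \<delta> c x] by (simp add: mult_left_mono)
      qed
      also have "\<dots> = (\<Sum>c\<in>grid_box L. grid_bump \<delta> c x) * M" by (simp add: sum_distrib_right)
      also have "\<dots> \<le> 1 * M" using M(1) by (intro mult_right_mono sum_grid_bump_le_1 finite_grid_box) auto
      finally show ?thesis by simp
    qed
    moreover have "norm (s x - h k x) \<le> \<epsilon>" if x: "norm x \<le> \<rho>'" for x
    proof -
      have one: "(\<Sum>c\<in>grid_box L. grid_bump \<delta> c x) = 1"
      proof (rule sum_grid_bump_eq_1[OF \<delta>])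
        fix i
        have "\<bar>x $ i\<bar> \<le> norm x" by (rule component_le_norm_cart)
        also have "\<dots> \<le> \<rho>' / \<delta> * \<delta>" using x \<delta> by simp
        also have "\<rho>' / \<delta> \<le> real L" unfolding L_def by linarith
        finally show "\<bar>x $ i\<bar> \<le> real L * \<delta>" using \<delta> by simp
      qed
      have "h k x = (\<Sum>c\<in>grid_box L. complex_of_real (grid_bump \<delta> c x)) * h k x"
        using one by (simp add: of_real_sum[symmetric] del: of_real_sum)
      then have "s x - h k x = (\<Sum>c\<in>grid_box L. complex_of_real (grid_bump \<delta> c x) * (h k (p c) - h k x))"
        by (simp add: s_def sum_distrib_right right_diff_distrib sum_subtractf)
      also have "norm \<dots> \<le> (\<Sum>c\<in>grid_box L. grid_bump \<delta> c x * \<epsilon>)"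
      proof (intro order_trans[OF norm_sum] sum_mono)
        fix c
        show "norm (complex_of_real (grid_bump \<delta> c x) * (h k (p c) - h k x)) \<le> grid_bump \<delta> c x * \<epsilon>"
        proof (cases "x \<in> grid_cube \<delta> c")
          case True
          have "dist (p c) x \<le> min 1 d / 2"
            unfolding \<delta>n[symmetric] by (rule dist_grid_cube[OF _ True]) (simp add: p_def grid_cube_nonempty \<delta>)
          then have *: "dist (p c) x < d" "dist (p c) x \<le> 1" using d(1) by (auto simp: min_def split: if_splits)
          have "norm (p c) \<le> norm x + dist (p c) x" by (simp add: dist_norm norm_triangle_sub)
          then have "norm (p c) \<le> \<rho>' + 1" using x * by simp
          then have "dist (h k (p c)) (h k x) < \<epsilon>" using x * by (intro d(2)) auto
          then show ?thesis unfolding norm_mult norm_of_real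
            using grid_bump_bounds[of \<delta> c x] by (simp add: dist_norm mult_left_mono)
        qed (simp add: grid_bump_eq_0 \<delta>)
      qed
      also have "\<dots> = \<epsilon>" using one by (simp add: sum_distrib_right[symmetric])
      finally show ?thesis .
    qed
    ultimately show ?thesis unfolding \<epsilon>_def by blast
  qed
  define s where "s k = (SOME s. s \<in> test_functions \<and> (\<forall>x. norm (s x) \<le> M) \<and> (\<forall>x. norm x \<le> \<rho>' \<longrightarrow> norm (s x - h k x) \<le> 1 / (real k + 1)))" for k
  have s: "s k \<in> test_functions" "norm (s k x) \<le> M" "norm x \<le> \<rho>' \<Longrightarrow> norm (s k x - h k x) \<le> 1 / (real k + 1)" for k x
    using someI_ex[OF ex[of k], folded s_def] by blast+
  define G where "G k x = complex_of_real (cut x) * s k x" for k x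
  show ?thesis
  proof (rule that[of G \<rho>'])
    show "G k \<in> test_functions" for k unfolding G_def by (intro test_mult test_smooth[OF cut_test] s)
    show "norm (G k x) \<le> M" for k x
      unfolding G_def norm_mult norm_of_real using mult_mono[OF cut01(2)[of x] s(2)[of k x]] cut01(1)[of x] by simp
    show "G k x = 0" if "\<rho>' < norm x" for k x using \<rho>'(2)[OF that] by (simp add: G_def)
    have "N \<in> null_sets lebesgue" using N by (simp add: negligible_iff_null_sets)
    then have "AE x in lebesgue. x \<notin> N" by (rule AE_not_in)
    then show "AE x in lebesgue. (\<lambda>k. G k x) \<longlonglongrightarrow> g x"
    proof eventually_elim
      case (elim x)
      show ?case
      proof (cases "norm x \<le> \<rho>'")
        case False
        then have "cut x = 0" using \<rho>'(2)[of x] by simp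
        then have "g x = 0" using cut1[of x] \<rho>(2)[of x] by fastforce
        then show ?thesis using \<open>cut x = 0\<close> by (simp add: G_def)
      next
        case True
        have "(\<lambda>k. 1 / (real k + 1)) \<longlonglongrightarrow> 0"
          using LIMSEQ_inverse_real_of_nat by (simp add: inverse_eq_divide add.commute)
        then have "(\<lambda>k. s k x - h k x) \<longlonglongrightarrow> 0"
          by (rule Lim_null_comparison[rotated]) (use s(3)[OF True] in simp)
        from tendsto_add[OF this hl[OF elim]] have "(\<lambda>k. s k x) \<longlonglongrightarrow> g x" by simp
        then have "(\<lambda>k. G k x) \<longlonglongrightarrow> complex_of_real (cut x) * g x"
          unfolding G_def by (intro tendsto_mult tendsto_const)
        moreover have "complex_of_real (cut x) * g x = g x" using cut1[of x] \<rho>(2)[of x] by (cases "norm x \<le> \<rho>") auto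
        ultimately show ?thesis by simp
      qed
    qed
  qed
qed

text \<open>The extremal function in the duality argument is not smooth, so the bound must pass to
  limits of test functions. Convergence is dominated: bound and support are common, and h is
  integrable on balls by Young's inequality against an indicator.\<close>

lemma pairing_bound_extend:
  fixes h g :: "real^'n \<Rightarrow> complex"
  assumes h: "h \<in> borel_measurable lebesgue" "power_integral p h < \<infinity>" and pp: "1 < p" "1 < p'" "1 / p + 1 / p' = 1"
    and bound: "\<And>g. g \<in> test_functions \<Longrightarrow> ennreal (norm (\<integral>x. h x * g x \<partial>lebesgue)) \<le> ennreal M * (F + power_integral r g)" and r: "0 < r"
    and g: "g \<in> borel_measurable lebesgue" "0 < B" "\<And>x. norm (g x) \<le> B" "0 < \<rho>" "\<And>x. \<rho> < norm x \<Longrightarrow> g x = 0"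
  shows "ennreal (norm (\<integral>x. h x * g x \<partial>lebesgue)) \<le> ennreal M * (F + power_integral r g)"
proof -
  obtain G \<rho>' where G: "\<And>k. G k \<in> test_functions" "\<And>k x. norm (G k x) \<le> B"
    "\<And>k x. \<rho>' < norm x \<Longrightarrow> G k x = 0" and Gl: "AE x in lebesgue. (\<lambda>k. G k x) \<longlonglongrightarrow> g x"
    using test_approximation[OF g] by blast
  note Gm = test_lebesgue[OF G(1)]
  let ?I = "\<lambda>x::real^'n. of_real (indicator (cball 0 \<rho>') x) :: complex"
  have Im: "?I \<in> borel_measurable lebesgue"
    by (intro lebesgue_measurable_borel measurable_compose[OF borel_measurable_indicator borel_measurable_of_real]) simp
  have Ifin: "(\<integral>\<^sup>+x. indicator (cball 0 \<rho>') x \<partial>(lebesgue :: (real^'n) measure)) < \<infinity>"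
    using emeasure_bounded_finite[OF bounded_cball, of 0 \<rho>'] by simp
  have l1: "(\<lambda>k. \<integral>x. h x * G k x \<partial>lebesgue) \<longlonglongrightarrow> (\<integral>x. h x * g x \<partial>lebesgue)"
  proof (rule integral_dominated_convergence[where w="\<lambda>x. B * norm (h x * ?I x)"])
    show "(\<lambda>x. h x * g x) \<in> borel_measurable lebesgue" by (intro borel_measurable_times h g)
    show "(\<lambda>x. h x * G k x) \<in> borel_measurable lebesgue" for k by (intro borel_measurable_times h Gm)
    have "power_integral p' ?I < \<infinity>"
    proof -
      have "power_integral p' ?I = (\<integral>\<^sup>+x. indicator (cball 0 \<rho>') x \<partial>(lebesgue :: (real^'n) measure))"
        unfolding power_integral_def by (intro nn_integral_cong) (auto simp: indicator_def)
      then show ?thesis using Ifin by simp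
    qed
    then have "(\<integral>\<^sup>+x. ennreal (norm (h x * ?I x)) \<partial>lebesgue) < \<infinity>"
      using order_le_less_trans[OF nn_integral_mult_young[OF h(1) Im pp]] h(2) by simp
    then have "integrable lebesgue (\<lambda>x. h x * ?I x)"
      by (intro integrableI_bounded borel_measurable_times h Im)
    then show "integrable lebesgue (\<lambda>x. B * norm (h x * ?I x))" by (intro integrable_mult_right integrable_norm) auto
    show "AE x in lebesgue. (\<lambda>k. h x * G k x) \<longlonglongrightarrow> h x * g x"
      using Gl by eventually_elim (intro tendsto_mult tendsto_const)
    show "AE x in lebesgue. norm (h x * G k x) \<le> B * norm (h x * ?I x)" for k
    proof (rule AE_I2)
      fix x
      show "norm (h x * G k x) \<le> B * norm (h x * ?I x)"
        using G(2)[of k x] G(3)[of x k] g(2)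
        by (cases "norm x \<le> \<rho>'") (auto simp: norm_mult mult.commute[of B] mult_left_mono)
    qed
  qed
  have l2: "(\<lambda>k. power_integral r (G k)) \<longlonglongrightarrow> power_integral r g"
    unfolding power_integral_def
  proof (rule nn_integral_dominated_convergence[where w="\<lambda>x. ennreal (B powr r) * indicator (cball 0 \<rho>') x"])
    show "(\<lambda>x. ennreal (norm (G k x) powr r)) \<in> borel_measurable lebesgue" for k by (rule norm_powr_measurable[OF Gm])
    show "(\<lambda>x. ennreal (norm (g x) powr r)) \<in> borel_measurable lebesgue" by (rule norm_powr_measurable[OF g(1)])
    show "(\<lambda>x. ennreal (B powr r) * indicator (cball 0 \<rho>') x) \<in> borel_measurable lebesgue"
      by (intro lebesgue_measurable_borel borel_measurable_times_ennreal borel_measurable_const borel_measurable_indicator) simp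
    show "(\<integral>\<^sup>+x. ennreal (B powr r) * indicator (cball 0 \<rho>') x \<partial>(lebesgue :: (real^'n) measure)) < \<infinity>"
      using Ifin by (subst nn_integral_cmult_indicator) (auto simp: ennreal_mult_less_top)
    show "AE x in lebesgue. ennreal (norm (G k x) powr r) \<le> ennreal (B powr r) * indicator (cball 0 \<rho>') x" for k
    proof (rule AE_I2)
      fix x
      show "ennreal (norm (G k x) powr r) \<le> ennreal (B powr r) * indicator (cball 0 \<rho>') x"
        using G(2)[of k x] G(3)[of x k] r
        by (cases "norm x \<le> \<rho>'") (auto intro!: ennreal_leI powr_mono2)
    qed
    show "AE x in lebesgue. (\<lambda>k. ennreal (norm (G k x) powr r)) \<longlonglongrightarrow> ennreal (norm (g x) powr r)"
      using Gl by eventually_elim (use r in \<open>intro tendsto_ennrealI tendsto_powr' tendsto_norm tendsto_const; simp\<close>)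
  qed
  show ?thesis
  proof (rule LIMSEQ_le)
    show "(\<lambda>k. ennreal (norm (\<integral>x. h x * G k x \<partial>lebesgue))) \<longlonglongrightarrow> ennreal (norm (\<integral>x. h x * g x \<partial>lebesgue))"
      by (intro tendsto_ennrealI tendsto_norm l1)
    show "(\<lambda>k. ennreal M * (F + power_integral r (G k))) \<longlonglongrightarrow> ennreal M * (F + power_integral r g)"
      by (intro ennreal_tendsto_cmult tendsto_add tendsto_const l2) simp
    show "\<exists>N. \<forall>n\<ge>N. ennreal (norm (\<integral>x. h x * G n x \<partial>lebesgue)) \<le> ennreal M * (F + power_integral r (G n))"
      using bound[OF G(1)] by blast
  qed
qed

text \<open>The test function is a multiple \<tau> of |h| powr (p' - 2) times the conjugate of h,
  truncated. Since (p' - 1) p = p', the pairing equals \<tau> I and the p-integral of the test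
  function equals \<tau> powr p * I, where I is the truncated p'-integral of h. For the right \<tau>
  the second contribution is absorbed by the first.\<close>

lemma dual_Ip_bound:
  fixes h :: "real^'n \<Rightarrow> complex"
  assumes h: "h \<in> borel_measurable lebesgue" "power_integral p h < \<infinity>" and pp: "1 < p" "1 < p'" "1 / p + 1 / p' = 1"
    and M: "0 < M" and F: "0 \<le> F"
    and bound: "\<And>g. g \<in> test_functions \<Longrightarrow> ennreal (norm (\<integral>x. h x * g x \<partial>lebesgue)) \<le> ennreal M * (ennreal F + power_integral p g)"
  shows "power_integral p' h \<le> ennreal (2 * M / (1 / (2 * M)) powr (1 / (p - 1)) * F)"
proof -
  \<comment> \<open>The solution of \<open>M * \<tau> powr p = \<tau> / 2\<close>, so that exactly
    half of the left-hand side remains after absorption.\<close>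
  define \<tau> where "\<tau> = (1 / (2 * M)) powr (1 / (p - 1))"
  have \<tau>: "0 < \<tau>" using M by (simp add: \<tau>_def)
  have \<tau>p: "M * \<tau> powr p = \<tau> / 2"
  proof -
    have "\<tau> powr p = \<tau> powr (p - 1) * \<tau>" using \<tau> powr_add[of \<tau> "p - 1" 1] by simp
    moreover have "\<tau> powr (p - 1) = 1 / (2 * M)" using M pp by (simp add: \<tau>_def powr_powr)
    ultimately show ?thesis using M by simp
  qed
  have exps: "(p' - 1) * p = p'" using pp by (simp add: field_simps)
  \<comment> \<open>Truncation in value and in space makes I finite, so that it may be subtracted,
    and makes the test function bounded with bounded support. Monotone convergence removes it at the
    end.\<close>
  define S where "S N = {x. norm (h x) \<le> real N \<and> norm x \<le> real N}" for N
  have S: "S N \<in> sets lebesgue" for N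
  proof -
    have "(\<lambda>x. norm (h x)) \<in> borel_measurable lebesgue" using h(1) by measurable
    from borel_measurable_le[OF this borel_measurable_const, of "real N"]
    have "{x. norm (h x) \<le> real N} \<in> sets lebesgue" by simp
    moreover have "cball 0 (real N) \<in> sets lebesgue" by simp
    ultimately have "{x. norm (h x) \<le> real N} \<inter> cball 0 (real N) \<in> sets lebesgue" by (rule sets.Int)
    moreover have "{x. norm (h x) \<le> real N} \<inter> cball 0 (real N) = S N" by (auto simp: S_def)
    ultimately show ?thesis by simp
  qed
  have main: "(\<integral>\<^sup>+x. ennreal (norm (h x) powr p') * indicator (S N) x \<partial>lebesgue) \<le> ennreal (2 * M / \<tau> * F)" for N
  proof -
    let ?I = "\<integral>\<^sup>+x. ennreal (norm (h x) powr p') * indicator (S N) x \<partial>lebesgue"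
    have "?I \<le> (\<integral>\<^sup>+x. ennreal (real N powr p') * indicator (cball 0 (real N)) x \<partial>(lebesgue :: (real^'n) measure))"
      using pp by (intro nn_integral_mono) (auto simp: S_def indicator_def intro!: ennreal_leI powr_mono2)
    also have "\<dots> < \<infinity>"
      using emeasure_bounded_finite[OF bounded_cball, of "0::real^'n" "real N"]
      by (subst nn_integral_cmult_indicator) (auto simp: ennreal_mult_less_top)
    finally have "?I < \<infinity>" .
    then obtain I where I: "?I = ennreal I" "0 \<le> I" by (cases ?I) auto
    define g where "g x = (if x \<in> S N then complex_of_real (\<tau> * norm (h x) powr (p' - 2)) * cnj (h x) else 0)" for x
    have norm_g: "norm (g x) = (if x \<in> S N then \<tau> * norm (h x) powr (p' - 1) else 0)" for x
    proof (cases "h x = 0")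
      case False
      then have "norm (h x) powr (p' - 2) * norm (h x) = norm (h x) powr (p' - 1)"
        using powr_add[of "norm (h x)" "p' - 2" 1] by simp
      then show ?thesis using \<tau> by (simp add: g_def norm_mult mult.assoc)
    qed (simp add: g_def)
    have hg: "h x * g x = complex_of_real (\<tau> * (norm (h x) powr p' * indicator (S N) x))" for x
    proof (cases "h x = 0")
      case False
      then have "norm (h x) powr (p' - 2) * norm (h x) ^ 2 = norm (h x) powr p'"
        using powr_add[of "norm (h x)" "p' - 2" 2] by (simp add: powr_numeral)
      then have e: "\<tau> * norm (h x) powr (p' - 2) * norm (h x) ^ 2 = \<tau> * norm (h x) powr p'" by simp
      have "complex_of_real (\<tau> * norm (h x) powr (p' - 2)) * (h x * cnj (h x)) = complex_of_real (\<tau> * norm (h x) powr p')"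
        unfolding complex_norm_square[symmetric] of_real_mult[symmetric] e ..
      then show ?thesis by (simp add: g_def indicator_def mult.left_commute)
    qed (simp add: g_def)
    have gm: "g \<in> borel_measurable lebesgue"
    proof -
      have "cnj \<in> borel_measurable borel" by (intro borel_measurable_continuous_onI continuous_intros)
      then have c: "(\<lambda>x. cnj (h x)) \<in> borel_measurable lebesgue" by (rule measurable_compose[OF h(1)])
      have "(\<lambda>z. complex_of_real (\<tau> * norm z powr (p' - 2))) \<in> borel_measurable borel" by measurable
      then have "(\<lambda>x. complex_of_real (\<tau> * norm (h x) powr (p' - 2))) \<in> borel_measurable lebesgue" by (rule measurable_compose[OF h(1)])
      from borel_measurable_times[OF this c] show ?thesis
        unfolding g_def[abs_def] using S[of N] by (intro measurable_If_set) auto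
    qed
    \<comment> \<open>The summand 1 keeps the bound positive even for N = 0; the radius
      \<open>real N + 1\<close> below has the same reason.\<close>
    define B where "B = \<tau> * real N powr (p' - 1) + 1"
    have B: "0 < B" using \<tau> by (simp add: B_def add_nonneg_pos)
    have gB: "norm (g x) \<le> B" for x
    proof (cases "x \<in> S N")
      case True
      then have "norm (h x) powr (p' - 1) \<le> real N powr (p' - 1)" using pp by (intro powr_mono2) (auto simp: S_def)
      then have "\<tau> * norm (h x) powr (p' - 1) \<le> \<tau> * real N powr (p' - 1)" using \<tau> by (intro mult_left_mono) auto
      then show ?thesis using True by (simp add: norm_g B_def)
    qed (use B norm_g in simp)
    have "ennreal (norm (\<integral>x. h x * g x \<partial>lebesgue)) \<le> ennreal M * (ennreal F + power_integral p g)"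
    proof (rule pairing_bound_extend[OF h pp bound _ gm B gB])
      show "0 < p" using pp by simp
      show "0 < real N + 1" by simp
      show "g x = 0" if "real N + 1 < norm x" for x using that by (auto simp: g_def S_def)
    qed
    moreover have "power_integral p g = ennreal (\<tau> powr p * I)"
    proof -
      have "power_integral p g = (\<integral>\<^sup>+x. ennreal (\<tau> powr p) * (ennreal (norm (h x) powr p') * indicator (S N) x) \<partial>lebesgue)"
        unfolding power_integral_def norm_g using \<tau> pp exps
        by (intro nn_integral_cong) (auto simp: powr_mult powr_powr ennreal_mult')
      also have "\<dots> = ennreal (\<tau> powr p) * ?I"
        using S[of N] by (intro nn_integral_cmult borel_measurable_times_ennreal norm_powr_measurable h borel_measurable_indicator)
      finally show ?thesis using I by (simp add: ennreal_mult')
    qed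
    moreover have "(\<integral>x. h x * g x \<partial>lebesgue) = complex_of_real (\<tau> * I)"
    proof -
      have m: "(\<lambda>x. norm (h x) powr p' * indicator (S N) x) \<in> borel_measurable lebesgue"
        using S[of N] h(1) by (intro borel_measurable_times borel_measurable_indicator) measurable
      have "has_bochner_integral lebesgue (\<lambda>x. norm (h x) powr p' * indicator (S N) x) I"
      proof (rule has_bochner_integral_nn_integral[OF m _ I(2)])
        show "(\<integral>\<^sup>+x. ennreal (norm (h x) powr p' * indicator (S N) x) \<partial>lebesgue) = ennreal I"
          unfolding I(1)[symmetric] by (intro nn_integral_cong) (auto simp: indicator_def)
      qed auto
      from has_bochner_integral_of_real[OF has_bochner_integral_mult_right[OF this, of \<tau>]]
      show ?thesis unfolding hg by (rule has_bochner_integral_integral_eq)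
    qed
    ultimately have "ennreal (\<tau> * I) \<le> ennreal M * (ennreal F + ennreal (\<tau> powr p * I))"
      using \<tau> I(2) by (simp add: norm_mult)
    also have "\<dots> = ennreal (M * F + M * \<tau> powr p * I)"
      using M F I(2) by (simp add: ennreal_mult'[symmetric] ennreal_plus[symmetric] distrib_left mult.assoc del: ennreal_plus)
    finally have "\<tau> * I \<le> M * F + \<tau> / 2 * I"
      unfolding \<tau>p using M F I(2) \<tau> by (subst (asm) ennreal_le_iff) auto
    then have "I \<le> 2 * M / \<tau> * F" using \<tau> by (simp add: field_simps)
    then show ?thesis using I by (simp add: ennreal_leI)
  qed
  have "power_integral p' h = (\<integral>\<^sup>+x. (SUP N. ennreal (norm (h x) powr p') * indicator (S N) x) \<partial>lebesgue)"
    unfolding power_integral_def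
  proof (rule nn_integral_cong)
    fix x
    obtain N0 :: nat where N0: "max (norm (h x)) (norm x) \<le> real N0" using real_arch_simple by blast
    show "ennreal (norm (h x) powr p') = (SUP N. ennreal (norm (h x) powr p') * indicator (S N) x)"
    proof (rule antisym)
      have "x \<in> S N0" using N0 by (simp add: S_def)
      then show "ennreal (norm (h x) powr p') \<le> (SUP N. ennreal (norm (h x) powr p') * indicator (S N) x)"
        by (intro SUP_upper2[of N0]) auto
      show "(SUP N. ennreal (norm (h x) powr p') * indicator (S N) x) \<le> ennreal (norm (h x) powr p')"
        by (intro SUP_least) (auto simp: indicator_def)
    qed
  qed
  also have "\<dots> = (SUP N. \<integral>\<^sup>+x. ennreal (norm (h x) powr p') * indicator (S N) x \<partial>lebesgue)"
  proof (rule nn_integral_monotone_convergence_SUP)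
    show "incseq (\<lambda>N x. ennreal (norm (h x) powr p') * indicator (S N) x)"
    proof (intro incseq_SucI le_funI mult_left_mono)
      fix N x show "indicator (S N) x \<le> (indicator (S (Suc N)) x :: ennreal)" by (auto simp: indicator_def S_def)
    qed simp
    show "(\<lambda>x. ennreal (norm (h x) powr p') * indicator (S N) x) \<in> borel_measurable lebesgue" for N
      using S[of N] by (intro borel_measurable_times_ennreal norm_powr_measurable h borel_measurable_indicator)
  qed
  also have "\<dots> \<le> ennreal (2 * M / \<tau> * F)" by (intro SUP_least main)
  finally show ?thesis by (simp add: \<tau>_def)
qed

section \<open>Strong type bounds and their relation to norms\<close>

definition power_integral_bounded :: "(('a::euclidean_space \<Rightarrow> complex) \<Rightarrow> 'a \<Rightarrow> complex) \<Rightarrow> real \<Rightarrow> bool" where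
  "power_integral_bounded T p \<longleftrightarrow> (\<exists>C\<ge>0. \<forall>f\<in>test_functions. power_integral p (T f) \<le> ennreal C * power_integral p f)"

lemma power_integral_bounded_dual:
  fixes T :: "(real^'n \<Rightarrow> complex) \<Rightarrow> real^'n \<Rightarrow> complex"
  assumes T: "cz_operator K A T" and pp: "1 < p" "1 < p'" "1 / p + 1 / p' = 1" and bdd: "power_integral_bounded T p"
  shows "power_integral_bounded T p'"
proof -
  obtain C where C: "0 \<le> C" "\<And>f. f \<in> test_functions \<Longrightarrow> power_integral p (T f) \<le> ennreal C * power_integral p f"
    using bdd unfolding power_integral_bounded_def by blast
  interpret dual_pair K A T p p' C by unfold_locales (use T pp C in auto)
  obtain M where M: "0 < M" "\<And>f g. f \<in> test_functions \<Longrightarrow> g \<in> test_functions \<Longrightarrow>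
      ennreal (norm (pairing T f g)) \<le> ennreal M * (power_integral p' f + power_integral p g)"
    using pairing_dual_le by blast
  let ?C = "2 * M / (1 / (2 * M)) powr (1 / (p - 1))"
  have "power_integral p' (T f) \<le> ennreal ?C * power_integral p' f" if f: "f \<in> test_functions" for f
  proof -
    have "power_integral p' f < \<infinity>" by (rule power_integral_test_finite[OF f]) (use pp in simp)
    then obtain F where F: "power_integral p' f = ennreal F" "0 \<le> F" by (cases "power_integral p' f") auto
    have "power_integral p f < \<infinity>" by (rule power_integral_test_finite[OF f]) (use pp in simp)
    then have fin: "power_integral p (T f) < \<infinity>" using C(2)[OF f] by (simp add: ennreal_mult_less_top order_le_less_trans)
    have "power_integral p' (T f) \<le> ennreal (?C * F)"
    proof (rule dual_Ip_bound[OF Tm[OF f] fin pp M(1) F(2)])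
      fix g :: "real^'n \<Rightarrow> complex" assume "g \<in> test_functions"
      from M(2)[OF f this] show "ennreal (norm (\<integral>x. T f x * g x \<partial>lebesgue)) \<le> ennreal M * (ennreal F + power_integral p g)"
        unfolding pairing_def F(1) .
    qed
    also have "ennreal (?C * F) = ennreal ?C * ennreal F" using M(1) by (intro ennreal_mult') simp
    finally show ?thesis by (simp only: F(1))
  qed
  then show ?thesis unfolding power_integral_bounded_def using M(1) by (intro exI[of _ ?C]) auto
qed

lemma power_integral_bounded_interpolate:
  fixes T :: "(real^'n \<Rightarrow> complex) \<Rightarrow> real^'n \<Rightarrow> complex"
  assumes "ae_linear T" "power_integral_bounded T p0" "power_integral_bounded T p1" "1 \<le> p0" "p0 < p" "p < p1"
  shows "power_integral_bounded T p"
proof -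
  have "bad_bound T p0" using assms bad_bound_of_Ip[of T p0] unfolding power_integral_bounded_def by auto
  moreover have "good_bound T p1" using assms good_bound_of_Ip[of T p1] unfolding power_integral_bounded_def by auto
  ultimately show ?thesis
    using test_function_interpolation[OF assms(1,4,5,6)] unfolding power_integral_bounded_def by metis
qed

lemma Lp_norm_ennreal: "0 < p \<Longrightarrow> Lp_norm (ennreal p) f = ennreal_powr (power_integral p f) (1 / p)"
  by (simp add: Lp_norm_def power_integral_def)

lemma power_integral_bounded_of_Lp:
  assumes "Lp_bounded_with (ennreal p) B T" "0 < p"
  shows "power_integral_bounded T p"
  unfolding power_integral_bounded_def
proof (intro exI[of _ "B powr p"] conjI ballI)
  fix f :: "'a \<Rightarrow> complex" assume f: "f \<in> test_functions"
  have B: "0 \<le> B" using assms by (simp add: Lp_bounded_with_def)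
  obtain x where x: "power_integral p f = ennreal x" "0 \<le> x" using power_integral_test_finite[OF f assms(2)] by (cases "power_integral p f") auto
  have "ennreal_powr (power_integral p (T f)) (1 / p) \<le> ennreal B * ennreal_powr (power_integral p f) (1 / p)"
    using assms f by (simp add: Lp_bounded_with_def Lp_norm_ennreal)
  also have "\<dots> = ennreal (B * x powr (1 / p))"
    using x B by (simp add: ennreal_powr_def ennreal_mult')
  finally have "power_integral p (T f) \<le> ennreal ((B * x powr (1 / p)) powr p)"
    using assms(2) B by (intro ennreal_powr_leD) auto
  also have "(B * x powr (1 / p)) powr p = B powr p * x"
    using assms(2) B x by (simp add: powr_mult powr_powr)
  finally show "power_integral p (T f) \<le> ennreal (B powr p) * power_integral p f"
    using x by (simp add: ennreal_mult')
qed simp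

lemma Lp_bounded_of_Ip:
  assumes "power_integral_bounded T p" "0 < p"
  shows "Lp_bounded (ennreal p) T"
proof -
  obtain C where C: "0 \<le> C" "\<And>f. f \<in> test_functions \<Longrightarrow> power_integral p (T f) \<le> ennreal C * power_integral p f"
    using assms unfolding power_integral_bounded_def by blast
  have "Lp_norm (ennreal p) (T f) \<le> ennreal (C powr (1 / p)) * Lp_norm (ennreal p) f" if f: "f \<in> test_functions" for f
  proof -
    obtain x where x: "power_integral p f = ennreal x" "0 \<le> x" using power_integral_test_finite[OF f assms(2)] by (cases "power_integral p f") auto
    have le: "power_integral p (T f) \<le> ennreal (C * x)" using C(2)[OF f] x C(1) by (simp add: ennreal_mult')
    then obtain z where z: "power_integral p (T f) = ennreal z" "0 \<le> z" by (cases "power_integral p (T f)") (auto simp: top_unique)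
    then have "z \<le> C * x" using le C(1) x by simp
    then have "z powr (1 / p) \<le> (C * x) powr (1 / p)" using z assms(2) by (intro powr_mono2) auto
    then show ?thesis
      using z x C(1) assms(2) by (simp add: Lp_norm_ennreal ennreal_powr_def powr_mult ennreal_mult'[symmetric] ennreal_leI)
  qed
  then show ?thesis unfolding Lp_bounded_def Lp_bounded_with_def by (intro exI[of _ "C powr (1 / p)"]) auto
qed

text \<open>If g is bounded by t, then its image is bounded by B t almost everywhere. With
  \<open>L = B\<close> the level set is null, so the constant 0 works for every exponent s.\<close>

lemma good_bound_of_Linfty:
  fixes T :: "('a::euclidean_space \<Rightarrow> complex) \<Rightarrow> 'a \<Rightarrow> complex"
  assumes lin: "ae_linear T" and B: "Lp_bounded_with \<infinity> B T"
  shows "good_bound T s"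
  unfolding good_bound_def
proof (rule exI[of _ B], rule exI[of _ "0::real"], intro conjI allI impI ballI)
  fix t :: real and g :: "'a \<Rightarrow> complex"
  assume t: "0 < t" and g: "g \<in> test_functions" and gt: "\<forall>x. norm (g x) \<le> t"
  have B0: "0 \<le> B" using B by (simp add: Lp_bounded_with_def)
  have "(\<lambda>x. ennreal (norm (g x))) \<in> borel_measurable lebesgue" using test_lebesgue[OF g] by measurable
  then have "Lp_norm \<infinity> g \<le> ennreal t"
    using gt by (simp add: Lp_norm_def) (intro esssup_I AE_I2 ennreal_leI, auto)
  moreover have "Lp_norm \<infinity> (T g) \<le> ennreal B * Lp_norm \<infinity> g" using B g by (simp add: Lp_bounded_with_def)
  ultimately have "Lp_norm \<infinity> (T g) \<le> ennreal B * ennreal t" by (meson mult_left_mono order_trans zero_le)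
  then have le: "esssup lebesgue (\<lambda>x. ennreal (norm (T g x))) \<le> ennreal (B * t)"
    using B0 by (simp add: Lp_norm_def ennreal_mult')
  have "AE x in lebesgue. ennreal (norm (T g x)) \<le> esssup lebesgue (\<lambda>x. ennreal (norm (T g x)))" by (rule esssup_AE)
  then have "AE x in lebesgue. x \<notin> {x. B * t < norm (T g x)}"
  proof eventually_elim
    case (elim x)
    then have "ennreal (norm (T g x)) \<le> ennreal (B * t)" using le by (rule order_trans)
    then show ?case using B0 t by (simp add: not_less)
  qed
  moreover have "{x. B * t < norm (T g x)} \<in> sets lebesgue"
  proof -
    have "(\<lambda>x. norm (T g x)) \<in> borel_measurable lebesgue" using ae_linear_measurable[OF lin g] by measurable
    from borel_measurable_less[OF borel_measurable_const this, of "B * t"] show ?thesis by simp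
  qed
  ultimately have "emeasure lebesgue {x. B * t < norm (T g x)} = 0" by (simp add: AE_iff_null_sets null_setsD1)
  then show "emeasure lebesgue {x. B * t < norm (T g x)} \<le> ennreal (0 * t powr (- s)) * power_integral s g" by simp
qed (use B in \<open>auto simp: Lp_bounded_with_def\<close>)

section \<open>Boundedness in the full range of exponents\<close>

lemma ennreal_between_real:
  fixes a b :: ennreal
  assumes "a < b" obtains r where "0 \<le> r" "a < ennreal r" "ennreal r < b"
proof -
  obtain z where z: "a < z" "z < b" using dense[OF assms] by blast
  then have "z < \<infinity>" by (metis infinity_ennreal_def less_top order_less_trans top.not_eq_extremum)
  then show ?thesis using z that by (cases z) auto
qed

lemma conjugate_exponent:
  fixes p :: real
  assumes "1 < p"
  shows "1 < p / (p - 1)" "1 / p + 1 / (p / (p - 1)) = 1"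
  using assms by (auto simp: field_simps)

text \<open>Both sides of the first equivalence say 1/p + 1/r < 1, and both sides of the second say
  1/p + 1/r > 1; these conditions are symmetric in p and r.\<close>

lemma conjugate_exponent_swap:
  fixes p r :: real
  assumes "1 < p" "1 < r"
  shows "r / (r - 1) < p \<longleftrightarrow> p / (p - 1) < r" "p < r / (r - 1) \<longleftrightarrow> r < p / (p - 1)"
  using assms by (simp_all add: field_simps)

theorem corollary1:
  fixes q q' s s' :: ennreal and A B :: real
    and K :: "real^'n \<Rightarrow> complex"
    and D :: "(real^'n \<Rightarrow> complex) set"
    and T :: "(real^'n \<Rightarrow> complex) \<Rightarrow> (real^'n \<Rightarrow> complex)"
  assumes "1 \<le> q" and "q < \<infinity>" and "holder_conjugate q q'"
    and "K \<in> hormander_class q'"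
    and "\<forall>x. x \<noteq> 0 \<longrightarrow> norm (K x) \<le> A / norm x ^ CARD('n)"
    and "singular_integral_operator K D T"
    and "q < s" and "Lp_bounded_with s B T"
    and "holder_conjugate s s'"
  shows "\<forall>p. min s' q < p \<and> p < max q' s \<longrightarrow> Lp_bounded p T"
proof (intro allI impI, elim conjE)
  fix p :: ennreal assume low: "min s' q < p" and high: "p < max q' s"
  obtain K0 where K0: "K0 \<in> borel_measurable borel" "\<And>x. norm (K0 x) \<le> A / norm x ^ CARD('n)" "AE x in lborel. K x = K0 x"
    using borel_kernel[of K A] assms(4,5) unfolding hormander_class_def by blast
  have T: "cz_operator K0 A T" by (rule cz_operator_of_singular_integral[OF assms(6) K0])
  then have lin: "ae_linear T" by (simp add: cz_operator_def)
  obtain a where a: "q = ennreal a" "1 \<le> a"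
    using assms(1,2) by (cases q) (auto simp flip: ennreal_1)
  have "hormander_const q' K0 < \<infinity>"
    using assms(4) hormander_inner_cong_AE[OF K0(3)] unfolding hormander_class_def hormander_const_def by simp
  then have "kernel_averages_bounded a K0"
    using kernel_averages_bounded_of_hormander[OF K0(1) a(2)] assms(3) a(1) by blast
  then have bad: "bad_bound T a" by (rule bad_bound_of_kernel[OF T a(2)])
  have between: "power_integral_bounded T r" if r: "a < r" "ennreal r < s" for r
  proof -
    \<comment> \<open>For an infinite s, any finite exponent above r can play the part of the upper
      endpoint.\<close>
    obtain s0 where "r < s0" "good_bound T s0"
    proof (cases s)
      case top
      then have "good_bound T (r + 1)" using good_bound_of_Linfty[OF lin] assms(8) by simp
      then show ?thesis using that[of "r + 1"] by simp
    next
      case (real s0)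
      then have "r < s0" using r a(2) by (simp add: ennreal_less_iff)
      moreover have "power_integral_bounded T s0" using power_integral_bounded_of_Lp[of s0 B T] assms(8) real \<open>r < s0\<close> r a(2) by simp
      then have "good_bound T s0"
        using good_bound_of_Ip[OF lin, of s0] \<open>r < s0\<close> r a(2) unfolding power_integral_bounded_def by auto
      ultimately show ?thesis using that by blast
    qed
    then show ?thesis
      using test_function_interpolation[OF lin a(2) r(1) _ _ bad] unfolding power_integral_bounded_def by metis
  qed
  have dual: "power_integral_bounded T (r / (r - 1))" if "power_integral_bounded T r" "1 < r" for r
    using power_integral_bounded_dual[OF T that(2) conjugate_exponent(1,2)[OF that(2)] that(1)] .
  have s'_ge: "1 \<le> s'"
    using assms(9) by (cases rule: holder_conjugate_cases) (auto simp flip: ennreal_1)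
  \<comment> \<open>Both s' and q are at least 1, and p lies strictly below an element of
    \<open>ennreal\<close>. Hence p is a real number above 1 and has a real conjugate.\<close>
  have "1 < p" using low s'_ge assms(1) by (auto simp: min_def split: if_splits)
  moreover have "p < \<infinity>" using high by (metis infinity_ennreal_def order_less_le_trans top_greatest)
  ultimately obtain t where t: "p = ennreal t" "1 < t"
    by (cases p) (auto simp flip: ennreal_1 simp: ennreal_less_iff)
  define t' where "t' = t / (t - 1)"
  have t': "1 < t'" "1 / t + 1 / t' = 1" using conjugate_exponent[OF t(2)] by (auto simp: t'_def)
  have between_dual: "power_integral_bounded T (r / (r - 1))" if "a < r" "ennreal r < s" for r
    using dual[OF between[OF that]] that a(2) by simp
  \<comment> \<open>Interpolation needs a good exponent on each side of p. Below p it can be taken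
    in (q, s) if q < p. Otherwise s' < p, which means t' < s, and the conjugate of an r in (q, s)
    with r > t' lies below t.\<close>
  have "\<exists>l. 1 \<le> l \<and> l < t \<and> power_integral_bounded T l"
  proof (cases "q < p")
    case True
    then have "q < min p s" using assms(7) by simp
    then obtain l where "q < ennreal l" "ennreal l < min p s" "0 \<le> l" using ennreal_between_real by blast
    then have "a < l" "l < t" "ennreal l < s" using a t by (auto simp: ennreal_less_iff)
    then show ?thesis using between[of l] a(2) by (intro exI[of _ l]) auto
  next
    case False
    then have sp: "s' < p" using low by (auto simp: min_def split: if_splits)
    from assms(9) have "ennreal t' < s"
    proof (cases rule: holder_conjugate_cases)
      case one_top then show ?thesis using assms(1,7) by simp
    next
      case (real x y)
      then have "y < t" using sp t by (simp add: ennreal_less_iff)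
      then have "1 / t < 1 / y" using real by (simp add: frac_less2)
      then have "1 / x < 1 / t'" using t'(2) real by linarith
      then have "t' < x" using real t' by (simp add: divide_less_eq less_divide_eq split: if_splits)
      then show ?thesis using real t' by (simp add: ennreal_less_iff)
    qed simp
    then have "max q (ennreal t') < s" using assms(7) by simp
    then obtain r where "max q (ennreal t') < ennreal r" "ennreal r < s" "0 \<le> r" using ennreal_between_real by blast
    then have r: "a < r" "t' < r" "ennreal r < s" using a t' by (auto simp: ennreal_less_iff)
    then have "1 < r" using a by simp
    then have "r / (r - 1) < t" "1 < r / (r - 1)"
      using r conjugate_exponent_swap(1)[OF t(2), of r] conjugate_exponent(1)[of r] by (auto simp: t'_def)
    then show ?thesis using between_dual[OF r(1,3)] by (intro exI[of _ "r / (r - 1)"]) auto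
  qed
  \<comment> \<open>Above p the exponent can be taken in (q, s) if p < s. Otherwise p < q', which
    means q < t', and the conjugate of an r in (q, s) with r < t' lies above t.\<close>
  moreover have "\<exists>u. t < u \<and> power_integral_bounded T u"
  proof (cases "p < s")
    case True
    then have "max q p < s" using assms(7) by simp
    then obtain u where "max q p < ennreal u" "ennreal u < s" "0 \<le> u" using ennreal_between_real by blast
    then have "a < u" "t < u" "ennreal u < s" using a t by (auto simp: ennreal_less_iff)
    then show ?thesis using between[of u] by blast
  next
    case False
    then have pq: "p < q'" using high by (auto simp: max_def split: if_splits)
    from assms(3) have "q < ennreal t'"
    proof (cases rule: holder_conjugate_cases)
      case top_one then show ?thesis using assms(2) by simp
    next
      case one_top then show ?thesis using t' by (simp flip: ennreal_1 add: ennreal_less_iff)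
    next
      case (real x y)
      then have "t < y" using pq t by (simp add: ennreal_less_iff)
      then have "1 / y < 1 / t" using t by (simp add: frac_less2)
      then have "1 / t' < 1 / x" using t'(2) real by linarith
      then have "x < t'" using real t' by (simp add: divide_less_eq less_divide_eq split: if_splits)
      then show ?thesis using real by (simp add: ennreal_less_iff)
    qed
    then have "q < min s (ennreal t')" using assms(7) by simp
    then obtain r where "q < ennreal r" "ennreal r < min s (ennreal t')" "0 \<le> r" using ennreal_between_real by blast
    then have r: "a < r" "r < t'" "ennreal r < s" using a t' by (auto simp: ennreal_less_iff)
    then have "t < r / (r - 1)"
      using a conjugate_exponent_swap(2)[OF t(2), of r] by (auto simp: t'_def)
    then show ?thesis using between_dual[OF r(1,3)] by blast
  qed
  ultimately have "power_integral_bounded T t" using power_integral_bounded_interpolate[OF lin] by blast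
  then show "Lp_bounded p T" using Lp_bounded_of_Ip[of T t] t by simp
qed

end
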